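(* Let $Y$ be a filling with positive integers of a skew shape $\lambda/\mu$, and assume that $G_{\lambda/\mu}$ is connected. Then $I(Y)$ is unmixed if and only if $I_{\lambda/\mu}$ is unmixed and the following conditions hold, where $\lambda/\mu=B_1\cup\cdots\cup B_t$ is the decomposition of the unmixed shape $\lambda/\mu$ into prime unmixed shapes: (1) $Y$ is constant on each block of $\lambda/\mu$ (that is, on each block of each $B_i$); (2) on each upper triangular prime shape $B_i$, $Y$ is weakly increasing along both rows and columns; (3) on each lower triangular prime shape $B_i$, $Y$ is weakly decreasing along both rows and columns.
   Context: Let $\mathrm{k}$ be a field. A skew shape $\lambda/\mu$ is a pair of sequences of integers $\lambda=(\lambda_1\ge\cdots\ge\lambda_n)$ and $\mu=(\mu_1\ge\cdots\ge\mu_n)$ with $\lambda_i>\mu_i\ge 0$ for all $i$ and $\mu_n=0$. It is identified with its diagram, the set of boxes $(i,j)$ with $1\le i\le n$, $\mu_i+1\le j\le\lambda_i$ (rows numbered from top to bottom, columns from left to right). Put $m=\lambda_1$ and $S=\mathrm{k}[x_1,\ldots,x_n,y_1,\ldots,y_m]$. A filling $Y$ assigns a positive integer $w(i,j)$ to each box $(i,j)$. The skew tableau ideal is $I(Y)=((x_iy_j)^{w(i,j)}\mid 1\le i\le n,\ \mu_i+1\le j\le\lambda_i)\subset S$, and the skew Ferrers ideal $I_{\lambda/\mu}$ is the one with all $w(i,j)=1$. $G_{\lambda/\mu}$ is the bipartite graph on $\{x_1,\ldots,x_n\}\cup\{y_1,\ldots,y_m\}$ with edges $\{x_i,y_j\}$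 for the boxes $(i,j)$. For $\mu=0$ one writes $I_\lambda$. An ideal $I$ is unmixed if $\dim(S/P)=\dim(S/I)$ for every associated prime $P$ of $S/I$. A partition $\lambda$ is unmixed if $I_\lambda$ is. "Increasing/decreasing along rows and columns" is with respect to reading left to right and top to bottom. Blocks. The Ferrers diagram of a partition $\lambda$ with conjugate $\lambda'$ is cut by the horizontal lines at depths $\lambda'_j$ and the vertical lines at widths $\lambda_i$ into rectangular regions called the blocks of $\lambda$ (rows are grouped into strips of rows of equal length, columns into strips of columns of equal length, and a block is the intersection of a row strip and a column strip, when contained in the diagram). A corner block is a block having no adjacent block to its right or below it. The extremal blocks are the top-right and the bottom-left corner blocks. Prime unmixed shapes. An upper triangular prime unmixed shape is (a translate of) the Ferrers diagram of an unmixed partition. A lower triangular prime unmixed shape is (a translate of) the image of such a diagram under reflection in the diagonal line running from bottom-left to top-right (equivalently, the $180^\circ$ rotation of the diagram of an unmixed partition); its blocks and its top-right and bottom-left extremal blocks are the images of those of the original diagram. Decomposition. If $G_{\lambda/\mu}$ is connected and $I_{\lambda/\mu}$ is unmixed, then $\lambda/\mu=B_1\cup\cdots\cup B_t$ for prime unmixed shapes $B_i$, nonsquare if $t>1$, such that for $1\le i<t$ the shapes $B_i,B_{i+1}$ are of alternating type (upper/lower triangular) and $B_i\cap B_{i+1}$ is the bottom-left extremal block of $B_i$ and the top-right extremal block of $B_{i+1}$; this decomposition is unique. The $B_i$ are the prime shapes of $\lambda/\mu$. (If $\lambda/\mu$ is a square, then $t=1$ and it has a single block.) *)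

theory Defs
  imports
    "HOL-Algebra.QuotRing"
    "HOL-Library.Poly_Mapping"
    "HOL-Library.Extended_Nat"
begin

section \<open>Polynomial rings\<close>

datatype var = X nat | Y nat

text \<open>A polynomial maps each monomial (a finitely supported exponent vector) to its coefficient.\<close>

type_synonym 'k mpoly = "(var \<Rightarrow>\<^sub>0 nat) \<Rightarrow>\<^sub>0 'k"

text \<open>The ring of polynomials in the variables \<open>V\<close>, as a subring of the ring in all variables.\<close>

definition poly_ring :: "var set \<Rightarrow> 'k::field mpoly ring" where
  "poly_ring V = \<lparr>carrier = {p. \<forall>t\<in>Poly_Mapping.keys p. Poly_Mapping.keys t \<subseteq> V},
     monoid.mult = (*), one = 1, zero = 0, add = (+)\<rparr>"

definition variable :: "var \<Rightarrow> 'k::field mpoly" where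
  "variable v = Poly_Mapping.single (Poly_Mapping.single v 1) 1"

lemma cring_poly_ring: "cring (poly_ring V :: 'k::field mpoly ring)"
proof -
  let ?C = "{p :: 'k mpoly. \<forall>t\<in>Poly_Mapping.keys p. Poly_Mapping.keys t \<subseteq> V}"
  have add: "p + q \<in> ?C" if "p \<in> ?C" "q \<in> ?C" for p q
    using that Poly_Mapping.keys_add[of p q] by blast
  have mult: "p * q \<in> ?C" if "p \<in> ?C" "q \<in> ?C" for p q
  proof (intro CollectI ballI)
    fix t assume "t \<in> Poly_Mapping.keys (p * q)"
    then obtain a b where "t = a + b" "a \<in> Poly_Mapping.keys p" "b \<in> Poly_Mapping.keys q"
      using keys_mult[of p q] by blast
    then show "Poly_Mapping.keys t \<subseteq> V"
      using that Poly_Mapping.keys_add[of a b] by blast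
  qed
  have neg: "\<exists>q\<in>?C. q + p = 0" if "p \<in> ?C" for p
    by (rule bexI[of _ "- p"]) (use that in simp_all)
  have zero: "0 \<in> ?C" and one: "1 \<in> ?C"
    by simp_all
  show ?thesis
    unfolding poly_ring_def
  proof (rule cringI)
    show "abelian_group \<lparr>carrier = ?C, monoid.mult = (*), one = 1, zero = 0, add = (+)\<rparr>"
      by (rule abelian_groupI; unfold ring.simps monoid.simps partial_object.simps)
        (rule add neg zero add.assoc add.commute add_0_left; assumption?)+
    show "comm_monoid \<lparr>carrier = ?C, monoid.mult = (*), one = 1, zero = 0, add = (+)\<rparr>"
      by (rule comm_monoidI; unfold monoid.simps partial_object.simps)
        (rule mult one mult.assoc mult.commute mult_1_left; assumption?)+
  qed (simp only: ring.simps monoid.simps distrib_right)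
qed


section \<open>Krull dimension, associated primes and unmixed ideals\<close>

text \<open>The supremum of the lengths of chains of prime ideals. The zero ring gets dimension 0 here;
  below the dimension is only taken of quotients by proper ideals.\<close>

definition krull_dim :: "('a, 'b) ring_scheme \<Rightarrow> enat" where
  "krull_dim R = Sup {enat l | l. \<exists>Q :: nat \<Rightarrow> 'a set.
     (\<forall>i\<le>l. primeideal (Q i) R) \<and> (\<forall>i<l. Q i \<subset> Q (Suc i))}"

text \<open>The associated primes of the \<open>R\<close>-module \<open>R/I\<close>: the primes that are annihilators of an
  element \<open>z\<close> of \<open>R/I\<close>; the element \<open>a\<close> of \<open>R\<close> acts on \<open>z\<close> as its class \<open>I +> a\<close>.\<close>

definition associated_primes :: "('a, 'b) ring_scheme \<Rightarrow> 'a set \<Rightarrow> 'a set set" where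
  "associated_primes R I = {P. primeideal P R \<and> (\<exists>z\<in>carrier (R Quot I).
     P = {a \<in> carrier R. (I +>\<^bsub>R\<^esub> a) \<otimes>\<^bsub>R Quot I\<^esub> z = \<zero>\<^bsub>R Quot I\<^esub>})}"

definition unmixed :: "('a, 'b) ring_scheme \<Rightarrow> 'a set \<Rightarrow> bool" where
  "unmixed R I \<longleftrightarrow> (\<forall>P\<in>associated_primes R I. krull_dim (R Quot P) = krull_dim (R Quot I))"


section \<open>Skew shapes\<close>

text \<open>Sequences are functions of which only the values at \<open>1, \<dots>, n\<close> matter; a box is a pair
  (row, column).\<close>

definition skew_shape :: "nat \<Rightarrow> (nat \<Rightarrow> nat) \<Rightarrow> (nat \<Rightarrow> nat) \<Rightarrow> bool" where
  "skew_shape n lam mu \<longleftrightarrow> 1 \<le> n \<and> antimono_on {1..n} lam \<and> antimono_on {1..n} mu \<and>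
     (\<forall>i\<in>{1..n}. mu i < lam i) \<and> mu n = 0"

definition skew_diagram :: "nat \<Rightarrow> (nat \<Rightarrow> nat) \<Rightarrow> (nat \<Rightarrow> nat) \<Rightarrow> (nat \<times> nat) set" where
  "skew_diagram n lam mu = {(i, j). 1 \<le> i \<and> i \<le> n \<and> mu i + 1 \<le> j \<and> j \<le> lam i}"

definition skew_vars :: "nat \<Rightarrow> (nat \<Rightarrow> nat) \<Rightarrow> var set" where
  "skew_vars n lam = X ` {1..n} \<union> Y ` {1..lam 1}"

definition skew_tableau_ideal ::
    "nat \<Rightarrow> (nat \<Rightarrow> nat) \<Rightarrow> (nat \<Rightarrow> nat) \<Rightarrow> (nat \<times> nat \<Rightarrow> nat) \<Rightarrow> 'k::field mpoly set" where
  "skew_tableau_ideal n lam mu w = Idl\<^bsub>poly_ring (skew_vars n lam)\<^esub>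
     {(variable (X i) * variable (Y j)) ^ w (i, j) | i j. (i, j) \<in> skew_diagram n lam mu}"

definition skew_ferrers_ideal ::
    "nat \<Rightarrow> (nat \<Rightarrow> nat) \<Rightarrow> (nat \<Rightarrow> nat) \<Rightarrow> 'k::field mpoly set" where
  "skew_ferrers_ideal n lam mu = skew_tableau_ideal n lam mu (\<lambda>_. 1)"

definition skew_edges :: "nat \<Rightarrow> (nat \<Rightarrow> nat) \<Rightarrow> (nat \<Rightarrow> nat) \<Rightarrow> (var \<times> var) set" where
  "skew_edges n lam mu = (\<Union>(i, j)\<in>skew_diagram n lam mu. {(X i, Y j), (Y j, X i)})"

definition skew_graph_connected :: "nat \<Rightarrow> (nat \<Rightarrow> nat) \<Rightarrow> (nat \<Rightarrow> nat) \<Rightarrow> bool" where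
  "skew_graph_connected n lam mu \<longleftrightarrow>
     (\<forall>u\<in>skew_vars n lam. \<forall>v\<in>skew_vars n lam. (u, v) \<in> (skew_edges n lam mu)\<^sup>*)"


section \<open>Partitions and their blocks\<close>

definition unmixed_partition :: "'k::field itself \<Rightarrow> nat \<Rightarrow> (nat \<Rightarrow> nat) \<Rightarrow> bool" where
  "unmixed_partition k n lam \<longleftrightarrow> skew_shape n lam (\<lambda>_. 0) \<and>
     unmixed (poly_ring (skew_vars n lam)) (skew_ferrers_ideal n lam (\<lambda>_. 0) :: 'k mpoly set)"

definition ferrers_diagram :: "nat \<Rightarrow> (nat \<Rightarrow> nat) \<Rightarrow> (nat \<times> nat) set" where
  "ferrers_diagram n lam = skew_diagram n lam (\<lambda>_. 0)"

definition conjugate :: "nat \<Rightarrow> (nat \<Rightarrow> nat) \<Rightarrow> nat \<Rightarrow> nat" where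
  "conjugate n lam j = card {i\<in>{1..n}. j \<le> lam i}"

definition row_strips :: "nat \<Rightarrow> (nat \<Rightarrow> nat) \<Rightarrow> nat set set" where
  "row_strips n lam = {{i'\<in>{1..n}. lam i' = lam i} | i. i \<in> {1..n}}"

definition column_strips :: "nat \<Rightarrow> (nat \<Rightarrow> nat) \<Rightarrow> nat set set" where
  "column_strips n lam =
     {{j'\<in>{1..lam 1}. conjugate n lam j' = conjugate n lam j} | j. j \<in> {1..lam 1}}"

definition blocks :: "nat \<Rightarrow> (nat \<Rightarrow> nat) \<Rightarrow> (nat \<times> nat) set set" where
  "blocks n lam = {R \<times> C | R C. R \<in> row_strips n lam \<and> C \<in> column_strips n lam \<and>
     R \<times> C \<subseteq> ferrers_diagram n lam}"

definition adjacent_right :: "(nat \<times> nat) set \<Rightarrow> (nat \<times> nat) set \<Rightarrow> bool" where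
  "adjacent_right b b' \<longleftrightarrow> b \<noteq> b' \<and> (\<exists>i j. (i, j) \<in> b \<and> (i, j + 1) \<in> b')"

definition adjacent_below :: "(nat \<times> nat) set \<Rightarrow> (nat \<times> nat) set \<Rightarrow> bool" where
  "adjacent_below b b' \<longleftrightarrow> b \<noteq> b' \<and> (\<exists>i j. (i, j) \<in> b \<and> (i + 1, j) \<in> b')"

definition corner_blocks :: "nat \<Rightarrow> (nat \<Rightarrow> nat) \<Rightarrow> (nat \<times> nat) set set" where
  "corner_blocks n lam = {b \<in> blocks n lam.
     \<not> (\<exists>b'\<in>blocks n lam. adjacent_right b b' \<or> adjacent_below b b')}"

definition top_right_block :: "nat \<Rightarrow> (nat \<Rightarrow> nat) \<Rightarrow> (nat \<times> nat) set" where
  "top_right_block n lam = (THE b. b \<in> corner_blocks n lam \<and> (1, lam 1) \<in> b)"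

definition bottom_left_block :: "nat \<Rightarrow> (nat \<Rightarrow> nat) \<Rightarrow> (nat \<times> nat) set" where
  "bottom_left_block n lam = (THE b. b \<in> corner_blocks n lam \<and> (n, 1) \<in> b)"


section \<open>Prime unmixed shapes\<close>

datatype triangle = Upper | Lower

text \<open>A prime shape is recorded by its orientation, the underlying partition (number of parts and the
  parts) and the translation (number of rows and of columns).\<close>

datatype prime_shape =
  Prime_Shape (orientation: triangle) (rows: nat) (parts: "nat \<Rightarrow> nat") (row_offset: nat) (col_offset: nat)

text \<open>For the lower triangular type the box \<open>(i, j)\<close> of the \<open>n \<times> lam 1\<close> bounding box is first
  reflected in the line from bottom left to top right. As \<open>i \<le> n\<close> and \<open>j \<le> lam 1\<close> for the boxes
  of the diagram, no subtraction below is truncated.\<close>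

fun place :: "prime_shape \<Rightarrow> nat \<times> nat \<Rightarrow> nat \<times> nat" where
  "place (Prime_Shape Upper n lam r c) (i, j) = (r + i, c + j)"
| "place (Prime_Shape Lower n lam r c) (i, j) = (r + (lam 1 + 1 - j), c + (n + 1 - i))"

definition boxes_of :: "prime_shape \<Rightarrow> (nat \<times> nat) set" where
  "boxes_of B = place B ` ferrers_diagram (rows B) (parts B)"

definition blocks_of :: "prime_shape \<Rightarrow> (nat \<times> nat) set set" where
  "blocks_of B = (`) (place B) ` blocks (rows B) (parts B)"

definition top_right_of :: "prime_shape \<Rightarrow> (nat \<times> nat) set" where
  "top_right_of B = place B ` top_right_block (rows B) (parts B)"

definition bottom_left_of :: "prime_shape \<Rightarrow> (nat \<times> nat) set" where
  "bottom_left_of B = place B ` bottom_left_block (rows B) (parts B)"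

definition is_square :: "(nat \<times> nat) set \<Rightarrow> bool" where
  "is_square D \<longleftrightarrow> (\<exists>r c s. D = {r + 1..r + s} \<times> {c + 1..c + s})"

text \<open>The shapes are listed from top right to bottom left. The first argument fixes the field over
  which unmixedness of the underlying partitions is meant.\<close>

definition prime_decomposition ::
    "'k::field itself \<Rightarrow> (nat \<times> nat) set \<Rightarrow> prime_shape list \<Rightarrow> bool" where
  "prime_decomposition k D Bs \<longleftrightarrow>
     Bs \<noteq> [] \<and>
     (\<forall>B\<in>set Bs. unmixed_partition k (rows B) (parts B)) \<and>
     D = (\<Union>B\<in>set Bs. boxes_of B) \<and>
     (1 < length Bs \<longrightarrow> (\<forall>B\<in>set Bs. \<not> is_square (boxes_of B))) \<and>
     (\<forall>i. Suc i < length Bs \<longrightarrow>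
        orientation (Bs ! i) \<noteq> orientation (Bs ! Suc i) \<and>
        boxes_of (Bs ! i) \<inter> boxes_of (Bs ! Suc i) = bottom_left_of (Bs ! i) \<and>
        boxes_of (Bs ! i) \<inter> boxes_of (Bs ! Suc i) = top_right_of (Bs ! Suc i))"


section \<open>Fillings\<close>

definition increasing_along :: "(nat \<times> nat) set \<Rightarrow> (nat \<times> nat \<Rightarrow> nat) \<Rightarrow> bool" where
  "increasing_along D w \<longleftrightarrow>
     (\<forall>i j j'. (i, j) \<in> D \<and> (i, j') \<in> D \<and> j \<le> j' \<longrightarrow> w (i, j) \<le> w (i, j')) \<and>
     (\<forall>i i' j. (i, j) \<in> D \<and> (i', j) \<in> D \<and> i \<le> i' \<longrightarrow> w (i, j) \<le> w (i', j))"

definition decreasing_along :: "(nat \<times> nat) set \<Rightarrow> (nat \<times> nat \<Rightarrow> nat) \<Rightarrow> bool" where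
  "decreasing_along D w \<longleftrightarrow>
     (\<forall>i j j'. (i, j) \<in> D \<and> (i, j') \<in> D \<and> j \<le> j' \<longrightarrow> w (i, j) \<ge> w (i, j')) \<and>
     (\<forall>i i' j. (i, j) \<in> D \<and> (i', j) \<in> D \<and> i \<le> i' \<longrightarrow> w (i, j) \<ge> w (i', j))"

end

theory Submission
  imports Defs
begin

text \<open>The associated primes of a monomial ideal are generated by sets of variables, one for each
  irreducible component, so unmixedness says that all these sets have the same size. For a skew
  tableau ideal this forces \<open>lam 1 = n\<close> and puts the antidiagonal into the shape. Number the columns
  from right to left and write \<open>i \<rightarrow> c\<close> if the box of row \<open>i\<close> and column \<open>c\<close> belongs to the shape. Then
  \<open>I(Y)\<close> is unmixed if and only if \<open>\<rightarrow>\<close> is reflexive and \<open>i \<rightarrow> k \<rightarrow> c\<close> implies \<open>i \<rightarrow> c\<close> with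
  \<open>w i c \<le> min (w i k) (w k c)\<close>: otherwise some component contains both variables of index \<open>k\<close> and
  has more than \<open>n\<close> elements. For the constant filling this is a preorder that is convex in the plane.
  Prime shapes are the intervals on which it contains \<open>\<le>\<close> (upper type) or \<open>\<ge>\<close> (lower type), the blocks
  are products of two equivalence classes, and a connected shape is a chain of maximal such intervals
  overlapping in one class. Two composable boxes always lie in a common prime shape, where the
  inequality amounts to the conditions (1)--(3).\<close>

section \<open>Quotient rings\<close>

text \<open>Unmixedness speaks about dimensions of quotients, so lengths of chains of primes have to
  be bounded. Elements separating consecutive primes of a chain have linearly independent power
  products, and the number of monomials available for these bounds the length. From then on only
  supports of components matter. A support meets the two variables of every box, and every set of
  variables that does so contains a support. The set of all rows and the set of all columns are
  themselves supports, whence \<open>lam 1 = n\<close>; a missing antidiagonal box would leave room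
  for a cover by \<open>n - 1\<close> lines. The resulting criterion is used three times: for
  \<open>Y\<close>, for the constant filling, and for the partitions below the prime shapes, so that
  the field disappears from all three. Prime shapes of alternating type suffice for the following
  local reason: if \<open>i \<rightarrow> k\<close> lies in one shape and
  \<open>k \<rightarrow> c\<close> in a neighbouring one, the change of type pushes one of the two
  boxes into the overlap, which belongs to both shapes.\<close>

lemma (in cring) quot_carrier: "carrier (R Quot I) = {I +> r | r. r \<in> carrier R}"
  unfolding FactRing_def A_RCOSETS_def' by auto

lemma (in cring) quot_zero: "\<zero>\<^bsub>R Quot I\<^esub> = I"
  by (simp add: FactRing_def)

text \<open>As \<open>I \<subseteq> Q\<close>, the ideal \<open>Q\<close> is a union of cosets of
  \<open>I\<close>, so any representative decides membership.\<close>

lemma (in cring) coset_in_image_iff: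
  assumes I: "ideal I R" and Q: "ideal Q R" "I \<subseteq> Q" and r: "r \<in> carrier R"
  shows "I +> r \<in> (+>) I ` Q \<longleftrightarrow> r \<in> Q"
proof
  assume "I +> r \<in> (+>) I ` Q"
  then obtain q where q: "q \<in> Q" "I +> r = I +> q" by (rule imageE)
  have "r = \<zero> \<oplus> r" "\<zero> \<in> I"
    using r additive_subgroup.zero_closed[OF ideal.axioms(1)[OF I]] by simp_all
  then have "r \<in> I +> q" unfolding q(2)[symmetric] a_r_coset_def'[of R I r] by blast
  then obtain i where "i \<in> I" "r = i \<oplus> q" unfolding a_r_coset_def'[of R I q] by blast
  then show "r \<in> Q" using q(1) Q(2) additive_subgroup.a_closed[OF ideal.axioms(1)[OF Q(1)]] by blast
qed (rule imageI)

lemma (in cring) primeideal_image_quot: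
  assumes I: "ideal I R" and Q: "primeideal Q R" "I \<subseteq> Q"
  shows "primeideal ((+>) I ` Q) (R Quot I)"
proof (rule primeidealI)
  have Qi: "ideal Q R" using Q(1) by (rule primeideal.axioms(1))
  note mem = coset_in_image_iff[OF I Qi Q(2)]
  show "ideal ((+>) I ` Q) (R Quot I)" using ring_ideal_imp_quot_ideal[OF I Qi] .
  show "cring (R Quot I)" using ideal.quotient_is_cring[OF I is_cring] .
  show "carrier (R Quot I) \<noteq> (+>) I ` Q"
  proof
    assume eq: "carrier (R Quot I) = (+>) I ` Q"
    have "r \<in> Q" if r: "r \<in> carrier R" for r
    proof -
      have "I +> r \<in> carrier (R Quot I)" unfolding quot_carrier using r by blast
      then show ?thesis unfolding eq mem[OF r] .
    qed
    moreover have "Q \<subseteq> carrier R" using ideal.Icarr[OF Qi] by blast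
    ultimately show False using primeideal.I_notcarr[OF Q(1)] by blast
  qed
  fix a b assume "a \<in> carrier (R Quot I)" "b \<in> carrier (R Quot I)"
    and ab: "a \<otimes>\<^bsub>R Quot I\<^esub> b \<in> (+>) I ` Q"
  then obtain x y where xy: "x \<in> carrier R" "y \<in> carrier R" "a = I +> x" "b = I +> y"
    unfolding quot_carrier by blast
  have "a \<otimes>\<^bsub>R Quot I\<^esub> b = I +> (x \<otimes> y)"
    using xy ideal.rcoset_mult_add[OF I] by (simp add: FactRing_def)
  then have "x \<otimes> y \<in> Q" using ab mem[OF m_closed[OF xy(1,2)]] by simp
  then have "x \<in> Q \<or> y \<in> Q"
    using primeideal.I_prime[OF Q(1)] xy by simp
  then show "a \<in> (+>) I ` Q \<or> b \<in> (+>) I ` Q"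
    unfolding xy by (auto intro: imageI)
qed

text \<open>Primes of the quotient correspond to primes above \<open>I\<close>, strict inclusions
  included. Chains can therefore be studied in the polynomial ring itself.\<close>

lemma (in cring) krull_dim_quot:
  assumes I: "ideal I R"
  shows "krull_dim (R Quot I) = Sup {enat l | l. \<exists>Q. (\<forall>i\<le>l. primeideal (Q i) R \<and> I \<subseteq> Q i) \<and>
     (\<forall>i<l. Q i \<subset> Q (Suc i))}"
proof -
  have "(\<exists>Q. (\<forall>i\<le>l. primeideal (Q i) (R Quot I)) \<and> (\<forall>i<l. Q i \<subset> Q (Suc i))) \<longleftrightarrow>
    (\<exists>Q. (\<forall>i\<le>l. primeideal (Q i) R \<and> I \<subseteq> Q i) \<and> (\<forall>i<l. Q i \<subset> Q (Suc i)))" (is "?L \<longleftrightarrow> ?R")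
    for l :: nat
  proof
    assume ?L
    then obtain Q where Q: "\<And>i. i \<le> l \<Longrightarrow> primeideal (Q i) (R Quot I)"
      "\<And>i. i < l \<Longrightarrow> Q i \<subset> Q (Suc i)" by blast
    define P where "P i = {r \<in> carrier R. I +> r \<in> Q i}" for i
    have "primeideal (P i) R" if "i \<le> l" for i
      unfolding P_def
      using ring_hom_ring.primeideal_vimage[OF ideal.rcos_ring_hom_ring[OF I] is_cring Q(1)[OF that]] .
    moreover have "I \<subseteq> P i" if "i \<le> l" for i
    proof
      fix r assume r: "r \<in> I"
      have "ideal (Q i) (R Quot I)" using Q(1)[OF that] by (rule primeideal.axioms(1))
      then have "I \<in> Q i"
        using additive_subgroup.zero_closed[OF ideal.axioms(1)] quot_zero[of I] by metis
      then show "r \<in> P i" unfolding P_def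
        using r ideal.Icarr[OF I r] a_coset_join2[of r I]
          additive_subgroup.a_subgroup[OF ideal.axioms(1)[OF I]] by simp
    qed
    moreover have "P i \<subset> P (Suc i)" if il: "i < l" for i
    proof -
      \<comment> \<open>Strictness survives the preimage because every element of the quotient is
        the class of some representative.\<close>
      obtain z where z: "z \<in> Q (Suc i)" "z \<notin> Q i" using Q(2)[OF il] by blast
      have "ideal (Q (Suc i)) (R Quot I)" using Q(1)[of "Suc i"] that by (auto intro: primeideal.axioms(1))
      then have "z \<in> carrier (R Quot I)" using z(1) by (rule ideal.Icarr)
      then show ?thesis using z Q(2)[OF il] unfolding P_def quot_carrier by blast
    qed
    ultimately show ?R by blast
  next
    assume ?R
    then obtain Q where Q: "\<And>i. i \<le> l \<Longrightarrow> primeideal (Q i) R" "\<And>i. i \<le> l \<Longrightarrow> I \<subseteq> Q i"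
      "\<And>i. i < l \<Longrightarrow> Q i \<subset> Q (Suc i)" by blast
    have "(+>) I ` Q i \<subset> (+>) I ` Q (Suc i)" if il: "i < l" for i
    proof -
      have id: "ideal (Q i) R" "ideal (Q (Suc i)) R" using Q(1) that by (auto intro: primeideal.axioms(1))
      obtain z where z: "z \<in> Q (Suc i)" "z \<notin> Q i" using Q(3)[OF il] by blast
      have zc: "z \<in> carrier R" using ideal.Icarr[OF id(2) z(1)] .
      have "I +> z \<notin> (+>) I ` Q i"
        using coset_in_image_iff[OF I id(1) Q(2) zc] that z by simp
      then show ?thesis using Q(3)[OF il] z by blast
    qed
    then show ?L using primeideal_image_quot[OF I Q(1,2)]
      by (intro exI[of _ "\<lambda>i. (+>) I ` Q i"]) auto
  qed
  then show ?thesis unfolding krull_dim_def by simp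
qed

text \<open>The annihilator of the class of \<open>f\<close> is the colon ideal of \<open>I\<close>
  by \<open>f\<close>.\<close>

lemma (in cring) associated_primes_quot:
  assumes I: "ideal I R"
  shows "associated_primes R I =
    {P. primeideal P R \<and> (\<exists>f\<in>carrier R. P = {a \<in> carrier R. a \<otimes> f \<in> I})}"
proof -
  have "(I +> a) \<otimes>\<^bsub>R Quot I\<^esub> (I +> f) = \<zero>\<^bsub>R Quot I\<^esub> \<longleftrightarrow> a \<otimes> f \<in> I"
    if "a \<in> carrier R" "f \<in> carrier R" for a f
  proof -
    have "(I +> a) \<otimes>\<^bsub>R Quot I\<^esub> (I +> f) = I +> (a \<otimes> f)"
      using that ideal.rcoset_mult_add[OF I] by (simp add: FactRing_def)
    moreover have "I +> (a \<otimes> f) = I \<longleftrightarrow> a \<otimes> f \<in> I"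
      using a_coset_join1[of I "a \<otimes> f"] a_coset_join2[of "a \<otimes> f" I] that
        additive_subgroup.a_subgroup[OF ideal.axioms(1)[OF I]] by auto
    ultimately show ?thesis by (simp add: quot_zero)
  qed
  then have "{a \<in> carrier R. (I +> a) \<otimes>\<^bsub>R Quot I\<^esub> (I +> f) = \<zero>\<^bsub>R Quot I\<^esub>} = {a \<in> carrier R. a \<otimes> f \<in> I}"
    if "f \<in> carrier R" for f using that by auto
  then show ?thesis unfolding associated_primes_def quot_carrier by blast
qed

section \<open>Monomial ideals\<close>

text \<open>A linear order on the variables is what the instance of \<^class>\<open>idom\<close> for \<^typ>\<open>'a \<Rightarrow>\<^sub>0 'b\<close> asks for;
  it plays no other role.\<close>

instantiation var :: linorder
begin

fun less_eq_var :: "var \<Rightarrow> var \<Rightarrow> bool" where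
  "less_eq_var (X i) (X j) \<longleftrightarrow> i \<le> j"
| "less_eq_var (X i) (Y j) \<longleftrightarrow> True"
| "less_eq_var (Y i) (X j) \<longleftrightarrow> False"
| "less_eq_var (Y i) (Y j) \<longleftrightarrow> i \<le> j"

definition less_var :: "var \<Rightarrow> var \<Rightarrow> bool" where
  "less_var u v \<longleftrightarrow> u \<le> v \<and> \<not> v \<le> u"

instance
proof
  fix u v z :: var
  show "u < v \<longleftrightarrow> u \<le> v \<and> \<not> v \<le> u" by (rule less_var_def)
  show "u \<le> u" by (cases u) auto
  show "u \<le> v \<Longrightarrow> v \<le> z \<Longrightarrow> u \<le> z" by (cases u; cases v; cases z) auto
  show "u \<le> v \<Longrightarrow> v \<le> u \<Longrightarrow> u = v" by (cases u; cases v) auto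
  show "u \<le> v \<or> v \<le> u" by (cases u; cases v) auto
qed

end

type_synonym monom = "var \<Rightarrow>\<^sub>0 nat"

section \<open>Supports of polynomials\<close>

lemma poly_mapping_eq_sum_single:
  "p = (\<Sum>t\<in>Poly_Mapping.keys p. Poly_Mapping.single t (Poly_Mapping.lookup p t))"
  by (rule poly_mapping_eqI) (simp add: lookup_sum lookup_single when_def in_keys_iff)

text \<open>Cancellation makes translation by \<open>t\<close> injective, so no two terms of the
  product collide.\<close>

lemma lookup_times_single:
  fixes p :: "'a::cancel_comm_monoid_add \<Rightarrow>\<^sub>0 'b::comm_semiring_1"
  shows "Poly_Mapping.lookup (p * Poly_Mapping.single t c) (s + t) = Poly_Mapping.lookup p s * c"
proof -
  have "p * Poly_Mapping.single t c =
      (\<Sum>u\<in>Poly_Mapping.keys p. Poly_Mapping.single (u + t) (Poly_Mapping.lookup p u * c))"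
    by (subst poly_mapping_eq_sum_single[of p]) (simp add: sum_distrib_right mult_single)
  then show ?thesis by (simp add: lookup_sum lookup_single when_def in_keys_iff)
qed

lemma keys_times_single:
  fixes p :: "'a::cancel_comm_monoid_add \<Rightarrow>\<^sub>0 'b::comm_semiring_1"
  shows "Poly_Mapping.keys (p * Poly_Mapping.single t 1) = (\<lambda>s. s + t) ` Poly_Mapping.keys p"
proof
  show "Poly_Mapping.keys (p * Poly_Mapping.single t 1) \<subseteq> (\<lambda>s. s + t) ` Poly_Mapping.keys p"
    using keys_mult[of p "Poly_Mapping.single t 1"] by auto
  show "(\<lambda>s. s + t) ` Poly_Mapping.keys p \<subseteq> Poly_Mapping.keys (p * Poly_Mapping.single t 1)"
    by (auto simp: in_keys_iff lookup_times_single)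
qed

text \<open>Together with the complementary part this serves as reduction modulo a monomial
  ideal.\<close>

definition restrict_poly :: "'a set \<Rightarrow> ('a \<Rightarrow>\<^sub>0 'b::comm_monoid_add) \<Rightarrow> ('a \<Rightarrow>\<^sub>0 'b)" where
  "restrict_poly A p = (\<Sum>t\<in>Poly_Mapping.keys p \<inter> A. Poly_Mapping.single t (Poly_Mapping.lookup p t))"

lemma lookup_restrict_poly:
  "Poly_Mapping.lookup (restrict_poly A p) t = (if t \<in> A then Poly_Mapping.lookup p t else 0)"
  by (auto simp: restrict_poly_def lookup_sum lookup_single when_def in_keys_iff)

lemma keys_restrict_poly: "Poly_Mapping.keys (restrict_poly A p) = Poly_Mapping.keys p \<inter> A"
  by (auto simp: in_keys_iff lookup_restrict_poly split: if_splits)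

lemma restrict_poly_add_compl: "restrict_poly A p + restrict_poly (- A) p = p"
  by (rule poly_mapping_eqI) (simp add: lookup_add lookup_restrict_poly)

lemma carrier_poly_ring:
  "p \<in> carrier (poly_ring V) \<longleftrightarrow> (\<forall>t\<in>Poly_Mapping.keys p. Poly_Mapping.keys t \<subseteq> V)"
  by (simp add: poly_ring_def)

lemma poly_ring_simps [simp]:
  "x \<otimes>\<^bsub>poly_ring V\<^esub> y = x * y" "\<one>\<^bsub>poly_ring V\<^esub> = 1" "\<zero>\<^bsub>poly_ring V\<^esub> = 0" "x \<oplus>\<^bsub>poly_ring V\<^esub> y = x + y"
  by (simp_all add: poly_ring_def)

lemma ring_poly_ring: "ring (poly_ring V)"
  using cring_poly_ring by (rule cring.axioms(1))

lemma single_in_carrier: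
  "Poly_Mapping.keys t \<subseteq> V \<Longrightarrow> Poly_Mapping.single t c \<in> carrier (poly_ring V)"
  by (simp add: carrier_poly_ring)

lemma poly_ring_closed:
  assumes "p \<in> carrier (poly_ring V)" "q \<in> carrier (poly_ring V)"
  shows "p + q \<in> carrier (poly_ring V)" "p * q \<in> carrier (poly_ring V)" "- p \<in> carrier (poly_ring V)"
proof -
  interpret cring "poly_ring V" by (rule cring_poly_ring)
  show "p + q \<in> carrier (poly_ring V)" "p * q \<in> carrier (poly_ring V)"
    using a_closed[OF assms] m_closed[OF assms] by simp_all
  show "- p \<in> carrier (poly_ring V)" using assms by (simp add: carrier_poly_ring)
qed

lemma a_inv_poly_ring:
  assumes "p \<in> carrier (poly_ring V)"
  shows "\<ominus>\<^bsub>poly_ring V\<^esub> p = - p"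
proof -
  interpret cring "poly_ring V" by (rule cring_poly_ring)
  show ?thesis using minus_equality[of "- p" p] assms poly_ring_closed(3)[OF assms assms] by simp
qed

lemma ideal_poly_ring:
  assumes "ideal Q (poly_ring V)"
  shows "p \<in> Q \<Longrightarrow> p \<in> carrier (poly_ring V)" "0 \<in> Q"
    "p \<in> Q \<Longrightarrow> q \<in> Q \<Longrightarrow> p + q \<in> Q"
    "p \<in> Q \<Longrightarrow> q \<in> carrier (poly_ring V) \<Longrightarrow> p * q \<in> Q"
    "p \<in> Q \<Longrightarrow> q \<in> carrier (poly_ring V) \<Longrightarrow> q * p \<in> Q"
    "p \<in> Q \<Longrightarrow> q \<in> Q \<Longrightarrow> p - q \<in> Q"
proof -
  interpret ideal Q "poly_ring V" by fact
  note sub = additive_subgroup_axioms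
  show c: "p \<in> carrier (poly_ring V)" if "p \<in> Q" for p using Icarr[OF that] .
  show "0 \<in> Q" using additive_subgroup.zero_closed[OF sub] by simp
  show a: "p + q \<in> Q" if "p \<in> Q" "q \<in> Q" for p q using additive_subgroup.a_closed[OF sub that] by simp
  show "p * q \<in> Q" if "p \<in> Q" "q \<in> carrier (poly_ring V)" using I_r_closed[OF that] by simp
  show "q * p \<in> Q" if "p \<in> Q" "q \<in> carrier (poly_ring V)" using I_l_closed[OF that] by simp
  show "p - q \<in> Q" if "p \<in> Q" "q \<in> Q"
  proof -
    have "- q \<in> Q" using additive_subgroup.a_inv_closed[OF sub that(2)] a_inv_poly_ring[OF c[OF that(2)]] by simp
    then show ?thesis using a[OF that(1)] by fastforce
  qed
qed

lemma ideal_poly_ring_sum: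
  assumes "ideal Q (poly_ring V)" "\<And>x. x \<in> A \<Longrightarrow> f x \<in> Q"
  shows "sum f A \<in> Q"
  using assms(2) by (induction A rule: infinite_finite_induct) (auto intro: ideal_poly_ring[OF assms(1)])

lemma primeideal_poly_ring:
  assumes "primeideal Q (poly_ring V)"
  shows "1 \<notin> Q" "p \<in> carrier (poly_ring V) \<Longrightarrow> q \<in> carrier (poly_ring V) \<Longrightarrow> p * q \<in> Q \<Longrightarrow> p \<in> Q \<or> q \<in> Q"
proof -
  interpret primeideal Q "poly_ring V" by fact
  show "1 \<notin> Q" using one_imp_carrier I_notcarr by auto
  show "p \<in> carrier (poly_ring V) \<Longrightarrow> q \<in> carrier (poly_ring V) \<Longrightarrow> p * q \<in> Q \<Longrightarrow> p \<in> Q \<or> q \<in> Q"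
    using I_prime[of p q] by simp
qed

section \<open>Ideals spanned by monomials\<close>

definition monomial_ideal :: "var set \<Rightarrow> monom set \<Rightarrow> 'k::field mpoly set" where
  "monomial_ideal V U = {p \<in> carrier (poly_ring V). Poly_Mapping.keys p \<subseteq> U}"

lemma ideal_monomial_ideal:
  assumes "\<And>s t. s \<in> U \<Longrightarrow> s + t \<in> U"
  shows "ideal (monomial_ideal V U :: 'k::field mpoly set) (poly_ring V)"
proof (rule idealI[OF ring_poly_ring])
  let ?I = "monomial_ideal V U :: 'k mpoly set"
  interpret cring "poly_ring V :: 'k mpoly ring" by (rule cring_poly_ring)
  show "subgroup ?I (add_monoid (poly_ring V))"
  proof (rule add.subgroupI)
    show "?I \<subseteq> carrier (poly_ring V)" by (auto simp: monomial_ideal_def)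
    show "?I \<noteq> {}" using zero_closed by (auto simp: monomial_ideal_def)
    show "\<ominus>\<^bsub>poly_ring V\<^esub> p \<in> ?I" if "p \<in> ?I" for p
      using that a_inv_poly_ring[of p V] poly_ring_closed(3)[of p V p]
      by (simp add: monomial_ideal_def)
    show "p \<oplus>\<^bsub>poly_ring V\<^esub> q \<in> ?I" if "p \<in> ?I" "q \<in> ?I" for p q
      using that poly_ring_closed(1)[of p V q] Poly_Mapping.keys_add[of p q]
      by (auto simp: monomial_ideal_def)
  qed
  have mult: "p * q \<in> ?I" if "p \<in> ?I" "q \<in> carrier (poly_ring V)" for p q
    using that poly_ring_closed(2)[of p V q] keys_mult[of p q] assms
    by (auto simp: monomial_ideal_def)
  show "q \<otimes>\<^bsub>poly_ring V\<^esub> p \<in> ?I" "p \<otimes>\<^bsub>poly_ring V\<^esub> q \<in> ?I"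
    if "p \<in> ?I" "q \<in> carrier (poly_ring V)" for p q
    using mult[OF that] by (simp_all add: mult.commute)
qed

text \<open>Membership is decided term by term: every term of a polynomial on the right is a
  multiple of a single generator.\<close>

lemma genideal_monomials:
  assumes G: "\<And>g. g \<in> G \<Longrightarrow> Poly_Mapping.keys g \<subseteq> V"
  shows "Idl\<^bsub>poly_ring V\<^esub> ((\<lambda>g. Poly_Mapping.single g 1) ` G) =
    (monomial_ideal V {g + s | g s. g \<in> G} :: 'k::field mpoly set)" (is "?L = ?R")
proof
  interpret cring "poly_ring V :: 'k mpoly ring" by (rule cring_poly_ring)
  have gens: "(\<lambda>g. Poly_Mapping.single g 1) ` G \<subseteq> carrier (poly_ring V :: 'k mpoly ring)"
    using G by (auto intro: single_in_carrier)
  show "?L \<subseteq> ?R"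
  proof (rule genideal_minimal)
    show "ideal ?R (poly_ring V)" by (rule ideal_monomial_ideal) (auto simp: add.assoc, metis)
    show "(\<lambda>g. Poly_Mapping.single g 1) ` G \<subseteq> ?R"
      using gens by (auto simp: monomial_ideal_def) (metis add.right_neutral)
  qed
  show "?R \<subseteq> ?L"
  proof
    fix p assume p: "p \<in> ?R"
    have "Poly_Mapping.single t (Poly_Mapping.lookup p t) \<in> ?L" if t: "t \<in> Poly_Mapping.keys p" for t
    proof -
      obtain g s where gs: "g \<in> G" "t = g + s" using p t by (auto simp: monomial_ideal_def)
      have "Poly_Mapping.keys t \<subseteq> V" using p t by (auto simp: monomial_ideal_def carrier_poly_ring)
      \<comment> \<open>The cofactor divides \<open>t\<close>, hence uses only variables of
        \<open>V\<close> and belongs to the ring.\<close>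
      moreover have "Poly_Mapping.keys s \<subseteq> Poly_Mapping.keys t"
        by (auto simp: gs in_keys_iff lookup_add)
      ultimately have "Poly_Mapping.single s (Poly_Mapping.lookup p t) \<in> carrier (poly_ring V)"
        by (intro single_in_carrier) auto
      then have "Poly_Mapping.single g 1 * Poly_Mapping.single s (Poly_Mapping.lookup p t) \<in> ?L"
        using ideal_poly_ring(4)[OF genideal_ideal[OF gens]] genideal_self[OF gens] gs by blast
      then show ?thesis by (simp add: mult_single gs)
    qed
    then have "(\<Sum>t\<in>Poly_Mapping.keys p. Poly_Mapping.single t (Poly_Mapping.lookup p t)) \<in> ?L"
      by (intro ideal_poly_ring_sum[OF genideal_ideal[OF gens]])
    then show "p \<in> ?L" using poly_mapping_eq_sum_single[of p] by simp
  qed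
qed

text \<open>The ideal generated by the variables in \<open>S \<inter> V\<close>, encoded by its
  monomials so that membership is read off from the terms.\<close>

definition variable_ideal :: "var set \<Rightarrow> var set \<Rightarrow> 'k::field mpoly set" where
  "variable_ideal V S = monomial_ideal V {t. Poly_Mapping.keys t \<inter> S \<noteq> {}}"

lemma ideal_variable_ideal: "ideal (variable_ideal V S) (poly_ring V)"
  unfolding variable_ideal_def
  by (rule ideal_monomial_ideal) (auto simp: in_keys_iff lookup_add)

lemma restrict_variable_ideal:
  assumes "p \<in> carrier (poly_ring V)"
  shows "restrict_poly (- {t. Poly_Mapping.keys t \<inter> S = {}}) p \<in> variable_ideal V S"
    "restrict_poly A p \<in> carrier (poly_ring V)"
  using assms by (auto simp: variable_ideal_def monomial_ideal_def carrier_poly_ring keys_restrict_poly)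

text \<open>Modulo the ideal only the part without variables of \<open>S\<close> counts. The product
  of two such parts is again free of \<open>S\<close>; if it lies in the ideal it vanishes, and
  there are no zero divisors.\<close>

lemma primeideal_variable_ideal:
  "primeideal (variable_ideal V S :: 'k::field mpoly set) (poly_ring V)"
proof (rule primeidealI[OF ideal_variable_ideal cring_poly_ring])
  let ?P = "variable_ideal V S :: 'k mpoly set" and ?A = "{t :: monom. Poly_Mapping.keys t \<inter> S = {}}"
  note P = ideal_poly_ring[OF ideal_variable_ideal[of V S]]
  have "1 \<notin> ?P" by (simp add: variable_ideal_def monomial_ideal_def)
  moreover have "1 \<in> carrier (poly_ring V :: 'k mpoly ring)" by (simp add: carrier_poly_ring)
  ultimately show "carrier (poly_ring V) \<noteq> ?P" by blast
  fix a b :: "'k mpoly"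
  assume a: "a \<in> carrier (poly_ring V)" and b: "b \<in> carrier (poly_ring V)"
    and "a \<otimes>\<^bsub>poly_ring V\<^esub> b \<in> ?P"
  then have ab: "a * b \<in> ?P" by simp
  define a0 a1 b0 b1 where defs: "a0 = restrict_poly ?A a" "a1 = restrict_poly (- ?A) a"
    "b0 = restrict_poly ?A b" "b1 = restrict_poly (- ?A) b"
  have spl: "a = a0 + a1" "b = b0 + b1" by (simp_all add: defs restrict_poly_add_compl)
  have a1: "a1 \<in> ?P" and b1: "b1 \<in> ?P"
    using restrict_variable_ideal(1)[OF a] restrict_variable_ideal(1)[OF b] by (simp_all add: defs)
  have "a0 \<in> carrier (poly_ring V)" using restrict_variable_ideal(2)[OF a] by (simp add: defs)
  then have "a0 * b1 \<in> ?P" using P(5) b1 by blast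
  moreover have "a1 * b \<in> ?P" using P(4) a1 b by blast
  ultimately have "a * b - a1 * b - a0 * b1 \<in> ?P" using P(6) ab by blast
  moreover have "a * b - a1 * b - a0 * b1 = a0 * b0" by (simp add: spl algebra_simps)
  ultimately have "a0 * b0 \<in> ?P" by simp
  then have "\<forall>t\<in>Poly_Mapping.keys (a0 * b0). Poly_Mapping.keys t \<inter> S \<noteq> {}"
    by (auto simp: variable_ideal_def monomial_ideal_def)
  moreover have "\<forall>t\<in>Poly_Mapping.keys (a0 * b0). Poly_Mapping.keys t \<inter> S = {}"
    using keys_mult[of a0 b0] by (fastforce simp: defs keys_restrict_poly in_keys_iff lookup_add)
  ultimately have "Poly_Mapping.keys (a0 * b0) = {}" by blast
  then have "a0 = 0 \<or> b0 = 0" by (simp only: keys_eq_empty mult_eq_0_iff)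
  then show "a \<in> ?P \<or> b \<in> ?P" using a1 b1 spl by auto
qed

lemma variable_ideal_subset_iff:
  assumes "S \<subseteq> V"
  shows "(variable_ideal V S :: 'k::field mpoly set) \<subseteq> variable_ideal V S' \<longleftrightarrow> S \<subseteq> S'"
proof
  assume sub: "(variable_ideal V S :: 'k mpoly set) \<subseteq> variable_ideal V S'"
  show "S \<subseteq> S'"
  proof
    fix v assume v: "v \<in> S"
    then have "(variable v :: 'k mpoly) \<in> variable_ideal V S"
      using assms by (auto simp: variable_def variable_ideal_def monomial_ideal_def carrier_poly_ring)
    then have "(variable v :: 'k mpoly) \<in> variable_ideal V S'" using sub by blast
    then show "v \<in> S'"
      by (auto simp: variable_def variable_ideal_def monomial_ideal_def split: if_splits)
  qed
next
  assume "S \<subseteq> S'"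
  then show "(variable_ideal V S :: 'k mpoly set) \<subseteq> variable_ideal V S'"
    by (auto simp: variable_ideal_def monomial_ideal_def)
qed

text \<open>Every term has a factor \<open>variable v\<close> with \<open>v\<close> in
  \<open>S\<close>, so for any ideal it is enough to contain these variables.\<close>

lemma variable_ideal_subset_prime:
  assumes Q: "ideal Q (poly_ring V :: 'k::field mpoly ring)"
    and S: "\<And>v. v \<in> S \<Longrightarrow> v \<in> V \<Longrightarrow> variable v \<in> Q"
  shows "variable_ideal V S \<subseteq> Q"
proof
  fix p :: "'k mpoly" assume p: "p \<in> variable_ideal V S"
  have "Poly_Mapping.single t (Poly_Mapping.lookup p t) \<in> Q" if t: "t \<in> Poly_Mapping.keys p" for t
  proof -
    have tV: "Poly_Mapping.keys t \<subseteq> V" and "Poly_Mapping.keys t \<inter> S \<noteq> {}"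
      using p t by (auto simp: variable_ideal_def monomial_ideal_def carrier_poly_ring)
    then obtain v where v: "v \<in> Poly_Mapping.keys t" "v \<in> S" by blast
    \<comment> \<open>As \<open>v\<close> occurs in \<open>t\<close>, the truncated subtraction of
      exponents is exact and \<open>s\<close> is the cofactor.\<close>
    define s where "s = t - Poly_Mapping.single v 1"
    have ts: "t = Poly_Mapping.single v 1 + s"
      using v(1) unfolding s_def
      by (intro poly_mapping_eqI) (auto simp: lookup_add lookup_minus lookup_single when_def in_keys_iff)
    have "Poly_Mapping.keys s \<subseteq> V" using tV by (auto simp: ts in_keys_iff lookup_add)
    then have "variable v * Poly_Mapping.single s (Poly_Mapping.lookup p t) \<in> Q"
      using v tV by (intro ideal_poly_ring(4)[OF Q] S single_in_carrier) auto
    moreover have "variable v * Poly_Mapping.single s (Poly_Mapping.lookup p t) =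
        Poly_Mapping.single t (Poly_Mapping.lookup p t)"
      by (subst ts) (simp add: variable_def mult_single)
    ultimately show ?thesis by simp
  qed
  then have "(\<Sum>t\<in>Poly_Mapping.keys p. Poly_Mapping.single t (Poly_Mapping.lookup p t)) \<in> Q"
    by (intro ideal_poly_ring_sum[OF Q])
  then show "p \<in> Q" using poly_mapping_eq_sum_single[of p] by simp
qed

section \<open>Dimension\<close>

fun power_prod :: "'a::comm_monoid_mult list \<Rightarrow> nat list \<Rightarrow> 'a" where
  "power_prod (a # as) (m # ms) = a ^ m * power_prod as ms"
| "power_prod _ _ = 1"

lemma one_in_carrier: "1 \<in> carrier (poly_ring V)"
  by (simp add: carrier_poly_ring)

lemma power_in_carrier: "p \<in> carrier (poly_ring V) \<Longrightarrow> p ^ n \<in> carrier (poly_ring V)"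
  by (induction n) (auto intro: poly_ring_closed simp: one_in_carrier)

lemma power_prod_in_carrier:
  "set as \<subseteq> carrier (poly_ring V) \<Longrightarrow> power_prod as ms \<in> carrier (poly_ring V)"
  by (induction as ms rule: power_prod.induct)
    (auto intro!: poly_ring_closed power_in_carrier simp: one_in_carrier)

lemma prime_power_notin:
  assumes "primeideal Q (poly_ring V)" "a \<in> carrier (poly_ring V)" "a \<notin> Q"
  shows "a ^ n \<notin> Q"
proof (induction n)
  case 0
  show ?case using primeideal_poly_ring(1)[OF assms(1)] by simp
next
  case (Suc n)
  then show ?case
    using primeideal_poly_ring(2)[OF assms(1,2) power_in_carrier[OF assms(2)], of n] assms(3) by auto
qed

text \<open>Cancelling the least power of the first element and passing to the next prime removes that
  element.\<close>

lemma prime_chain_independent: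
  fixes Q :: "nat \<Rightarrow> 'k::field mpoly set"
  assumes "\<And>i. i \<le> length as \<Longrightarrow> primeideal (Q i) (poly_ring V)"
    and "\<And>i. i < length as \<Longrightarrow> Q i \<subseteq> Q (Suc i) \<and> as ! i \<in> Q (Suc i) \<and> as ! i \<notin> Q i"
    and "finite F" "\<And>ms. ms \<in> F \<Longrightarrow> length ms = length as"
    and "(\<Sum>ms\<in>F. Poly_Mapping.single 0 (c ms) * power_prod as ms) \<in> Q 0" "ms \<in> F"
  shows "c ms = 0"
  using assms
proof (induction as arbitrary: Q F c ms)
  case Nil
  then have "F = {[]}" "ms = []" by auto
  then have "Poly_Mapping.single 0 (c []) \<in> Q 0" using Nil.prems(5) by simp
  have "c [] = 0"
  proof (rule ccontr)
    assume "c [] \<noteq> 0"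
    have Q: "primeideal (Q 0) (poly_ring V)" using Nil.prems(1) by simp
    \<comment> \<open>A nonzero constant is a unit and cannot lie in a prime ideal.\<close>
    have "Poly_Mapping.single 0 (c []) * Poly_Mapping.single 0 (inverse (c [])) \<in> Q 0"
      using \<open>Poly_Mapping.single 0 (c []) \<in> Q 0\<close>
      by (intro ideal_poly_ring(4)[OF primeideal.axioms(1)[OF Q]] single_in_carrier) auto
    then show False
      using \<open>c [] \<noteq> 0\<close> primeideal_poly_ring(1)[OF Q] by (simp add: mult_single)
  qed
  then show ?case using \<open>ms = []\<close> by simp
next
  case (Cons a as)
  have pr: "primeideal (Q i) (poly_ring V)" if "i \<le> Suc (length as)" for i
    using Cons.prems(1) that by simp
  note id = primeideal.axioms(1)[OF pr]
  note idr = ideal_poly_ring[OF id]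
  have carr: "set (a # as) \<subseteq> carrier (poly_ring V)"
  proof
    fix x assume "x \<in> set (a # as)"
    then obtain i where "i < length (a # as)" "x = (a # as) ! i" by (metis in_set_conv_nth)
    then show "x \<in> carrier (poly_ring V)" using Cons.prems(2)[of i] idr(1)[of "Suc i"] by simp
  qed
  have a: "a \<in> Q 1" "a \<notin> Q 0" "Q 0 \<subseteq> Q 1" "a \<in> carrier (poly_ring V)"
    using Cons.prems(2)[of 0] carr by auto
  show ?case
  proof (rule ccontr)
    assume "c ms \<noteq> 0"
    \<comment> \<open>Without the zero coefficients, the least exponent \<open>m\<close> of
      \<open>a\<close> is attained by a term that really occurs.\<close>
    define F' where "F' = {ms \<in> F. c ms \<noteq> 0}"
    define m where "m = Min (hd ` F')"
    have F': "finite F'" "F' \<noteq> {}" using Cons.prems(3,6) \<open>c ms \<noteq> 0\<close> by (auto simp: F'_def)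
    have ge: "m \<le> hd ns" if "ns \<in> F'" for ns using F' that by (simp add: m_def)
    have cons: "ns = hd ns # tl ns" "length (tl ns) = length as" if "ns \<in> F'" for ns
      using Cons.prems(4)[of ns] that by (cases ns; auto simp: F'_def)+
    define g where "g ns = Poly_Mapping.single 0 (c ns) * (a ^ (hd ns - m) * power_prod as (tl ns))" for ns
    have g_carr: "Poly_Mapping.single 0 (c ns) * (a ^ k * power_prod as (tl ns)) \<in> carrier (poly_ring V)" for ns k
      using carr by (intro poly_ring_closed power_in_carrier power_prod_in_carrier single_in_carrier) auto
    have "(\<Sum>ms\<in>F. Poly_Mapping.single 0 (c ms) * power_prod (a # as) ms) =
        (\<Sum>ms\<in>F'. Poly_Mapping.single 0 (c ms) * power_prod (a # as) ms)"
      using Cons.prems(3) by (intro sum.mono_neutral_right) (auto simp: F'_def)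
    also have "\<dots> = (\<Sum>ms\<in>F'. a ^ m * g ms)"
    proof (rule sum.cong[OF refl])
      fix ns assume ns: "ns \<in> F'"
      have "power_prod (a # as) ns = a ^ hd ns * power_prod as (tl ns)"
        by (subst cons(1)[OF ns]) simp
      also have "a ^ hd ns = a ^ m * a ^ (hd ns - m)" using ge[OF ns] by (simp flip: power_add)
      finally show "Poly_Mapping.single 0 (c ns) * power_prod (a # as) ns = a ^ m * g ns"
        by (simp add: g_def mult.assoc mult.left_commute)
    qed
    finally have "a ^ m * sum g F' \<in> Q 0" using Cons.prems(5) by (simp add: sum_distrib_left)
    moreover have "sum g F' \<in> carrier (poly_ring V)"
      by (rule ideal_poly_ring_sum[OF ring.oneideal[OF ring_poly_ring]]) (simp add: g_def g_carr)
    ultimately have "sum g F' \<in> Q 0"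
      using primeideal_poly_ring(2)[OF pr power_in_carrier[OF a(4)]] prime_power_notin[OF pr a(4,2)]
      by blast
    then have gQ: "sum g F' \<in> Q 1" using a by blast
    define F0 where "F0 = {ns \<in> F'. hd ns = m}"
    \<comment> \<open>These terms keep a positive power of \<open>a\<close>, which lies in
      \<open>Q 1\<close>. What remains is a relation modulo \<open>Q 1\<close> among the other
      elements.\<close>
    have "sum g (F' - F0) \<in> Q 1"
    proof (rule ideal_poly_ring_sum[OF id])
      fix ns assume ns: "ns \<in> F' - F0"
      then have "hd ns - m = Suc (hd ns - m - 1)" using ge[of ns] by (auto simp: F0_def)
      then have "a ^ (hd ns - m) = a * a ^ (hd ns - m - 1)" by (metis power_Suc)
      then have "g ns = a * (Poly_Mapping.single 0 (c ns) * (a ^ (hd ns - m - 1) * power_prod as (tl ns)))"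
        by (simp add: g_def algebra_simps)
      then show "g ns \<in> Q 1" using idr(4)[OF _ a(1) g_carr] by simp
    qed simp
    moreover have "sum g F' = sum g F0 + sum g (F' - F0)"
      using F'(1) by (subst sum.subset_diff[of F0 F']) (auto simp: F0_def add.commute)
    ultimately have "sum g F0 \<in> Q 1" using idr(6)[OF _ gQ, of "sum g (F' - F0)"] by simp
    moreover have inj: "inj_on tl F0"
      by (rule inj_onI) (metis (mono_tags, lifting) F0_def cons(1) mem_Collect_eq)
    moreover have "sum g F0 = (\<Sum>t\<in>tl ` F0. Poly_Mapping.single 0 (c (m # t)) * power_prod as t)"
      unfolding sum.reindex[OF inj]
    proof (rule sum.cong[OF refl])
      fix ns assume ns: "ns \<in> F0"
      then have "m # tl ns = ns" using cons(1)[of ns] by (simp add: F0_def)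
      then show "g ns = ((\<lambda>t. Poly_Mapping.single 0 (c (m # t)) * power_prod as t) \<circ> tl) ns"
        using ns by (simp add: g_def F0_def)
    qed
    ultimately have sumQ: "(\<Sum>t\<in>tl ` F0. Poly_Mapping.single 0 (c (m # t)) * power_prod as t) \<in> Q (Suc 0)"
      by simp
    have "m \<in> hd ` F'" using F' unfolding m_def by (intro Min_in) auto
    then obtain ns where ns: "ns \<in> F0" by (auto simp: F0_def)
    \<comment> \<open>The induction hypothesis is applied to the chain from \<open>Q 1\<close> on,
      with the coefficients of the terms whose first exponent is \<open>m\<close>.\<close>
    have "c (m # tl ns) = 0"
    proof (rule Cons.IH[of "\<lambda>i. Q (Suc i)" "tl ` F0" "\<lambda>t. c (m # t)"])
      show "finite (tl ` F0)" using F' by (simp add: F0_def)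
      show "\<And>t. t \<in> tl ` F0 \<Longrightarrow> length t = length as" using cons by (auto simp: F0_def)
      show "tl ns \<in> tl ` F0" using ns by simp
      show "Q (Suc i) \<subseteq> Q (Suc (Suc i)) \<and> as ! i \<in> Q (Suc (Suc i)) \<and> as ! i \<notin> Q (Suc i)"
        if "i < length as" for i
        using Cons.prems(2)[of "Suc i"] that by simp
    qed (use pr sumQ in simp_all)
    then show False using ns cons(1)[of ns] by (auto simp: F0_def F'_def)
  qed
qed

section \<open>Counting linearly independent polynomials\<close>

lemma vector_space_mpoly:
  "vector_space (\<lambda>c (p :: 'k::field mpoly). Poly_Mapping.single 0 c * p)"
  by (unfold_locales) (simp_all add: algebra_simps single_add mult_single flip: mult.assoc)

text \<open>The family lies in the span of the monomials in \<open>T\<close>. Independence is stated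
  for an indexed family because the index set, later a set of exponent vectors, is what gets
  counted.\<close>

lemma card_independent_mpolys_le:
  fixes f :: "'a \<Rightarrow> 'k::field mpoly"
  assumes L: "finite L" and T: "finite T" and keys: "\<And>x. x \<in> L \<Longrightarrow> Poly_Mapping.keys (f x) \<subseteq> T"
    and indep: "\<And>c x. (\<Sum>x\<in>L. Poly_Mapping.single 0 (c x) * f x) = 0 \<Longrightarrow> x \<in> L \<Longrightarrow> c x = 0"
  shows "card L \<le> card T"
proof -
  interpret vector_space "\<lambda>c (p :: 'k mpoly). Poly_Mapping.single 0 c * p"
    by (rule vector_space_mpoly)
  have inj: "inj_on f L"
  proof (rule inj_onI, rule ccontr)
    fix x y assume xy: "x \<in> L" "y \<in> L" "f x = f y" "x \<noteq> y"
    \<comment> \<open>Two equal members would satisfy a nontrivial relation with these coefficients,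
      so passing to the set of values loses nothing.\<close>
    let ?c = "\<lambda>z. if z = x then 1 else if z = y then - 1 else 0 :: 'k"
    have "(\<Sum>z\<in>L. Poly_Mapping.single 0 (?c z) * f z) =
        (\<Sum>z\<in>L. (if z = x then f x else 0) + (if z = y then - f y else 0))"
      using xy(4) by (intro sum.cong) (auto simp: single_uminus)
    also have "\<dots> = 0" using xy L by (simp add: sum.distrib)
    finally show False using indep[of ?c x] xy by simp
  qed
  have "independent (f ` L)"
  proof
    assume "dependent (f ` L)"
    then obtain u v where uv: "v \<in> f ` L" "u v \<noteq> 0" "(\<Sum>v\<in>f ` L. Poly_Mapping.single 0 (u v) * v) = 0"
      using dependent_finite[of "f ` L"] L by auto
    then show False using indep[of "u \<circ> f"] by (auto simp: sum.reindex[OF inj])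
  qed
  moreover have "f ` L \<subseteq> span ((\<lambda>t. Poly_Mapping.single t 1) ` T)"
  proof clarify
    fix x assume x: "x \<in> L"
    have "(\<Sum>t\<in>Poly_Mapping.keys (f x). Poly_Mapping.single 0 (Poly_Mapping.lookup (f x) t) * Poly_Mapping.single t 1)
        \<in> span ((\<lambda>t. Poly_Mapping.single t 1) ` T)"
      using keys[OF x] by (intro span_sum span_scale span_base) auto
    then show "f x \<in> span ((\<lambda>t. Poly_Mapping.single t 1) ` T)"
      using poly_mapping_eq_sum_single[of "f x"] by (simp add: mult_single)
  qed
  ultimately have "card (f ` L) \<le> card ((\<lambda>t. Poly_Mapping.single t (1::'k)) ` T)"
    using independent_span_bound T by blast
  then show ?thesis using card_image[OF inj] card_image_le[OF T] by (metis order_trans)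
qed

text \<open>Bounding each exponent instead of the total degree makes the count a plain power, while
  bounds still add up under multiplication.\<close>

definition bounded_monomials :: "var set \<Rightarrow> nat \<Rightarrow> monom set" where
  "bounded_monomials A B = {t. Poly_Mapping.keys t \<subseteq> A \<and> (\<forall>v. Poly_Mapping.lookup t v \<le> B)}"

lemma card_bounded_monomials:
  assumes "finite A"
  shows "finite (bounded_monomials A B)" "card (bounded_monomials A B) \<le> (B + 1) ^ card A"
proof -
  let ?r = "\<lambda>t. restrict (Poly_Mapping.lookup t) A"
  have inj: "inj_on ?r (bounded_monomials A B)"
  proof (rule inj_onI, rule poly_mapping_eqI)
    fix s t :: monom and v
    assume s: "s \<in> bounded_monomials A B" and t: "t \<in> bounded_monomials A B" and eq: "?r s = ?r t"
    show "Poly_Mapping.lookup s v = Poly_Mapping.lookup t v"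
    proof (cases "v \<in> A")
      case True
      then show ?thesis using fun_cong[OF eq, of v] by simp
    next
      case False
      then have "v \<notin> Poly_Mapping.keys s" "v \<notin> Poly_Mapping.keys t"
        using s t by (auto simp: bounded_monomials_def)
      then show ?thesis by (simp add: in_keys_iff)
    qed
  qed
  have sub: "?r ` bounded_monomials A B \<subseteq> A \<rightarrow>\<^sub>E {..B}"
    by (auto simp: bounded_monomials_def)
  have fin: "finite (A \<rightarrow>\<^sub>E {..B})" using assms by (intro finite_PiE) auto
  show "finite (bounded_monomials A B)"
    using inj_on_finite[OF inj sub fin] .
  show "card (bounded_monomials A B) \<le> (B + 1) ^ card A"
    using card_inj_on_le[OF inj sub fin] assms by (simp add: card_PiE)
qed

lemma keys_mult_bounded:
  assumes "Poly_Mapping.keys p \<subseteq> bounded_monomials A B" "Poly_Mapping.keys q \<subseteq> bounded_monomials A C"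
  shows "Poly_Mapping.keys (p * q) \<subseteq> bounded_monomials A (B + C)"
proof
  fix t assume "t \<in> Poly_Mapping.keys (p * q)"
  then obtain u v where "t = u + v" "u \<in> bounded_monomials A B" "v \<in> bounded_monomials A C"
    using keys_mult[of p q] assms by blast
  then show "t \<in> bounded_monomials A (B + C)"
    using Poly_Mapping.keys_add[of u v] by (auto simp: bounded_monomials_def lookup_add add_mono)
qed

lemma keys_power_bounded:
  assumes "Poly_Mapping.keys (p :: 'k::field mpoly) \<subseteq> bounded_monomials A B"
  shows "Poly_Mapping.keys (p ^ n) \<subseteq> bounded_monomials A (n * B)"
proof (induction n)
  case 0
  show ?case by (simp add: bounded_monomials_def)
next
  case (Suc n)
  then show ?case using keys_mult_bounded[OF assms Suc] by simp
qed

lemma keys_power_prod_bounded: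
  assumes "\<And>p. p \<in> set as \<Longrightarrow> Poly_Mapping.keys (p :: 'k::field mpoly) \<subseteq> bounded_monomials A B"
  shows "Poly_Mapping.keys (power_prod as ms) \<subseteq> bounded_monomials A (sum_list ms * B)"
  using assms
proof (induction as ms rule: power_prod.induct)
  case (1 a as m ms)
  have "Poly_Mapping.keys (power_prod (a # as) (m # ms)) \<subseteq> bounded_monomials A (m * B + sum_list ms * B)"
    unfolding power_prod.simps using 1 by (intro keys_mult_bounded keys_power_bounded) auto
  then show ?case by (simp add: algebra_simps)
qed (auto simp: bounded_monomials_def)

text \<open>The right side grows like \<open>M ^ d\<close>, so it cannot dominate a higher power of
  \<open>M\<close>.\<close>

lemma power_growth_le:
  fixes l d C :: nat
  assumes "\<And>M. M ^ l \<le> (C * M + 1) ^ d"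
  shows "l \<le> d"
proof (rule ccontr)
  assume "\<not> l \<le> d"
  \<comment> \<open>Chosen larger than \<open>(C + 1) ^ d\<close> for the contradiction; being
    positive it also gives \<open>C * M + 1 \<le> (C + 1) * M\<close>.\<close>
  define M where "M = (C + 1) ^ d + 1"
  have "M * M ^ d = M ^ Suc d" by simp
  also have "\<dots> \<le> M ^ l" using \<open>\<not> l \<le> d\<close> by (intro power_increasing) (auto simp: M_def)
  also have "\<dots> \<le> (C * M + 1) ^ d" by (rule assms)
  also have "\<dots> \<le> ((C + 1) * M) ^ d" by (intro power_mono) (auto simp: M_def)
  also have "\<dots> = (C + 1) ^ d * M ^ d" by (rule power_mult_distrib)
  finally have "M \<le> (C + 1) ^ d" by (simp add: M_def)
  then show False by (simp add: M_def)
qed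

text \<open>Pick \<open>a i\<close> in \<open>Q (Suc i)\<close> but not in \<open>Q i\<close>. The
  \<open>M ^ l\<close> power products with exponents below \<open>M\<close> are independent by
  \<open>prime_chain_independent\<close>, yet use only variables of \<open>V - S\<close> with
  exponents linear in \<open>M\<close>. Comparing growth in \<open>M\<close> bounds
  \<open>l\<close>.\<close>

lemma prime_chain_length_le:
  fixes Q :: "nat \<Rightarrow> 'k::field mpoly set"
  assumes V: "finite V" and pr: "\<And>i. i \<le> l \<Longrightarrow> primeideal (Q i) (poly_ring V)"
    and chain: "\<And>i. i < l \<Longrightarrow> Q i \<subset> Q (Suc i)" and S: "variable_ideal V S \<subseteq> Q 0"
  shows "l \<le> card (V - S)"
proof -
  note id = primeideal.axioms(1)[OF pr]
  note idr = ideal_poly_ring[OF id]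
  have S': "variable_ideal V S \<subseteq> Q i" if "i \<le> l" for i
    using that
  proof (induction i)
    case (Suc i)
    then show ?case using chain[of i] by auto
  qed (use S in simp)
  let ?A = "{t :: monom. Poly_Mapping.keys t \<inter> S = {}}"
  \<comment> \<open>The part of \<open>b\<close> that involves \<open>S\<close> lies in every prime
    of the chain, so it may be subtracted.\<close>
  have "\<exists>a. a \<in> Q (Suc i) \<and> a \<notin> Q i \<and> Poly_Mapping.keys a \<subseteq> ?A" if i: "i < l" for i
  proof -
    obtain b where b: "b \<in> Q (Suc i)" "b \<notin> Q i" using chain[OF i] by blast
    have bc: "b \<in> carrier (poly_ring V)" using idr(1)[OF _ b(1)] i by simp
    let ?c = "restrict_poly (- ?A) b"
    have c: "?c \<in> Q i" "?c \<in> Q (Suc i)"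
      using restrict_variable_ideal(1)[OF bc] S'[of i] S'[of "Suc i"] i by auto
    have spl: "restrict_poly ?A b = b - ?c" "b = restrict_poly ?A b + ?c"
      using restrict_poly_add_compl[of ?A b] by (simp_all add: algebra_simps)
    have "restrict_poly ?A b \<in> Q (Suc i)" using spl(1) idr(6)[OF _ b(1) c(2)] i by simp
    moreover have "restrict_poly ?A b \<notin> Q i" using spl(2) idr(3)[OF _ _ c(1)] i b(2) by force
    moreover have "Poly_Mapping.keys (restrict_poly ?A b) \<subseteq> ?A" by (simp add: keys_restrict_poly)
    ultimately show ?thesis by blast
  qed
  then obtain a where a: "\<And>i. i < l \<Longrightarrow> a i \<in> Q (Suc i) \<and> a i \<notin> Q i \<and> Poly_Mapping.keys (a i) \<subseteq> ?A"
    by metis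
  define as where "as = map a [0..<l]"
  \<comment> \<open>All exponents occurring in the chosen elements; their maximum bounds each factor
    of a power product.\<close>
  define E where "E = (\<Union>i<l. \<Union>t\<in>Poly_Mapping.keys (a i). Poly_Mapping.lookup t ` Poly_Mapping.keys t)"
  have "finite E" by (simp add: E_def)
  then obtain B where B: "\<forall>e\<in>E. e \<le> B" by (auto simp: finite_nat_set_iff_bounded_le)
  have keys: "Poly_Mapping.keys p \<subseteq> bounded_monomials (V - S) B" if p: "p \<in> set as" for p
  proof
    fix t assume t: "t \<in> Poly_Mapping.keys p"
    obtain i where i: "i < l" "p = a i" using p by (auto simp: as_def)
    have "p \<in> carrier (poly_ring V)" using a[OF i(1)] idr(1)[of "Suc i"] i by simp
    then have "Poly_Mapping.keys t \<subseteq> V - S" using t a[OF i(1)] i(2) by (auto simp: carrier_poly_ring)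
    moreover have "Poly_Mapping.lookup t v \<le> B" for v
    proof (cases "v \<in> Poly_Mapping.keys t")
      case True
      then have "Poly_Mapping.lookup t v \<in> E" using i t by (auto simp: E_def)
      then show ?thesis using B by blast
    qed (simp add: in_keys_iff)
    ultimately show "t \<in> bounded_monomials (V - S) B" by (simp add: bounded_monomials_def)
  qed
  show ?thesis
  proof (rule power_growth_le)
    fix M :: nat
    define L where "L = {ms. set ms \<subseteq> {..<M} \<and> length ms = l}"
    have L: "finite L" "card L = M ^ l"
      by (simp_all add: L_def finite_lists_length_eq card_lists_length_eq)
    have fin: "finite (V - S)" using V by simp
    have "card L \<le> card (bounded_monomials (V - S) (l * B * M))"
    proof (rule card_independent_mpolys_le[OF L(1) card_bounded_monomials(1)[OF fin], where f = "power_prod as :: _ \<Rightarrow> 'k mpoly"])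
      fix ms assume ms: "ms \<in> L"
      have "\<forall>m\<in>set ms. m \<le> M" using ms by (auto simp: L_def intro: less_imp_le)
      then have "sum_list ms \<le> length ms * M" by (induction ms) auto
      then have "sum_list ms * B \<le> l * M * B" using ms by (intro mult_right_mono) (auto simp: L_def)
      then have "bounded_monomials (V - S) (sum_list ms * B) \<subseteq> bounded_monomials (V - S) (l * B * M)"
        by (auto simp: bounded_monomials_def mult.commute mult.left_commute intro: order_trans)
      then show "Poly_Mapping.keys (power_prod as ms) \<subseteq> bounded_monomials (V - S) (l * B * M)"
        using keys_power_prod_bounded[OF keys, of as ms] by blast
    next
      fix c ms assume sum0: "(\<Sum>ms\<in>L. Poly_Mapping.single 0 (c ms) * power_prod as ms) = 0" and "ms \<in> L"
      show "c ms = 0"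
      proof (rule prime_chain_independent[of as Q V L c ms])
        show "primeideal (Q i) (poly_ring V)" if "i \<le> length as" for i
          using pr[of i] that by (simp add: as_def)
        show "Q i \<subseteq> Q (Suc i) \<and> as ! i \<in> Q (Suc i) \<and> as ! i \<notin> Q i" if "i < length as" for i
          using a[of i] chain[of i] that by (auto simp: as_def)
        show "(\<Sum>ms\<in>L. Poly_Mapping.single 0 (c ms) * power_prod as ms) \<in> Q 0"
          unfolding sum0 by (rule idr(2)) simp
        show "length ms = length as" if "ms \<in> L" for ms using that by (simp add: L_def as_def)
      qed fact+
    qed
    also have "\<dots> \<le> (l * B * M + 1) ^ card (V - S)" by (rule card_bounded_monomials(2)[OF fin])
    finally show "M ^ l \<le> (l * B * M + 1) ^ card (V - S)" using L by simp
  qed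
qed

text \<open>Adjoining the variables outside \<open>S\<close> one at a time gives a chain of the
  largest possible length.\<close>

lemma variable_ideal_chain:
  assumes V: "finite V" and S: "S \<subseteq> V"
  shows "\<exists>Q :: nat \<Rightarrow> 'k::field mpoly set. (\<forall>i\<le>card (V - S). primeideal (Q i) (poly_ring V) \<and>
    variable_ideal V S \<subseteq> Q i) \<and> (\<forall>i<card (V - S). Q i \<subset> Q (Suc i))"
proof -
  have "finite (V - S)" using V by simp
  then obtain xs where xs: "set xs = V - S" "distinct xs" using finite_distinct_list by blast
  define Q where "Q i = (variable_ideal V (S \<union> set (take i xs)) :: 'k mpoly set)" for i
  have len: "length xs = card (V - S)" using xs distinct_card by fastforce
  have sub: "S \<union> set (take i xs) \<subseteq> V" for i using S xs set_take_subset by fastforce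
  have "Q i \<subset> Q (Suc i)" if i: "i < length xs" for i
  proof -
    have "xs ! i \<in> set (take (Suc i) xs)" "xs ! i \<notin> set (take i xs)" "xs ! i \<notin> S"
      using i xs nth_mem[OF i] by (auto simp: take_Suc_conv_app_nth in_set_conv_nth nth_eq_iff_index_eq)
    moreover have "set (take i xs) \<subseteq> set (take (Suc i) xs)" by (simp add: set_take_subset_set_take)
    ultimately show ?thesis
      unfolding Q_def psubset_eq set_eq_subset variable_ideal_subset_iff[OF sub] by blast
  qed
  moreover have "variable_ideal V S \<subseteq> Q i" for i
    unfolding Q_def variable_ideal_subset_iff[OF S] by blast
  moreover have "primeideal (Q i) (poly_ring V)" for i
    unfolding Q_def by (rule primeideal_variable_ideal)
  ultimately show ?thesis using len by (intro exI[of _ Q]) auto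
qed

lemma krull_dim_variable_ideal:
  assumes "finite V" "S \<subseteq> V"
  shows "krull_dim (poly_ring V Quot (variable_ideal V S :: 'k::field mpoly set)) = enat (card (V - S))"
  unfolding cring.krull_dim_quot[OF cring_poly_ring ideal_variable_ideal]
proof (rule antisym)
  show "Sup {enat l | l. \<exists>Q. (\<forall>i\<le>l. primeideal (Q i) (poly_ring V) \<and> (variable_ideal V S :: 'k mpoly set) \<subseteq> Q i) \<and>
     (\<forall>i<l. Q i \<subset> Q (Suc i))} \<le> enat (card (V - S))"
  proof (rule Sup_least, clarify)
    fix l and Q :: "nat \<Rightarrow> 'k mpoly set"
    assume Q: "\<forall>i\<le>l. primeideal (Q i) (poly_ring V) \<and> variable_ideal V S \<subseteq> Q i" "\<forall>i<l. Q i \<subset> Q (Suc i)"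
    have "l \<le> card (V - S)"
      by (rule prime_chain_length_le[OF assms(1), of l Q]) (use Q in simp_all)
    then show "enat l \<le> enat (card (V - S))" by simp
  qed
  show "enat (card (V - S)) \<le> Sup {enat l | l. \<exists>Q. (\<forall>i\<le>l. primeideal (Q i) (poly_ring V) \<and>
     (variable_ideal V S :: 'k mpoly set) \<subseteq> Q i) \<and> (\<forall>i<l. Q i \<subset> Q (Suc i))}"
    using variable_ideal_chain[OF assms, where 'k='k]
    by (intro Sup_upper CollectI exI[of _ "card (V - S)"] conjI refl)
qed

section \<open>Unmixed monomial ideals\<close>

lemma variable_power: "variable v ^ k = Poly_Mapping.single (Poly_Mapping.single v k) 1"
proof (induction k)
  case (Suc k)
  then show ?case by (simp add: variable_def mult_single flip: single_add)
qed simp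

definition monomial_of :: "var set \<Rightarrow> (var \<Rightarrow> nat) \<Rightarrow> monom" where
  "monomial_of A T = (\<Sum>v\<in>A. Poly_Mapping.single v (T v))"

lemma lookup_monomial_of:
  "finite A \<Longrightarrow> Poly_Mapping.lookup (monomial_of A T) v = (if v \<in> A then T v else 0)"
  by (simp add: monomial_of_def lookup_sum lookup_single when_def)

lemma keys_monomial_of: "finite A \<Longrightarrow> Poly_Mapping.keys (monomial_of A T) \<subseteq> A"
  by (auto simp: in_keys_iff lookup_monomial_of split: if_splits)

lemma monomial_in_prime:
  assumes P: "primeideal P (poly_ring V :: 'k::field mpoly ring)" and "finite A" "A \<subseteq> V"
    and "Poly_Mapping.single (monomial_of A T) 1 \<in> P"
  shows "\<exists>v\<in>A. variable v \<in> P"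
  using assms(2-)
proof (induction A rule: finite_induct)
  case empty
  then show ?case using primeideal_poly_ring(1)[OF P] by (simp add: monomial_of_def)
next
  case (insert v A)
  have v: "(variable v :: 'k mpoly) \<in> carrier (poly_ring V)"
    using insert.prems by (simp add: variable_def single_in_carrier)
  have m: "Poly_Mapping.single (monomial_of A T) 1 \<in> carrier (poly_ring V :: 'k mpoly ring)"
    using keys_monomial_of[OF insert.hyps(1), of T] insert.prems by (intro single_in_carrier) auto
  have "variable v ^ T v * Poly_Mapping.single (monomial_of A T) 1 \<in> P"
    using insert by (simp add: variable_power mult_single monomial_of_def)
  then have "variable v ^ T v \<in> P \<or> Poly_Mapping.single (monomial_of A T) 1 \<in> P"
    using primeideal_poly_ring(2)[OF P power_in_carrier[OF v] m] by blast
  then show ?case using prime_power_notin[OF P v] insert by auto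
qed

text \<open>Exponents at least \<open>W\<close> behave as infinite ones. A support \<open>S\<close> is that of an irreducible
  component of the monomial ideal: the component is generated by the powers \<open>v ^ (T v + 1)\<close> with
  \<open>v\<close> in \<open>S\<close>.\<close>

definition component_support :: "var set \<Rightarrow> ((var \<Rightarrow> nat) \<Rightarrow> bool) \<Rightarrow> nat \<Rightarrow> var set \<Rightarrow> (var \<Rightarrow> nat) \<Rightarrow> bool" where
  "component_support V I W S T \<longleftrightarrow> S \<subseteq> V \<and> \<not> I T \<and> (\<forall>v\<in>V - S. W \<le> T v) \<and>
     (\<forall>v\<in>S. I (T(v := T v + 1)))"

text \<open>\<open>I t\<close> stands for membership of the monomial with exponents
  \<open>t\<close>. By \<open>mono\<close> this is an upset that depends on the exponents in
  \<open>V\<close> only; \<open>trunc\<close> says that the minimal generators have exponents at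
  most \<open>W\<close>.\<close>

locale bounded_monomial_ideal =
  fixes V :: "var set" and I :: "(var \<Rightarrow> nat) \<Rightarrow> bool" and W :: nat
  assumes fin: "finite V"
    and mono: "\<And>s t. I s \<Longrightarrow> (\<And>v. v \<in> V \<Longrightarrow> s v \<le> t v) \<Longrightarrow> I t"
    and trunc: "\<And>t. I t \<Longrightarrow> I (\<lambda>v. min (t v) W)"
begin

abbreviation MI :: "'k::field mpoly set" where
  "MI \<equiv> monomial_ideal V {t. I (Poly_Mapping.lookup t)}"

text \<open>Raising an exponent that is already at least \<open>W\<close> cannot lead into the
  ideal, since truncation does not see it.\<close>

lemma component_support_less:
  assumes "component_support V I W S T" "v \<in> S"
  shows "T v < W"
proof (rule ccontr)
  assume *: "\<not> T v < W"
  have "I (T(v := T v + 1))" using assms by (simp add: component_support_def)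
  from trunc[OF this] have "I T" by (rule mono) (use * in auto)
  then show False using assms(1) by (simp add: component_support_def)
qed

text \<open>Raise exponents below \<open>W\<close> greedily while staying outside the ideal; the
  total deficit below \<open>W\<close> drops each time. When nothing can be raised, the variables
  still below \<open>W\<close> form the support.\<close>

lemma extend_component_support:
  assumes "\<not> I T0"
  shows "\<exists>S T. component_support V I W S T \<and> (\<forall>v. T0 v \<le> T v)"
  using assms
proof (induction "\<Sum>v\<in>V. W - T0 v" arbitrary: T0 rule: less_induct)
  case less
  show ?case
  proof (cases "\<exists>v\<in>V. T0 v < W \<and> \<not> I (T0(v := T0 v + 1))")
    case True
    then obtain v where v: "v \<in> V" "T0 v < W" "\<not> I (T0(v := T0 v + 1))" by blast
    let ?T = "T0(v := T0 v + 1)"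
    have "(\<Sum>u\<in>V. W - ?T u) < (\<Sum>u\<in>V. W - T0 u)"
      by (rule sum_strict_mono_ex1[OF fin]) (use v in auto)
    then obtain S T where ST: "component_support V I W S T" "\<forall>u. ?T u \<le> T u"
      using less(1)[of ?T] v(3) by blast
    have "T0 u \<le> T u" for u using ST(2)[rule_format, of u] by (auto split: if_splits)
    then show ?thesis using ST(1) by blast
  next
    case False
    then have "component_support V I W {v \<in> V. T0 v < W} T0"
      using less(2) by (auto simp: component_support_def not_less)
    then show ?thesis by blast
  qed
qed

text \<open>Outside \<open>S\<close> the exponents of \<open>t\<close> already count as infinite,
  and inside \<open>S\<close> nothing is added.\<close>

lemma not_in_add:
  assumes "\<not> I t" "\<And>v. v \<in> V - S \<Longrightarrow> W \<le> t v" "\<And>v. v \<in> S \<Longrightarrow> s v = 0"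
  shows "\<not> I (\<lambda>v. s v + t v)"
proof
  assume "I (\<lambda>v. s v + t v)"
  from trunc[OF this] have "I t"
  proof (rule mono)
    show "min (s v + t v) W \<le> t v" if "v \<in> V" for v
      using assms(2)[of v] assms(3)[of v] that by (cases "v \<in> S") auto
  qed
  then show False using assms(1) by blast
qed

lemma ideal_MI: "ideal MI (poly_ring V)"
  by (rule ideal_monomial_ideal) (auto intro: mono simp: lookup_add)

lemma keys_MI: "p \<in> MI \<longleftrightarrow> p \<in> carrier (poly_ring V) \<and> (\<forall>t\<in>Poly_Mapping.keys p. I (Poly_Mapping.lookup t))"
  by (auto simp: monomial_ideal_def)

text \<open>Multiplying the monomial \<open>T\<close> by a variable outside \<open>S\<close> never
  reaches the ideal, by any variable in \<open>S\<close> it does. So the colon ideal is generated by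
  \<open>S\<close>.\<close>

lemma annihilator_component:
  assumes "component_support V I W S T"
  shows "(variable_ideal V S :: 'k::field mpoly set) =
    {a \<in> carrier (poly_ring V). a * Poly_Mapping.single (monomial_of V T) 1 \<in> MI}"
proof -
  let ?t = "monomial_of V T"
  note lk = lookup_monomial_of[OF fin, of T]
  have t: "\<not> I T" "\<And>v. v \<in> V - S \<Longrightarrow> W \<le> T v" "S \<subseteq> V"
    "\<And>v. v \<in> S \<Longrightarrow> I (T(v := T v + 1))"
    using assms by (auto simp: component_support_def)
  have iff: "I (Poly_Mapping.lookup (s + ?t)) \<longleftrightarrow> Poly_Mapping.keys s \<inter> S \<noteq> {}" for s
  proof
    assume *: "I (Poly_Mapping.lookup (s + ?t))"
    show "Poly_Mapping.keys s \<inter> S \<noteq> {}"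
    proof
      assume "Poly_Mapping.keys s \<inter> S = {}"
      then have "\<not> I (\<lambda>v. Poly_Mapping.lookup s v + T v)"
        using t by (intro not_in_add[of T S]) (auto simp: in_keys_iff)
      moreover have "I (\<lambda>v. Poly_Mapping.lookup s v + T v)"
        using * by (rule mono) (simp add: lookup_add lk)
      ultimately show False by blast
    qed
  next
    assume "Poly_Mapping.keys s \<inter> S \<noteq> {}"
    then obtain v where v: "v \<in> Poly_Mapping.keys s" "v \<in> S" by blast
    from t(4)[OF v(2)] show "I (Poly_Mapping.lookup (s + ?t))"
      by (rule mono) (use v in \<open>auto simp: lookup_add lk in_keys_iff\<close>)
  qed
  have m: "Poly_Mapping.single ?t 1 \<in> carrier (poly_ring V :: 'k mpoly ring)"
    using keys_monomial_of[OF fin, of T] by (rule single_in_carrier)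
  show ?thesis
    using poly_ring_closed(2)[OF _ m] iff
    by (auto simp: keys_MI variable_ideal_def monomial_ideal_def keys_times_single)
qed

lemma associated_primes_MI:
  "associated_primes (poly_ring V) (MI :: 'k::field mpoly set) =
    {variable_ideal V S | S. \<exists>T. component_support V I W S T}"
  unfolding cring.associated_primes_quot[OF cring_poly_ring ideal_MI] poly_ring_simps
proof (intro equalityI subsetI)
  fix P :: "'k mpoly set" assume "P \<in> {variable_ideal V S | S. \<exists>T. component_support V I W S T}"
  then obtain S T where S: "P = variable_ideal V S" "component_support V I W S T" by blast
  have "Poly_Mapping.single (monomial_of V T) 1 \<in> carrier (poly_ring V :: 'k mpoly ring)"
    using keys_monomial_of[OF fin, of T] by (rule single_in_carrier)
  then show "P \<in> {P. primeideal P (poly_ring V) \<and>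
      (\<exists>f\<in>carrier (poly_ring V). P = {a \<in> carrier (poly_ring V). a * f \<in> MI})}"
    using annihilator_component[OF S(2)] S(1) primeideal_variable_ideal by blast
next
  fix P :: "'k mpoly set"
  assume "P \<in> {P. primeideal P (poly_ring V) \<and>
      (\<exists>f\<in>carrier (poly_ring V). P = {a \<in> carrier (poly_ring V). a * f \<in> MI})}"
  then obtain f where P: "primeideal P (poly_ring V)" and f: "f \<in> carrier (poly_ring V)"
    and Pf: "P = {a \<in> carrier (poly_ring V). a * f \<in> MI}" by blast
  note id = primeideal.axioms(1)[OF P]
  note MIr = ideal_poly_ring[OF ideal_MI]
  define S where "S = {v \<in> V. variable v \<in> P}"
  \<comment> \<open>A product of variables not in \<open>P\<close>, hence itself not in the prime
    \<open>P\<close>. Replacing \<open>f\<close> by \<open>g\<close> keeps the annihilator and makes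
    all exponents outside \<open>S\<close> at least \<open>W\<close>.\<close>
  define u where "u = monomial_of (V - S) (\<lambda>_. W)"
  define g where "g = f * Poly_Mapping.single u 1"
  have finS: "finite (V - S)" using fin by simp
  have u: "Poly_Mapping.single u 1 \<in> carrier (poly_ring V :: 'k mpoly ring)"
    using keys_monomial_of[OF finS, of "\<lambda>_. W"] by (intro single_in_carrier) (auto simp: u_def)
  have g: "g \<in> carrier (poly_ring V)" using poly_ring_closed(2)[OF f u] by (simp add: g_def)
  have uP: "Poly_Mapping.single u 1 \<notin> P"
    using monomial_in_prime[OF P finS, of "\<lambda>_. W"] by (auto simp: u_def S_def)
  have Pg: "a \<in> P \<longleftrightarrow> a * g \<in> MI" if a: "a \<in> carrier (poly_ring V)" for a
  proof -
    have "a * g \<in> MI \<longleftrightarrow> a * Poly_Mapping.single u 1 \<in> P"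
      using poly_ring_closed(2)[OF a u] by (simp add: Pf g_def mult.assoc mult.commute[of f])
    then show ?thesis
      using primeideal_poly_ring(2)[OF P a u] uP ideal_poly_ring(4)[OF id _ u] by blast
  qed
  have gW: "W \<le> Poly_Mapping.lookup t v" if "t \<in> Poly_Mapping.keys g" "v \<in> V - S" for t v
    using that by (auto simp: g_def keys_times_single lookup_add u_def lookup_monomial_of[OF finS])
  have "g \<notin> MI" using Pg[OF one_in_carrier] primeideal_poly_ring(1)[OF P] by simp
  then obtain t where t: "t \<in> Poly_Mapping.keys g" "\<not> I (Poly_Mapping.lookup t)"
    using g by (auto simp: keys_MI)
  have "component_support V I W S (Poly_Mapping.lookup t)"
    unfolding component_support_def
  proof (intro conjI ballI)
    show "S \<subseteq> V" by (auto simp: S_def)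
    fix v assume v: "v \<in> S"
    \<comment> \<open>The ideal is monomial, so this statement about \<open>g\<close> passes to its
      single term \<open>t\<close>.\<close>
    have "g * variable v \<in> MI" using v Pg[of "variable v"] ideal_poly_ring(1)[OF id]
      by (auto simp: S_def mult.commute)
    then have "I (Poly_Mapping.lookup (t + Poly_Mapping.single v 1))"
      using t(1) by (simp add: keys_MI variable_def keys_times_single)
    then show "I ((Poly_Mapping.lookup t)(v := Poly_Mapping.lookup t v + 1))"
      by (rule mono) (simp add: lookup_add lookup_single when_def)
  qed (use t gW in blast)+
  moreover have "P = variable_ideal V S"
  proof
    show sub: "variable_ideal V S \<subseteq> P"
      by (rule variable_ideal_subset_prime[OF id]) (simp add: S_def)
    show "P \<subseteq> variable_ideal V S"
    proof
      fix a assume a: "a \<in> P"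
      let ?A = "{t :: monom. Poly_Mapping.keys t \<inter> S = {}}" and ?B = "{t :: monom. \<not> I (Poly_Mapping.lookup t)}"
      have ac: "a \<in> carrier (poly_ring V)" using ideal_poly_ring(1)[OF id a] .
      define a0 where "a0 = restrict_poly ?A a"
      define a1 where "a1 = restrict_poly (- ?A) a"
      have a1: "a1 \<in> variable_ideal V S" and a0c: "a0 \<in> carrier (poly_ring V)"
        using restrict_variable_ideal[OF ac] by (simp_all add: a1_def a0_def)
      have aa: "a = a0 + a1" by (simp add: a0_def a1_def restrict_poly_add_compl)
      have "a - a1 \<in> P" using ideal_poly_ring(6)[OF id a] a1 sub by blast
      then have "a0 \<in> P" by (simp add: aa)
      \<comment> \<open>Only the terms of \<open>g\<close> outside the ideal can obstruct. By
        \<open>not_in_add\<close> no term of \<open>a0 * g0\<close> lies in the ideal, although the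
        product does; hence it is zero, and \<open>g0\<close> is nonzero because it contains
        \<open>t\<close>.\<close>
      define g0 where "g0 = restrict_poly ?B g"
      define g1 where "g1 = restrict_poly (- ?B) g"
      have gg: "g = g0 + g1" by (simp add: g0_def g1_def restrict_poly_add_compl)
      have "g1 \<in> MI" using restrict_variable_ideal(2)[OF g, of "- ?B"]
        by (simp add: keys_MI g1_def keys_restrict_poly)
      then have "a0 * g1 \<in> MI" using MIr(5) a0c by blast
      moreover have "a0 * g \<in> MI" using Pg[OF a0c] \<open>a0 \<in> P\<close> by simp
      ultimately have "a0 * g - a0 * g1 \<in> MI" using MIr(6) by blast
      then have a0g0: "a0 * g0 \<in> MI" by (simp add: gg algebra_simps)
      have "Poly_Mapping.keys (a0 * g0) = {}"
      proof (rule equals0I)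
        fix r assume r: "r \<in> Poly_Mapping.keys (a0 * g0)"
        then obtain s q where sq: "r = s + q" "s \<in> Poly_Mapping.keys a0" "q \<in> Poly_Mapping.keys g0"
          using keys_mult[of a0 g0] by blast
        have "\<not> I (\<lambda>v. Poly_Mapping.lookup s v + Poly_Mapping.lookup q v)"
        proof (rule not_in_add)
          show "\<not> I (Poly_Mapping.lookup q)" using sq(3) by (simp add: g0_def keys_restrict_poly)
          show "W \<le> Poly_Mapping.lookup q v" if "v \<in> V - S" for v
            using gW[OF _ that] sq(3) by (simp add: g0_def keys_restrict_poly)
          show "Poly_Mapping.lookup s v = 0" if "v \<in> S" for v
            using sq(2) that by (auto simp: a0_def keys_restrict_poly in_keys_iff)
        qed
        moreover have "I (Poly_Mapping.lookup r)" using r a0g0 by (simp add: keys_MI)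
        ultimately show False by (simp add: sq(1) lookup_add[abs_def])
      qed
      then have "a0 = 0 \<or> g0 = 0" by (simp only: keys_eq_empty mult_eq_0_iff)
      moreover have "t \<in> Poly_Mapping.keys g0" using t by (simp add: g0_def keys_restrict_poly)
      ultimately have "a0 = 0" by auto
      then show "a \<in> variable_ideal V S" using a1 aa by simp
    qed
  qed
  ultimately show "P \<in> {variable_ideal V S | S. \<exists>T. component_support V I W S T}" by blast
qed

text \<open>The counterpart of a minimal prime: it lets an arbitrary chain of primes above the ideal
  be compared with a component.\<close>

lemma MI_prime_support:
  assumes P: "primeideal P (poly_ring V :: 'k::field mpoly ring)" and "MI \<subseteq> P"
  shows "\<exists>S T. component_support V I W S T \<and> (\<forall>v\<in>S. variable v \<in> P)"
proof -
  define S' where "S' = {v \<in> V. variable v \<in> P}"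
  \<comment> \<open>Only variables of \<open>P\<close> are left below \<open>W\<close>, so a support
    found above \<open>T0\<close> consists of variables of \<open>P\<close>. The monomial itself is
    outside the ideal, as \<open>P\<close> would otherwise contain one of the remaining
    variables.\<close>
  define T0 where "T0 v = (if v \<in> S' then 0 else W)" for v
  have finS: "finite (V - S')" using fin by simp
  have "\<not> I T0"
  proof
    assume "I T0"
    let ?m = "monomial_of (V - S') (\<lambda>_. W)"
    have "I (Poly_Mapping.lookup ?m)"
      using \<open>I T0\<close> by (rule mono) (simp add: lookup_monomial_of[OF finS] T0_def)
    moreover have "(Poly_Mapping.single ?m 1 :: 'k mpoly) \<in> carrier (poly_ring V)"
      using keys_monomial_of[OF finS, of "\<lambda>_. W"] by (intro single_in_carrier) blast
    ultimately have "(Poly_Mapping.single ?m 1 :: 'k mpoly) \<in> MI" by (simp add: keys_MI)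
    then have "Poly_Mapping.single ?m 1 \<in> P" using assms(2) by blast
    then show False using monomial_in_prime[OF P finS] by (auto simp: S'_def)
  qed
  then obtain S T where ST: "component_support V I W S T" "\<forall>v. T0 v \<le> T v"
    using extend_component_support by blast
  have "variable v \<in> P" if "v \<in> S" for v
    using component_support_less[OF ST(1) that] ST(2)[rule_format, of v]
    by (auto simp: T0_def S'_def split: if_splits)
  then show ?thesis using ST(1) by blast
qed

text \<open>A component with support \<open>S\<close> contributes dimension
  \<open>card V - card S\<close>. If all supports have the same size, the dimension of the quotient
  by the whole ideal is this common value as well.\<close>

theorem unmixed_MI_iff:
  "unmixed (poly_ring V) (MI :: 'k::field mpoly set) \<longleftrightarrow>
    (\<exists>N. \<forall>S T. component_support V I W S T \<longrightarrow> card S = N)"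
proof
  assume u: "unmixed (poly_ring V) (MI :: 'k mpoly set)"
  have "enat (card (V - S)) = krull_dim (poly_ring V Quot (MI :: 'k mpoly set))" and "card S = card V - card (V - S)"
    if S: "component_support V I W S T" for S T
  proof -
    have sub: "S \<subseteq> V" using S by (simp add: component_support_def)
    have "(variable_ideal V S :: 'k mpoly set) \<in> associated_primes (poly_ring V) MI"
      using S by (auto simp: associated_primes_MI)
    then show "enat (card (V - S)) = krull_dim (poly_ring V Quot (MI :: 'k mpoly set))"
      using u krull_dim_variable_ideal[OF fin sub, where 'k='k] by (simp add: unmixed_def)
    show "card S = card V - card (V - S)"
      using sub fin card_mono[OF fin sub] by (simp add: card_Diff_subset finite_subset)
  qed
  \<comment> \<open>Solving for \<open>card S\<close> exhibits a value that does not depend on the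
    support.\<close>
  then have "card S = card V - the_enat (krull_dim (poly_ring V Quot (MI :: 'k mpoly set)))"
    if "component_support V I W S T" for S T
    using that by (metis the_enat.simps)
  then show "\<exists>N. \<forall>S T. component_support V I W S T \<longrightarrow> card S = N" by blast
next
  assume "\<exists>N. \<forall>S T. component_support V I W S T \<longrightarrow> card S = N"
  then obtain N where N: "\<And>S T. component_support V I W S T \<Longrightarrow> card S = N" by blast
  have diff: "card (V - S) = card V - N" "S \<subseteq> V" if S: "component_support V I W S T" for S T
  proof -
    show "S \<subseteq> V" using S by (simp add: component_support_def)
    then show "card (V - S) = card V - N" using fin N[OF S] by (simp add: card_Diff_subset finite_subset)
  qed
  show "unmixed (poly_ring V) (MI :: 'k mpoly set)"
    unfolding unmixed_def associated_primes_MI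
  proof clarify
    fix S T assume S: "component_support V I W S T"
    have MIS: "(MI :: 'k mpoly set) \<subseteq> variable_ideal V S"
      unfolding annihilator_component[OF S]
      using ideal_poly_ring(1,4)[OF ideal_MI] single_in_carrier[OF keys_monomial_of[OF fin]] by blast
    have "krull_dim (poly_ring V Quot (MI :: 'k mpoly set)) = enat (card (V - S))"
      unfolding cring.krull_dim_quot[OF cring_poly_ring ideal_MI]
    proof (rule antisym)
      show "Sup {enat l | l. \<exists>Q. (\<forall>i\<le>l. primeideal (Q i) (poly_ring V) \<and> (MI :: 'k mpoly set) \<subseteq> Q i) \<and>
         (\<forall>i<l. Q i \<subset> Q (Suc i))} \<le> enat (card (V - S))"
      proof (rule Sup_least, clarify)
        fix l and Q :: "nat \<Rightarrow> 'k mpoly set"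
        assume Q: "\<forall>i\<le>l. primeideal (Q i) (poly_ring V) \<and> MI \<subseteq> Q i" "\<forall>i<l. Q i \<subset> Q (Suc i)"
        \<comment> \<open>Upper bound: the first prime of any chain contains the variables of some
          support \<open>S'\<close>, which is as large as \<open>S\<close>.\<close>
        then have Q0: "primeideal (Q 0) (poly_ring V)" "MI \<subseteq> Q 0" by simp_all
        obtain S' T' where S': "component_support V I W S' T'" "\<forall>v\<in>S'. variable v \<in> Q 0"
          using MI_prime_support[OF Q0] by blast
        have "l \<le> card (V - S')"
        proof (rule prime_chain_length_le[OF fin, of l Q])
          show "variable_ideal V S' \<subseteq> Q 0"
            by (rule variable_ideal_subset_prime[OF primeideal.axioms(1)[OF Q0(1)]]) (use S'(2) in blast)
        qed (use Q in simp_all)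
        then show "enat l \<le> enat (card (V - S))" using diff[OF S] diff[OF S'(1)] by simp
      qed
      obtain Q :: "nat \<Rightarrow> 'k mpoly set" where Q: "\<forall>i\<le>card (V - S). primeideal (Q i) (poly_ring V) \<and>
          variable_ideal V S \<subseteq> Q i" "\<forall>i<card (V - S). Q i \<subset> Q (Suc i)"
        using variable_ideal_chain[OF fin diff(2)[OF S]] by blast
      show "enat (card (V - S)) \<le> Sup {enat l | l. \<exists>Q. (\<forall>i\<le>l. primeideal (Q i) (poly_ring V) \<and>
         (MI :: 'k mpoly set) \<subseteq> Q i) \<and> (\<forall>i<l. Q i \<subset> Q (Suc i))}"
        using Q MIS by (intro Sup_upper CollectI exI[of _ "card (V - S)"] exI[of _ Q] conjI refl) blast+
    qed
    then show "krull_dim (poly_ring V Quot (variable_ideal V S :: 'k mpoly set)) = krull_dim (poly_ring V Quot (MI :: 'k mpoly set))"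
      using krull_dim_variable_ideal[OF fin diff(2)[OF S], where 'k='k] by simp
  qed
qed

end

section \<open>Unmixed skew tableau ideals\<close>

definition box_exponents :: "(nat \<times> nat) set \<Rightarrow> (nat \<times> nat \<Rightarrow> nat) \<Rightarrow> (var \<Rightarrow> nat) \<Rightarrow> bool" where
  "box_exponents D w t \<longleftrightarrow> (\<exists>(i, j)\<in>D. w (i, j) \<le> t (X i) \<and> w (i, j) \<le> t (Y j))"

text \<open>Divisibility by a power of \<open>variable (X i) * variable (Y j)\<close> compares just
  two exponents.\<close>

lemma skew_tableau_ideal_eq:
  assumes D: "\<And>i j. (i, j) \<in> skew_diagram n lam mu \<Longrightarrow> X i \<in> skew_vars n lam \<and> Y j \<in> skew_vars n lam"
  shows "(skew_tableau_ideal n lam mu w :: 'k::field mpoly set) =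
    monomial_ideal (skew_vars n lam) {t. box_exponents (skew_diagram n lam mu) w (Poly_Mapping.lookup t)}"
proof -
  let ?D = "skew_diagram n lam mu"
  define g where "g i j = Poly_Mapping.single (X i) (w (i, j)) + Poly_Mapping.single (Y j) (w (i, j))" for i j
  define G where "G = {g i j | i j. (i, j) \<in> ?D}"
  have lg: "Poly_Mapping.lookup (g i j) v = (if v = X i \<or> v = Y j then w (i, j) else 0)" for i j v
    by (simp add: g_def lookup_add lookup_single when_def)
  have "(variable (X i) * variable (Y j)) ^ w (i, j) = (Poly_Mapping.single (g i j) 1 :: 'k mpoly)" for i j
    by (simp add: power_mult_distrib variable_power mult_single g_def)
  then have "{(variable (X i) * variable (Y j)) ^ w (i, j) | i j. (i, j) \<in> ?D} =
      (\<lambda>g. Poly_Mapping.single g (1 :: 'k)) ` G"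
    unfolding G_def by auto
  moreover have "{g + s | g s. g \<in> G} = {t. box_exponents ?D w (Poly_Mapping.lookup t)}"
  proof (intro equalityI subsetI)
    fix t assume "t \<in> {g + s | g s. g \<in> G}"
    then obtain i j s where "(i, j) \<in> ?D" "t = g i j + s" by (auto simp: G_def)
    then show "t \<in> {t. box_exponents ?D w (Poly_Mapping.lookup t)}"
      by (auto simp: box_exponents_def lookup_add lg intro!: bexI[of _ "(i, j)"])
  next
    fix t assume "t \<in> {t. box_exponents ?D w (Poly_Mapping.lookup t)}"
    then obtain i j where ij: "(i, j) \<in> ?D"
      "w (i, j) \<le> Poly_Mapping.lookup t (X i)" "w (i, j) \<le> Poly_Mapping.lookup t (Y j)"
      by (auto simp: box_exponents_def)
    then have "t = g i j + (t - g i j)"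
      by (intro poly_mapping_eqI) (auto simp: lookup_add lookup_minus lg)
    then show "t \<in> {g + s | g s. g \<in> G}" using ij(1) unfolding G_def by blast
  qed
  moreover have "Poly_Mapping.keys h \<subseteq> skew_vars n lam" if "h \<in> G" for h
    using that D by (auto simp: G_def in_keys_iff lg split: if_splits)
  ultimately show ?thesis
    unfolding skew_tableau_ideal_def using genideal_monomials[of G "skew_vars n lam"] by simp
qed

text \<open>Columns are renumbered from right to left, so that the boxes on the antidiagonal become the
  reflexive pairs.\<close>

definition box_rel :: "nat \<Rightarrow> (nat \<times> nat) set \<Rightarrow> nat \<Rightarrow> nat \<Rightarrow> bool" where
  "box_rel n D i c \<longleftrightarrow> i \<in> {1..n} \<and> c \<in> {1..n} \<and> (i, n + 1 - c) \<in> D"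

definition transitive_filling :: "(nat \<Rightarrow> nat \<Rightarrow> bool) \<Rightarrow> (nat \<Rightarrow> nat \<Rightarrow> nat) \<Rightarrow> bool" where
  "transitive_filling r v \<longleftrightarrow>
     (\<forall>i k c. r i k \<longrightarrow> r k c \<longrightarrow> r i c \<and> v i c \<le> v i k \<and> v i c \<le> v k c)"

lemma skew_diagram_bounds:
  assumes "skew_shape n lam mu" "(i, j) \<in> skew_diagram n lam mu"
  shows "i \<in> {1..n}" "j \<in> {1..lam 1}"
proof -
  show i: "i \<in> {1..n}" using assms(2) by (simp add: skew_diagram_def)
  have "lam i \<le> lam 1" using assms(1) i
    unfolding skew_shape_def monotone_on_def by auto
  then show "j \<in> {1..lam 1}" using assms(2) by (simp add: skew_diagram_def)
qed

text \<open>The antidiagonal boxes pair the row variable \<open>X k\<close> with the column variable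
  \<open>Y (n + 1 - k)\<close>. A support meets each pair, so it has \<open>n\<close> elements if
  and only if it never contains both members of a pair.\<close>

theorem unmixed_skew_tableau_iff:
  assumes sh: "skew_shape n lam mu"
    and cols: "\<And>j. j \<in> {1..lam 1} \<Longrightarrow> \<exists>i. (i, j) \<in> skew_diagram n lam mu"
    and w: "\<forall>b\<in>skew_diagram n lam mu. w b > 0"
  shows "unmixed (poly_ring (skew_vars n lam)) (skew_tableau_ideal n lam mu w :: 'k::field mpoly set) \<longleftrightarrow>
    lam 1 = n \<and> (\<forall>k\<in>{1..n}. box_rel n (skew_diagram n lam mu) k k) \<and>
    transitive_filling (box_rel n (skew_diagram n lam mu)) (\<lambda>i c. w (i, n + 1 - c))"
    (is "?L \<longleftrightarrow> ?R")
proof -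
  let ?D = "skew_diagram n lam mu" and ?V = "skew_vars n lam"
  note bounds = skew_diagram_bounds[OF sh]
  have finD: "finite ?D"
    by (rule finite_subset[of _ "{1..n} \<times> {1..lam 1}"]) (use bounds in auto)
  obtain W where W: "\<And>b. b \<in> ?D \<Longrightarrow> w b \<le> W"
    using finD finite_nat_set_iff_bounded_le[of "w ` ?D"] by auto
  let ?I = "box_exponents ?D w"
  interpret bounded_monomial_ideal ?V ?I W
  proof
    show "finite ?V" by (simp add: skew_vars_def)
    show "?I t" if Is: "?I s" and st: "\<And>v. v \<in> ?V \<Longrightarrow> s v \<le> t v" for s t
    proof -
      obtain i j where ij: "(i, j) \<in> ?D" "w (i, j) \<le> s (X i)" "w (i, j) \<le> s (Y j)"
        using Is by (auto simp: box_exponents_def)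
      then have "s (X i) \<le> t (X i)" "s (Y j) \<le> t (Y j)"
        using bounds[OF ij(1)] by (auto intro!: st simp: skew_vars_def)
      then show ?thesis using ij by (auto simp: box_exponents_def intro!: bexI[of _ "(i, j)"])
    qed
    show "?I (\<lambda>v. min (t v) W)" if "?I t" for t
      using that W by (fastforce simp: box_exponents_def)
  qed
  let ?C = "component_support ?V ?I W"
  have XV: "X i \<in> ?V \<longleftrightarrow> i \<in> {1..n}" and YV: "Y j \<in> ?V \<longleftrightarrow> j \<in> {1..lam 1}" for i j
    by (auto simp: skew_vars_def)
  have "?L \<longleftrightarrow> (\<exists>N. \<forall>S T. ?C S T \<longrightarrow> card S = N)"
    using unmixed_MI_iff[where 'k='k] skew_tableau_ideal_eq[of n lam mu w, where 'k='k] bounds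
    by (auto simp: skew_vars_def)
  also have "\<dots> \<longleftrightarrow> ?R"
  proof
    assume R: ?R
    let ?r = "box_rel n ?D"
    have ln: "lam 1 = n" and refl: "\<And>k. k \<in> {1..n} \<Longrightarrow> (k, n + 1 - k) \<in> ?D"
      using R by (auto simp: box_rel_def)
    have VV: "X k \<in> ?V" "Y (n + 1 - k) \<in> ?V" if "k \<in> {1..n}" for k
      using that unfolding XV YV ln by auto
    have tr: "(i, n + 1 - c) \<in> ?D \<and> w (i, n + 1 - c) \<le> w (i, n + 1 - k) \<and> w (i, n + 1 - c) \<le> w (k, n + 1 - c)"
      if "?r i k" "?r k c" for i k c
      using R that unfolding transitive_filling_def box_rel_def by blast
    have "card S = n" if C: "?C S T" for S T
    proof -
      have S: "S \<subseteq> ?V" "\<not> ?I T" "\<And>v. v \<in> ?V - S \<Longrightarrow> W \<le> T v"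
        "\<And>v. v \<in> S \<Longrightarrow> ?I (T(v := T v + 1))" using C by (auto simp: component_support_def)
      have ge: "X k \<in> S \<or> Y (n + 1 - k) \<in> S" if k: "k \<in> {1..n}" for k
      proof (rule ccontr)
        assume "\<not> (X k \<in> S \<or> Y (n + 1 - k) \<in> S)"
        then have "W \<le> T (X k)" "W \<le> T (Y (n + 1 - k))"
          using VV[OF k] S(3) by blast+
        then have "?I T" using W[OF refl[OF k]] refl[OF k]
          by (auto simp: box_exponents_def intro!: bexI[of _ "(k, n + 1 - k)"])
        then show False using S(2) by simp
      qed
      \<comment> \<open>If both belonged to \<open>S\<close>, raising either exponent would reach
        the ideal through boxes in row \<open>k\<close> and column \<open>n + 1 - k\<close>. By the
        composition rule the other two lines of these boxes cross in a box that already puts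
        \<open>T\<close> into the ideal.\<close>
      have le: "\<not> (X k \<in> S \<and> Y (n + 1 - k) \<in> S)" if k: "k \<in> {1..n}" for k
      proof
        assume XY: "X k \<in> S \<and> Y (n + 1 - k) \<in> S"
        have "?I (T(X k := T (X k) + 1))" using S(4) XY by blast
        then obtain j where j: "(k, j) \<in> ?D" "w (k, j) \<le> T (Y j)"
          using S(2) by (fastforce simp: box_exponents_def split: if_splits)
        have "?I (T(Y (n + 1 - k) := T (Y (n + 1 - k)) + 1))" using S(4) XY by blast
        then obtain i where i: "(i, n + 1 - k) \<in> ?D" "w (i, n + 1 - k) \<le> T (X i)"
          using S(2) by (fastforce simp: box_exponents_def split: if_splits)
        define c where "c = n + 1 - j"
        have c: "c \<in> {1..n}" "n + 1 - c = j" using bounds[OF j(1)] ln by (auto simp: c_def)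
        have "?r i k" "?r k c" using i(1) j(1) k c bounds[OF i(1)] by (auto simp: box_rel_def)
        then have "(i, j) \<in> ?D \<and> w (i, j) \<le> w (i, n + 1 - k) \<and> w (i, j) \<le> w (k, j)"
          using tr c by metis
        then have "?I T" using i j by (auto simp: box_exponents_def intro!: bexI[of _ "(i, j)"])
        then show False using S(2) by simp
      qed
      define f where "f k = (if X k \<in> S then X k else Y (n + 1 - k))" for k
      have "inj_on f {1..n}" by (auto simp: inj_on_def f_def split: if_splits)
      moreover have "S = f ` {1..n}"
      proof (intro equalityI subsetI)
        fix v assume v: "v \<in> S"
        show "v \<in> f ` {1..n}"
        proof (cases v)
          case (X k)
          then show ?thesis using v S(1) by (auto simp: f_def skew_vars_def intro!: image_eqI[of _ _ k])
        next
          case (Y j)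
          then have "n + 1 - j \<in> {1..n}" "n + 1 - (n + 1 - j) = j"
            using subsetD[OF S(1) v] unfolding Y YV ln by auto
          then show ?thesis using v Y le[of "n + 1 - j"] by (auto simp: f_def intro!: image_eqI[of _ _ "n + 1 - j"])
        qed
      next
        fix v assume "v \<in> f ` {1..n}"
        then obtain k where k: "k \<in> {1..n}" "v = f k" by blast
        then show "v \<in> S" using ge[OF k(1)] by (simp add: f_def split: if_splits)
      qed
      ultimately show ?thesis by (simp add: card_image)
    qed
    then show "\<exists>N. \<forall>S T. ?C S T \<longrightarrow> card S = N" by blast
  next
    assume "\<exists>N. \<forall>S T. ?C S T \<longrightarrow> card S = N"
    then obtain N where N: "\<And>S T. ?C S T \<Longrightarrow> card S = N" by blast
    \<comment> \<open>Exponent 0 on a cover keeps the monomial outside the ideal because the weights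
      are positive; all variables off the cover have exponent \<open>W\<close> and stay out of the
      support.\<close>
    have cover: "\<exists>S T. ?C S T \<and> S \<subseteq> Z" if Z: "\<And>i j. (i, j) \<in> ?D \<Longrightarrow> X i \<in> Z \<or> Y j \<in> Z" for Z
    proof -
      let ?T0 = "\<lambda>v. if v \<in> Z then 0 else W"
      have "\<not> ?I ?T0" using Z w by (fastforce simp: box_exponents_def)
      then obtain S T where ST: "?C S T" "\<forall>v. ?T0 v \<le> T v" using extend_component_support by blast
      have "v \<in> Z" if "v \<in> S" for v
        using component_support_less[OF ST(1) that] ST(2)[rule_format, of v] by (auto split: if_splits)
      then show ?thesis using ST(1) by blast
    qed
    have hit: "X i \<in> S \<or> Y j \<in> S" if C: "?C S T" and ij: "(i, j) \<in> ?D" for S T i j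
    proof (rule ccontr)
      assume "\<not> (X i \<in> S \<or> Y j \<in> S)"
      then have "W \<le> T (X i)" "W \<le> T (Y j)"
        using C bounds[OF ij] by (auto simp: component_support_def skew_vars_def)
      then have "?I T" using W[OF ij] ij by (auto simp: box_exponents_def intro!: bexI[of _ "(i, j)"])
      then show False using C by (simp add: component_support_def)
    qed
    have row: "(i, lam i) \<in> ?D" if "i \<in> {1..n}" for i
      using sh that by (auto simp: skew_shape_def skew_diagram_def Suc_le_eq)
    \<comment> \<open>Every row contains a box, so a support consisting of row variables contains
      all of them. The same with columns gives two supports of sizes \<open>n\<close> and
      \<open>lam 1\<close>.\<close>
    obtain S T where S: "?C S T" "S \<subseteq> X ` {1..n}" using cover[of "X ` {1..n}"] bounds by auto
    have "X i \<in> S" if "i \<in> {1..n}" for i using hit[OF S(1) row[OF that]] S(2) by auto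
    then have "S = X ` {1..n}" using S(2) by blast
    then have Nn: "N = n" using N[OF S(1)] by (simp add: card_image inj_on_def)
    obtain S T where S: "?C S T" "S \<subseteq> Y ` {1..lam 1}" using cover[of "Y ` {1..lam 1}"] bounds by auto
    have "Y j \<in> S" if "j \<in> {1..lam 1}" for j
      using cols[OF that] hit[OF S(1)] S(2) by blast
    then have "S = Y ` {1..lam 1}" using S(2) by blast
    then have ln: "lam 1 = n" using N[OF S(1)] Nn by (simp add: card_image inj_on_def)
    have VV: "X k \<in> ?V" "Y (n + 1 - k) \<in> ?V" if "k \<in> {1..n}" for k
      using that unfolding XV YV ln by auto
    have small: "n \<le> card Z" if Z: "\<And>i j. (i, j) \<in> ?D \<Longrightarrow> X i \<in> Z \<or> Y j \<in> Z" "finite Z" for Z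
    proof -
      obtain S T where "?C S T" "S \<subseteq> Z" using cover[of Z] Z(1) by blast
      then show ?thesis using N Nn card_mono[OF Z(2)] by metis
    qed
    have anti: "lam i \<le> lam k" "mu i \<le> mu k" if "k \<in> {1..n}" "i \<in> {1..n}" "k \<le> i" for i k
      using sh that by (auto simp: skew_shape_def monotone_on_def)
    have refl: "(k, n + 1 - k) \<in> ?D" if k: "k \<in> {1..n}" for k
    proof (rule ccontr)
      assume "(k, n + 1 - k) \<notin> ?D"
      then consider "lam k < n + 1 - k" | "n + 1 - k \<le> mu k" using k by (auto simp: skew_diagram_def)
      then show False
      proof cases
        case 1
        \<comment> \<open>The box lies to the right of row \<open>k\<close>, so rows from
          \<open>k\<close> on end by column \<open>n - k\<close>; with the rows above
          \<open>k\<close> this is a cover by \<open>n - 1\<close> lines.\<close>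
        let ?Z = "X ` {1..<k} \<union> Y ` {1..n - k}"
        have "n \<le> card ?Z"
        proof (rule small)
          fix i j assume ij: "(i, j) \<in> ?D"
          then show "X i \<in> ?Z \<or> Y j \<in> ?Z"
            using anti(1)[OF k bounds(1)[OF ij]] bounds[OF ij] 1
            by (cases "k \<le> i") (auto simp: skew_diagram_def)
        qed simp
        also have "card ?Z \<le> card (X ` {1..<k}) + card (Y ` {1..n - k})" by (rule card_Un_le)
        also have "\<dots> = (k - 1) + (n - k)" by (simp add: card_image inj_on_def)
        finally show False using k by auto
      next
        case 2
        \<comment> \<open>The box lies to the left of row \<open>k\<close>, so rows up to
          \<open>k\<close> start at column \<open>n + 2 - k\<close> or later; with the rows below
          \<open>k\<close> this is again a cover by \<open>n - 1\<close> lines.\<close>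
        let ?Z = "X ` {k<..n} \<union> Y ` {n + 2 - k..n}"
        have "n \<le> card ?Z"
        proof (rule small)
          fix i j assume ij: "(i, j) \<in> ?D"
          then show "X i \<in> ?Z \<or> Y j \<in> ?Z"
            using anti(2)[OF bounds(1)[OF ij] k] bounds[OF ij] 2 ln k
            by (cases "i \<le> k") (auto simp: skew_diagram_def)
        qed simp
        also have "card ?Z \<le> card (X ` {k<..n}) + card (Y ` {n + 2 - k..n})" by (rule card_Un_le)
        also have "\<dots> = (n - k) + (k - 1)" using k by (simp add: card_image inj_on_def)
        finally show False using k by auto
      qed
    qed
    have "(i, n + 1 - c) \<in> ?D \<and> w (i, n + 1 - c) \<le> w (i, n + 1 - k) \<and> w (i, n + 1 - c) \<le> w (k, n + 1 - c)"
      if r: "box_rel n ?D i k" "box_rel n ?D k c" for i k c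
    proof (rule ccontr)
      assume neg: "\<not> ?thesis"
      have k: "k \<in> {1..n}" and ik: "(i, n + 1 - k) \<in> ?D" and kc: "(k, n + 1 - c) \<in> ?D"
        using r by (auto simp: box_rel_def)
      \<comment> \<open>A component with these exponents contains both \<open>X k\<close> and \<open>Y (n + 1 - k)\<close>, hence is too large.\<close>
      define T0 where "T0 v = (if v = X i then w (i, n + 1 - k) else if v = Y (n + 1 - c) then w (k, n + 1 - c) else 0)" for v
      \<comment> \<open>Positive weights leave \<open>(i, n + 1 - c)\<close> as the only candidate
        box, and for it the required inequalities are exactly what \<open>neg\<close>
        denies.\<close>
      have "\<not> ?I T0"
        using neg w by (fastforce simp: box_exponents_def T0_def split: if_splits)
      then obtain S T where ST: "?C S T" "\<forall>v. T0 v \<le> T v" using extend_component_support by blast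
      have T: "w (i, n + 1 - k) \<le> T (X i)" "w (k, n + 1 - c) \<le> T (Y (n + 1 - c))"
        using ST(2)[rule_format, of "X i"] ST(2)[rule_format, of "Y (n + 1 - c)"] by (simp_all add: T0_def)
      have notI: "\<not> ?I T" and out: "\<And>v. v \<in> ?V - S \<Longrightarrow> W \<le> T v" and "S \<subseteq> ?V"
        using ST(1) by (auto simp: component_support_def)
      have Xk: "X k \<in> S"
      proof (rule ccontr)
        assume "X k \<notin> S"
        then have "W \<le> T (X k)" using VV[OF k] out by blast
        then have "?I T" using T(2) W[OF kc] kc by (auto simp: box_exponents_def intro!: bexI[of _ "(k, n + 1 - c)"])
        then show False using notI by simp
      qed
      have Yk: "Y (n + 1 - k) \<in> S"
      proof (rule ccontr)
        assume "Y (n + 1 - k) \<notin> S"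
        then have "W \<le> T (Y (n + 1 - k))" using VV[OF k] out by blast
        then have "?I T" using T(1) W[OF ik] ik by (auto simp: box_exponents_def intro!: bexI[of _ "(i, n + 1 - k)"])
        then show False using notI by simp
      qed
      \<comment> \<open>One member from each antidiagonal pair; the second member of the pair of
        index \<open>k\<close> is an extra element.\<close>
      define f where "f k = (if X k \<in> S then X k else Y (n + 1 - k))" for k
      have inj: "inj_on f {1..n}" by (auto simp: inj_on_def f_def split: if_splits)
      have "Y (n + 1 - k) \<notin> f ` {1..n}"
      proof
        assume "Y (n + 1 - k) \<in> f ` {1..n}"
        then obtain l where l: "l \<in> {1..n}" "Y (n + 1 - k) = f l" by blast
        then have "X l \<notin> S" "n + 1 - k = n + 1 - l" by (auto simp: f_def split: if_splits)
        moreover from this(2) have "k = l" using k l(1) by auto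
        ultimately show False using Xk by simp
      qed
      then have "card (insert (Y (n + 1 - k)) (f ` {1..n})) = n + 1"
        using card_image[OF inj] by simp
      moreover have "insert (Y (n + 1 - k)) (f ` {1..n}) \<subseteq> S"
      proof -
        have "f l \<in> S" if "l \<in> {1..n}" for l using hit[OF ST(1) refl[OF that]] by (auto simp: f_def)
        then show ?thesis using Yk by blast
      qed
      moreover have "finite S" using \<open>S \<subseteq> ?V\<close> fin by (rule finite_subset)
      ultimately have "n + 1 \<le> card S" using card_mono[of S "insert (Y (n + 1 - k)) (f ` {1..n})"] by simp
      then show False using N[OF ST(1)] Nn by simp
    qed
    then have "transitive_filling (box_rel n ?D) (\<lambda>i c. w (i, n + 1 - c))"
      unfolding transitive_filling_def box_rel_def by blast
    moreover have "box_rel n ?D k k" if "k \<in> {1..n}" for k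
      using refl[OF that] that unfolding box_rel_def by blast
    ultimately show ?R using ln by blast
  qed
  finally show ?thesis .
qed

section \<open>Convex preorders on intervals\<close>

text \<open>\<open>convex\<close> reflects that a skew diagram contains the rectangle between a box
  and another one weakly below and to the right of it. As columns are numbered from the right, the
  inequalities of the second coordinates are reversed.\<close>

locale skew_preorder =
  fixes l u :: nat and r :: "nat \<Rightarrow> nat \<Rightarrow> bool"
  assumes field: "r i c \<Longrightarrow> i \<in> {l..u} \<and> c \<in> {l..u}"
    and refl: "i \<in> {l..u} \<Longrightarrow> r i i"
    and trans: "r i k \<Longrightarrow> r k c \<Longrightarrow> r i c"
    and convex: "r i c \<Longrightarrow> r i' c' \<Longrightarrow> i \<le> a \<Longrightarrow> a \<le> i' \<Longrightarrow> c' \<le> b \<Longrightarrow> b \<le> c \<Longrightarrow> r a b"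
begin

text \<open>The box of \<open>i\<close> and \<open>c\<close> spans with the antidiagonal box of
  \<open>k\<close> a rectangle that has the two required boxes as corners.\<close>

lemma between_up:
  assumes "r i c" "i \<le> k" "k \<le> c"
  shows "r i k" "r k c"
proof -
  have "r k k" using field[OF assms(1)] assms(2,3) by (intro refl) auto
  with assms show "r i k" "r k c" using convex[of i c k k i k] convex[of i c k k k c] by auto
qed

lemma between_down:
  assumes "r i c" "c \<le> k" "k \<le> i"
  shows "r i k" "r k c"
proof -
  have "r k k" using field[OF assms(1)] assms(2,3) by (intro refl) auto
  with assms show "r i k" "r k c" using convex[of k k i c i k] convex[of k k i c k c] by auto
qed

definition cls :: "nat \<Rightarrow> nat set" where
  "cls x = {y. r x y \<and> r y x}"

lemma cls_self: "x \<in> {l..u} \<Longrightarrow> x \<in> cls x"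
  by (simp add: cls_def refl)

lemma cls_sub: "cls x \<subseteq> {l..u}"
  using field by (auto simp: cls_def)

lemma cls_eq: "y \<in> cls x \<Longrightarrow> cls y = cls x"
  unfolding cls_def using trans[of y x] trans[of x y] trans[of _ y x] trans[of _ x y] by blast

lemma cls_interval: "y \<in> cls x \<Longrightarrow> z \<in> cls x \<Longrightarrow> y \<le> k \<Longrightarrow> k \<le> z \<Longrightarrow> k \<in> cls x"
proof -
  assume y: "y \<in> cls x" and z: "z \<in> cls x" and k: "y \<le> k" "k \<le> z"
  have "r y z" "r z y" using y z trans[of y x z] trans[of z x y] by (auto simp: cls_def)
  then have "r y k" "r k y" using between_up[OF _ k] between_down[OF _ k] by auto
  then show "k \<in> cls x" using y trans[of x y k] trans[of k y x] by (auto simp: cls_def)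
qed

end

text \<open>Exchanging the arguments is the reflection in the antidiagonal; it turns the upper type
  into the lower one.\<close>

lemma skew_preorder_transpose:
  assumes "skew_preorder l u r"
  shows "skew_preorder l u (\<lambda>a b. r b a)"
proof -
  interpret skew_preorder l u r by fact
  show ?thesis
  proof
    show "r b a" if "r c i" "r c' i'" "i \<le> a" "a \<le> i'" "c' \<le> b" "b \<le> c" for i c i' c' a b
      by (rule convex[OF that(2,1)]) (use that in auto)
    show "i \<in> {l..u} \<and> c \<in> {l..u}" if "r c i" for i c using field[OF that] by blast
    show "r i i" if "i \<in> {l..u}" for i using refl[OF that] .
    show "r c i" if "r k i" "r c k" for i k c using trans[OF that(2,1)] .
  qed
qed

lemma skew_preorder_shift:
  assumes "skew_preorder l u r" "0 < l"
  shows "skew_preorder (d + l) (d + u) (\<lambda>a b. d < a \<and> d < b \<and> r (a - d) (b - d))"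
proof -
  interpret skew_preorder l u r by fact
  show ?thesis
  proof
    show "d < a \<and> d < b \<and> r (a - d) (b - d)"
      if "d < i \<and> d < c \<and> r (i - d) (c - d)" "d < i' \<and> d < c' \<and> r (i' - d) (c' - d)"
        "i \<le> a" "a \<le> i'" "c' \<le> b" "b \<le> c" for i c i' c' a b
      using convex[of "i - d" "c - d" "i' - d" "c' - d" "a - d" "b - d"] that by auto
    show "i \<in> {d + l..d + u} \<and> c \<in> {d + l..d + u}" if "d < i \<and> d < c \<and> r (i - d) (c - d)" for i c
      using field[of "i - d" "c - d"] that by auto
    show "d < i \<and> d < c \<and> r (i - d) (c - d)"
      if "d < i \<and> d < k \<and> r (i - d) (k - d)" "d < k \<and> d < c \<and> r (k - d) (c - d)" for i k c
      using trans[of "i - d" "k - d" "c - d"] that by simp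
    show "d < i \<and> d < i \<and> r (i - d) (i - d)" if "i \<in> {d + l..d + u}" for i
    proof -
      have "i - d \<in> {l..u}" "d < i" using that \<open>0 < l\<close> by auto
      then show ?thesis using refl by blast
    qed
  qed
qed

section \<open>Blocks of unmixed partitions\<close>

text \<open>The combinatorial content of \<open>unmixed_partition\<close>, free of the field;
  \<open>unmixed_partition_iff\<close> makes the link.\<close>

locale unmixed_diagram =
  fixes N :: nat and lam :: "nat \<Rightarrow> nat"
  assumes shape: "skew_shape N lam (\<lambda>_. 0)"
    and lam_one: "lam 1 = N"
    and rel_refl: "k \<in> {1..N} \<Longrightarrow> box_rel N (ferrers_diagram N lam) k k"
    and rel_trans: "box_rel N (ferrers_diagram N lam) i k \<Longrightarrow> box_rel N (ferrers_diagram N lam) k c \<Longrightarrow>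
      box_rel N (ferrers_diagram N lam) i c"
begin

abbreviation rel :: "nat \<Rightarrow> nat \<Rightarrow> bool" where
  "rel \<equiv> box_rel N (ferrers_diagram N lam)"

lemma rel_iff: "rel i c \<longleftrightarrow> i \<in> {1..N} \<and> c \<in> {1..N} \<and> N + 1 - c \<le> lam i"
  by (auto simp: box_rel_def ferrers_diagram_def skew_diagram_def)

lemma lam_anti: "i \<in> {1..N} \<Longrightarrow> k \<in> {1..N} \<Longrightarrow> i \<le> k \<Longrightarrow> lam k \<le> lam i"
  using shape by (auto simp: skew_shape_def monotone_on_def)

lemma N_pos: "0 < N"
  using shape by (simp add: skew_shape_def)

lemma lam_bounds: "i \<in> {1..N} \<Longrightarrow> 0 < lam i \<and> lam i \<le> N"
  using shape lam_anti[of 1 i] lam_one by (auto simp: skew_shape_def)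

text \<open>Row \<open>i\<close> starts at the left edge and reaches the antidiagonal. This is where
  the upper type shows.\<close>

lemma rel_up: "i \<in> {1..N} \<Longrightarrow> c \<in> {1..N} \<Longrightarrow> i \<le> c \<Longrightarrow> rel i c"
  using rel_refl[of i] by (auto simp: rel_iff)

lemma skew_preorder_rel: "skew_preorder 1 N rel"
proof
  show "rel a b" if "rel i c" "rel i' c'" "i \<le> a" "a \<le> i'" "c' \<le> b" "b \<le> c" for i c i' c' a b
    using that lam_anti[of a i'] by (auto simp: rel_iff)
  show "i \<in> {1..N} \<and> c \<in> {1..N}" if "rel i c" for i c using that by (simp add: rel_iff)
qed (fact rel_refl rel_trans)+

sublocale skew_preorder 1 N rel by (rule skew_preorder_rel)

lemma row_strip:
  assumes "i \<in> {1..N}"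
  shows "{i' \<in> {1..N}. lam i' = lam i} = cls i"
proof -
  have "lam i' = lam i \<longleftrightarrow> rel i i' \<and> rel i' i" if i': "i' \<in> {1..N}" for i'
  proof
    assume "lam i' = lam i"
    then show "rel i i' \<and> rel i' i" using rel_refl[OF i'] rel_refl[OF assms] by (simp add: rel_iff)
  next
    assume r: "rel i i' \<and> rel i' i"
    \<comment> \<open>The last box of row \<open>a\<close> relates \<open>a\<close> to
      \<open>N + 1 - lam a\<close>; by transitivity row \<open>b\<close> reaches that column
      too.\<close>
    have ge: "lam b \<ge> lam a" if "rel b a" "a \<in> {1..N}" for a b
    proof -
      have "rel a (N + 1 - lam a)" using that lam_bounds[of a] by (auto simp: rel_iff)
      then have "rel b (N + 1 - lam a)" using rel_trans that by blast
      then show ?thesis using lam_bounds[of a] that by (auto simp: rel_iff)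
    qed
    show "lam i' = lam i" using ge[of i i'] ge[of i' i] r assms i' by auto
  qed
  then show ?thesis using cls_sub[of i] by (auto simp: cls_def rel_iff)
qed

text \<open>The length of a column counts the predecessors of its index. The sets of predecessors
  are nested because any two indices are comparable, so equal lengths mean equal sets.\<close>

lemma column_strip:
  assumes c: "c \<in> {1..N}"
  shows "{j' \<in> {1..lam 1}. conjugate N lam j' = conjugate N lam (N + 1 - c)} = (\<lambda>c. N + 1 - c) ` cls c"
proof -
  have conj: "conjugate N lam (N + 1 - c) = card {i. rel i c}" if "c \<in> {1..N}" for c
    unfolding conjugate_def using that by (intro arg_cong[of _ _ card]) (auto simp: rel_iff)
  have fin: "finite {i. rel i c}" for c
    by (rule finite_subset[of _ "{1..N}"]) (auto simp: rel_iff)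
  have sub: "{i. rel i c} \<subseteq> {i. rel i c'}" if "rel c c'" for c c'
    using that rel_trans by blast
  have iff: "card {i. rel i c'} = card {i. rel i c} \<longleftrightarrow> c' \<in> cls c" if c': "c' \<in> {1..N}" for c'
  proof
    assume eq: "card {i. rel i c'} = card {i. rel i c}"
    have "rel c c' \<or> rel c' c" using rel_up[of c c'] rel_up[of c' c] c c' by linarith
    then have "{i. rel i c'} = {i. rel i c}"
      using card_subset_eq[OF fin sub] eq by metis
    then show "c' \<in> cls c" using rel_refl[OF c] rel_refl[OF c'] by (auto simp: cls_def)
  next
    assume "c' \<in> cls c"
    then have "{i. rel i c'} = {i. rel i c}"
      using sub[of c c'] sub[of c' c] by (auto simp: cls_def)
    then show "card {i. rel i c'} = card {i. rel i c}" by simp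
  qed
  show ?thesis
  proof (intro equalityI subsetI)
    fix j assume j: "j \<in> {j' \<in> {1..lam 1}. conjugate N lam j' = conjugate N lam (N + 1 - c)}"
    have "lam (Suc 0) = N" using lam_one by simp
    then have jc: "N + 1 - j \<in> {1..N}" "N + 1 - (N + 1 - j) = j" using j by auto
    then have "N + 1 - j \<in> cls c" using j conj[OF jc(1)] conj[OF c] iff[OF jc(1)] by simp
    then show "j \<in> (\<lambda>c. N + 1 - c) ` cls c" using jc(2) by (metis imageI)
  next
    fix j assume "j \<in> (\<lambda>c. N + 1 - c) ` cls c"
    then obtain c' where c': "c' \<in> cls c" "j = N + 1 - c'" by blast
    have c'N: "c' \<in> {1..N}" using c' cls_sub by blast
    have "conjugate N lam j = conjugate N lam (N + 1 - c)"
      using iff[OF c'N] c' conj[OF c'N] conj[OF c] by simp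
    moreover have "j \<in> {1..lam 1}" unfolding lam_one using c'N c'(2) by auto
    ultimately show "j \<in> {j' \<in> {1..lam 1}. conjugate N lam j' = conjugate N lam (N + 1 - c)}" by blast
  qed
qed

abbreviation block :: "nat \<Rightarrow> nat \<Rightarrow> (nat \<times> nat) set" where
  "block i c \<equiv> cls i \<times> (\<lambda>c. N + 1 - c) ` cls c"

lemma mem_block:
  assumes "c' \<in> {1..N}"
  shows "(i', N + 1 - c') \<in> block i c \<longleftrightarrow> i' \<in> cls i \<and> c' \<in> cls c"
proof -
  have "c' = d" if "d \<in> cls c" "N + 1 - c' = N + 1 - d" for d
    using that assms subsetD[OF cls_sub that(1)] by auto
  then show ?thesis by auto
qed

text \<open>By transitivity one box of a product of two classes lies in the diagram if and only if
  all do.\<close>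

lemma blocks_eq: "blocks N lam = {block i c | i c. rel i c}"
proof -
  have rows: "row_strips N lam = {cls i | i. i \<in> {1..N}}"
    unfolding row_strips_def using row_strip by auto
  have cols: "column_strips N lam = {(\<lambda>c. N + 1 - c) ` cls c | c. c \<in> {1..N}}"
  proof (intro equalityI subsetI)
    fix C assume "C \<in> column_strips N lam"
    then obtain j where j: "j \<in> {1..lam 1}" "C = {j' \<in> {1..lam 1}. conjugate N lam j' = conjugate N lam j}"
      unfolding column_strips_def by blast
    have jN: "j \<in> {1..N}" using j(1) unfolding lam_one .
    then have jc: "N + 1 - j \<in> {1..N}" "N + 1 - (N + 1 - j) = j" by auto
    then show "C \<in> {(\<lambda>c. N + 1 - c) ` cls c | c. c \<in> {1..N}}"
      using column_strip[OF jc(1)] j(2) by auto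
  next
    fix C assume "C \<in> {(\<lambda>c. N + 1 - c) ` cls c | c. c \<in> {1..N}}"
    then obtain c where c: "c \<in> {1..N}" "C = (\<lambda>c. N + 1 - c) ` cls c" by blast
    have "N + 1 - c \<in> {1..lam 1}" unfolding lam_one using c(1) by auto
    then show "C \<in> column_strips N lam"
      unfolding column_strips_def c(2) column_strip[OF c(1), symmetric] by blast
  qed
  have sub: "block i c \<subseteq> ferrers_diagram N lam \<longleftrightarrow> rel i c" if ic: "i \<in> {1..N}" "c \<in> {1..N}" for i c
  proof
    assume "block i c \<subseteq> ferrers_diagram N lam"
    moreover have "(i, N + 1 - c) \<in> block i c" using mem_block cls_self ic by blast
    ultimately show "rel i c" using ic by (auto simp: box_rel_def)
  next
    assume r: "rel i c"
    show "block i c \<subseteq> ferrers_diagram N lam"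
    proof
      fix p assume "p \<in> block i c"
      then obtain i' c' where p: "p = (i', N + 1 - c')" "i' \<in> cls i" "c' \<in> cls c" by blast
      then have "rel i' c'" using r rel_trans[of i' i c] rel_trans[of i' c c'] by (simp add: cls_def)
      then show "p \<in> ferrers_diagram N lam" using p(1) by (simp add: box_rel_def)
    qed
  qed
  show ?thesis
    unfolding blocks_def rows cols
  proof (intro equalityI subsetI)
    fix b assume "b \<in> {R \<times> C | R C. R \<in> {cls i | i. i \<in> {1..N}} \<and>
      C \<in> {(\<lambda>c. N + 1 - c) ` cls c | c. c \<in> {1..N}} \<and> R \<times> C \<subseteq> ferrers_diagram N lam}"
    then obtain i c where ic: "i \<in> {1..N}" "c \<in> {1..N}" "b = block i c" "block i c \<subseteq> ferrers_diagram N lam"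
      by (elim CollectE exE conjE) (simp only:)
    then have "rel i c" using sub[OF ic(1,2)] by simp
    then show "b \<in> {block i c | i c. rel i c}" using ic(3) by (intro CollectI exI conjI)
  next
    fix b assume "b \<in> {block i c | i c. rel i c}"
    then obtain i c where ic: "b = block i c" "rel i c" by (elim CollectE exE conjE)
    have "i \<in> {1..N}" "c \<in> {1..N}" using field[OF ic(2)] by simp_all
    moreover from this have "block i c \<subseteq> ferrers_diagram N lam" using sub ic(2) by simp
    ultimately show "b \<in> {R \<times> C | R C. R \<in> {cls i | i. i \<in> {1..N}} \<and>
      C \<in> {(\<lambda>c. N + 1 - c) ` cls c | c. c \<in> {1..N}} \<and> R \<times> C \<subseteq> ferrers_diagram N lam}"
      unfolding ic(1) by (intro CollectI exI[of _ "cls i"] exI[of _ "(\<lambda>c. N + 1 - c) ` cls c"]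
          exI[of _ i] exI[of _ c] conjI HOL.refl)
  qed
qed

text \<open>A step right or down from a block of equivalent indices gives a box whose indices are
  related to the old ones both ways, by \<open>rel_up\<close> and by the new box itself. So the step
  does not leave the block.\<close>

lemma corner_diagonal:
  assumes k: "k \<in> {1..N}"
  shows "block k k \<in> corner_blocks N lam"
proof -
  have no: False if b': "b' \<in> blocks N lam" "b' \<noteq> block k k" and pq: "(i, j) \<in> block k k"
    "(i', j') \<in> b'" and adj: "i' = i \<and> j' = j + 1 \<or> i' = i + 1 \<and> j' = j" for b' i j i' j'
  proof -
    obtain p q where b: "b' = block p q" "rel p q" using b'(1) unfolding blocks_eq by blast
    obtain c where c: "c \<in> cls k" "j = N + 1 - c" "i \<in> cls k" using pq(1) by blast
    obtain c' where c': "c' \<in> cls q" "j' = N + 1 - c'" "i' \<in> cls p" using pq(2) b(1) by blast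
    have bnd: "c \<in> {1..N}" "c' \<in> {1..N}" "i \<in> {1..N}" "i' \<in> {1..N}"
      using c c' cls_sub by blast+
    have ic': "rel i' c'" using c' b(2) rel_trans[of i' p q] rel_trans[of i' q c'] by (simp add: cls_def)
    have le: "i \<le> i'" "c' \<le> c" using adj c(2) c'(2) bnd by auto
    have "rel i i'" "rel c' c" using rel_up le bnd by auto
    have "i' \<in> cls k \<and> c' \<in> cls k"
    proof (cases "i' = i")
      case True
      then have "rel k c'" using ic' c(3) rel_trans[of k i c'] by (simp add: cls_def)
      moreover have "rel c' k" using \<open>rel c' c\<close> c(1) rel_trans[of c' c k] by (simp add: cls_def)
      ultimately show ?thesis using True c(3) by (simp add: cls_def)
    next
      case False
      then have cc: "c' = c" using adj c(2) c'(2) bnd by auto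
      have "rel i' k" using ic' c(1) rel_trans[of i' c k] unfolding cc by (simp add: cls_def)
      moreover have "rel k i'" using \<open>rel i i'\<close> c(3) rel_trans[of k i i'] by (simp add: cls_def)
      ultimately show ?thesis using cc c(1) by (simp add: cls_def)
    qed
    then have "cls p = cls k" "cls q = cls k" using cls_eq[of i' p] cls_eq[of i' k] cls_eq[of c' q] cls_eq[of c' k] c' by simp_all
    then show False using b(1) b'(2) by simp
  qed
  have "block k k \<in> blocks N lam" unfolding blocks_eq using rel_refl[OF k] by blast
  then show ?thesis
    unfolding corner_blocks_def adjacent_right_def adjacent_below_def using no by blast
qed

text \<open>Blocks come from equivalence classes, so the block through a given box is unique and the
  definite description is meaningful.\<close>

lemma the_corner_diagonal:
  assumes k: "k \<in> {1..N}"
  shows "(THE b. b \<in> corner_blocks N lam \<and> (k, N + 1 - k) \<in> b) = block k k"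
proof (rule the_equality)
  show "block k k \<in> corner_blocks N lam \<and> (k, N + 1 - k) \<in> block k k"
    using corner_diagonal[OF k] mem_block[OF k] cls_self[OF k] by blast
  fix b assume b: "b \<in> corner_blocks N lam \<and> (k, N + 1 - k) \<in> b"
  then obtain i c where "b = block i c" unfolding corner_blocks_def blocks_eq by blast
  moreover from this have "k \<in> cls i" "k \<in> cls c" using b mem_block[OF k] by blast+
  ultimately show "b = block k k" using cls_eq by metis
qed

lemma top_right_block_eq: "top_right_block N lam = block 1 1"
  using the_corner_diagonal[of 1] N_pos unfolding top_right_block_def lam_one by simp

lemma bottom_left_block_eq: "bottom_left_block N lam = block N N"
  using the_corner_diagonal[of N] N_pos unfolding bottom_left_block_def by simp

end

text \<open>The criterion for the constant filling; every column is met by the first row.\<close>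

lemma unmixed_partition_iff:
  "unmixed_partition TYPE('k::field) N lam \<longleftrightarrow> unmixed_diagram N lam"
proof -
  have "unmixed (poly_ring (skew_vars N lam)) (skew_ferrers_ideal N lam (\<lambda>_. 0) :: 'k mpoly set) \<longleftrightarrow>
    lam 1 = N \<and> (\<forall>k\<in>{1..N}. box_rel N (ferrers_diagram N lam) k k) \<and>
    transitive_filling (box_rel N (ferrers_diagram N lam)) (\<lambda>_ _. 1)"
    if sh: "skew_shape N lam (\<lambda>_. 0)"
    unfolding skew_ferrers_ideal_def ferrers_diagram_def
  proof (rule unmixed_skew_tableau_iff[OF sh])
    show "\<exists>i. (i, j) \<in> skew_diagram N lam (\<lambda>_. 0)" if "j \<in> {1..lam 1}" for j
      using sh that by (intro exI[of _ 1]) (auto simp: skew_diagram_def skew_shape_def)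
  qed simp
  then show ?thesis
    unfolding unmixed_partition_def unmixed_diagram_def transitive_filling_def by auto
qed

section \<open>Prime shapes as convex preorders\<close>

definition first_row :: "prime_shape \<Rightarrow> nat" where
  "first_row B = row_offset B + 1"

definition last_row :: "prime_shape \<Rightarrow> nat" where
  "last_row B = row_offset B + rows B"

text \<open>The sum of the coordinates of the boxes on the antidiagonal of the shape.\<close>

definition diagonal_sum :: "prime_shape \<Rightarrow> nat" where
  "diagonal_sum B = row_offset B + col_offset B + rows B + 1"

text \<open>Both indices are shifted by the row offset, the second one being a column counted from
  the right with respect to \<open>diagonal_sum B\<close>. The reflection that defines the lower
  type fixes the antidiagonal and therefore swaps the indices.\<close>

definition shape_rel :: "prime_shape \<Rightarrow> nat \<Rightarrow> nat \<Rightarrow> bool" where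
  "shape_rel B a b \<longleftrightarrow> row_offset B < a \<and> row_offset B < b \<and>
     (case orientation B of
       Upper \<Rightarrow> box_rel (rows B) (ferrers_diagram (rows B) (parts B)) (a - row_offset B) (b - row_offset B)
     | Lower \<Rightarrow> box_rel (rows B) (ferrers_diagram (rows B) (parts B)) (b - row_offset B) (a - row_offset B))"

definition antidiagonal_boxes :: "nat \<Rightarrow> nat set \<Rightarrow> nat set \<Rightarrow> (nat \<times> nat) set" where
  "antidiagonal_boxes s A C = {(a, s - c) | a c. a \<in> A \<and> c \<in> C}"

locale unmixed_prime_shape =
  fixes B :: prime_shape
  assumes diagram: "unmixed_diagram (rows B) (parts B)"
begin

sublocale D: unmixed_diagram "rows B" "parts B" by (rule diagram)

lemma skew_preorder_shape_rel: "skew_preorder (first_row B) (last_row B) (shape_rel B)"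
proof (cases "orientation B")
  case Upper
  then show ?thesis
    using skew_preorder_shift[OF D.skew_preorder_rel, of "row_offset B"]
    by (simp add: shape_rel_def[abs_def] first_row_def last_row_def)
next
  case Lower
  then show ?thesis
    using skew_preorder_shift[OF skew_preorder_transpose[OF D.skew_preorder_rel], of "row_offset B"]
    by (simp add: shape_rel_def[abs_def] first_row_def last_row_def)
qed

sublocale skew_preorder "first_row B" "last_row B" "shape_rel B" by (rule skew_preorder_shape_rel)

lemma rows_le: "first_row B \<le> last_row B"
  using D.N_pos by (simp add: first_row_def last_row_def)

lemma last_row_less: "last_row B < diagonal_sum B"
  by (simp add: last_row_def diagonal_sum_def)

lemma shape_rel_Upper:
  assumes "orientation B = Upper" "a \<in> {first_row B..last_row B}" "b \<in> {first_row B..last_row B}" "a \<le> b"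
  shows "shape_rel B a b"
  using assms D.rel_up[of "a - row_offset B" "b - row_offset B"]
  by (auto simp: shape_rel_def first_row_def last_row_def)

lemma shape_rel_Lower:
  assumes "orientation B = Lower" "a \<in> {first_row B..last_row B}" "b \<in> {first_row B..last_row B}" "b \<le> a"
  shows "shape_rel B a b"
  using assms D.rel_up[of "b - row_offset B" "a - row_offset B"]
  by (auto simp: shape_rel_def first_row_def last_row_def)

text \<open>Equivalence is symmetric, so the swap for the lower type does not affect
  classes.\<close>

lemma cls_shift: "cls (row_offset B + x) = (+) (row_offset B) ` D.cls x"
proof -
  have iff: "y \<in> cls (row_offset B + x) \<longleftrightarrow> row_offset B < y \<and> y - row_offset B \<in> D.cls x" for y
    using D.field[of x] by (cases "orientation B") (auto simp: cls_def D.cls_def shape_rel_def D.rel_iff)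
  have pos: "0 < y" if "y \<in> D.cls x" for y using that by (auto simp: D.cls_def D.rel_iff)
  show ?thesis
  proof (intro equalityI subsetI)
    fix y assume "y \<in> cls (row_offset B + x)"
    then have "row_offset B < y" "y - row_offset B \<in> D.cls x" using iff by blast+
    then show "y \<in> (+) (row_offset B) ` D.cls x" by (intro image_eqI[of _ _ "y - row_offset B"]) simp_all
  next
    fix y assume "y \<in> (+) (row_offset B) ` D.cls x"
    then obtain z where "z \<in> D.cls x" "y = row_offset B + z" by blast
    then show "y \<in> cls (row_offset B + x)" unfolding iff using pos by simp
  qed
qed

lemma place_eq:
  assumes "i \<in> {1..rows B}" "c \<in> {1..rows B}"
  shows "place B (i, rows B + 1 - c) = (case orientation B of
    Upper \<Rightarrow> (row_offset B + i, diagonal_sum B - (row_offset B + c))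
  | Lower \<Rightarrow> (row_offset B + c, diagonal_sum B - (row_offset B + i)))"
proof -
  obtain t N p r d where B: "B = Prime_Shape t N p r d" by (cases B)
  have "p (Suc 0) = N" using D.lam_one by (simp add: B)
  then show ?thesis using assms by (cases t) (auto simp: B diagonal_sum_def)
qed

lemma place_image:
  assumes "A \<subseteq> {1..rows B}" "C \<subseteq> {1..rows B}"
  shows "place B ` (A \<times> (\<lambda>c. rows B + 1 - c) ` C) = (case orientation B of
    Upper \<Rightarrow> antidiagonal_boxes (diagonal_sum B) ((+) (row_offset B) ` A) ((+) (row_offset B) ` C)
  | Lower \<Rightarrow> antidiagonal_boxes (diagonal_sum B) ((+) (row_offset B) ` C) ((+) (row_offset B) ` A))"
    (is "_ = ?R")
proof -
  have eq: "place B ` (A \<times> (\<lambda>c. rows B + 1 - c) ` C) = {place B (i, rows B + 1 - c) | i c. i \<in> A \<and> c \<in> C}"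
    by blast
  show ?thesis
  proof (cases "orientation B")
    case Upper
    have "place B (i, rows B + 1 - c) = (row_offset B + i, diagonal_sum B - (row_offset B + c))"
      if "i \<in> A" "c \<in> C" for i c
      using place_eq[OF subsetD[OF assms(1) that(1)] subsetD[OF assms(2) that(2)]] Upper by simp
    then have "{place B (i, rows B + 1 - c) | i c. i \<in> A \<and> c \<in> C} =
        {(row_offset B + i, diagonal_sum B - (row_offset B + c)) | i c. i \<in> A \<and> c \<in> C}"
      by (intro Collect_cong ex_cong1) auto
    then show ?thesis unfolding eq using Upper by (auto simp: antidiagonal_boxes_def)
  next
    case Lower
    have "place B (i, rows B + 1 - c) = (row_offset B + c, diagonal_sum B - (row_offset B + i))"
      if "i \<in> A" "c \<in> C" for i c
      using place_eq[OF subsetD[OF assms(1) that(1)] subsetD[OF assms(2) that(2)]] Lower by simp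
    then have "{place B (i, rows B + 1 - c) | i c. i \<in> A \<and> c \<in> C} =
        {(row_offset B + c, diagonal_sum B - (row_offset B + i)) | i c. i \<in> A \<and> c \<in> C}"
      by (intro Collect_cong ex_cong1) auto
    then show ?thesis unfolding eq using Lower by (auto simp: antidiagonal_boxes_def)
  qed
qed

lemma place_block:
  "place B ` D.block i c = (case orientation B of
    Upper \<Rightarrow> antidiagonal_boxes (diagonal_sum B) (cls (row_offset B + i)) (cls (row_offset B + c))
  | Lower \<Rightarrow> antidiagonal_boxes (diagonal_sum B) (cls (row_offset B + c)) (cls (row_offset B + i)))"
  unfolding cls_shift by (rule place_image[OF D.cls_sub D.cls_sub])

lemma shape_rel_shift:
  "shape_rel B a b \<longleftrightarrow> (\<exists>i c. D.rel i c \<and> (case orientation B of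
    Upper \<Rightarrow> a = row_offset B + i \<and> b = row_offset B + c
  | Lower \<Rightarrow> a = row_offset B + c \<and> b = row_offset B + i))" (is "?L \<longleftrightarrow> ?R")
proof
  assume L: ?L
  then have ab: "row_offset B < a" "row_offset B < b" by (auto simp: shape_rel_def)
  show ?R
  proof (cases "orientation B")
    case Upper
    then show ?thesis using L ab
      by (intro exI[of _ "a - row_offset B"] exI[of _ "b - row_offset B"]) (auto simp: shape_rel_def)
  next
    case Lower
    then show ?thesis using L ab
      by (intro exI[of _ "b - row_offset B"] exI[of _ "a - row_offset B"]) (auto simp: shape_rel_def)
  qed
next
  assume ?R
  then show ?L by (cases "orientation B") (auto simp: shape_rel_def D.rel_iff)
qed

lemma boxes_of_eq: "boxes_of B = {(a, diagonal_sum B - b) | a b. shape_rel B a b}"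
proof -
  let ?N = "rows B"
  have "ferrers_diagram ?N (parts B) = {(i, ?N + 1 - c) | i c. D.rel i c}"
  proof (intro equalityI subsetI)
    fix p assume "p \<in> ferrers_diagram ?N (parts B)"
    then obtain i j where p: "p = (i, j)" "(i, j) \<in> ferrers_diagram ?N (parts B)" by (cases p) auto
    then have ij: "i \<in> {1..?N}" "1 \<le> j" "j \<le> parts B i"
      by (auto simp: ferrers_diagram_def skew_diagram_def)
    then have "j \<in> {1..?N}" using D.lam_bounds[of i] by auto
    then have "?N + 1 - (?N + 1 - j) = j" "?N + 1 - j \<in> {1..?N}" by auto
    then have "D.rel i (?N + 1 - j)" "p = (i, ?N + 1 - (?N + 1 - j))"
      using p ij by (simp_all add: box_rel_def)
    then show "p \<in> {(i, ?N + 1 - c) | i c. D.rel i c}" by blast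
  qed (auto simp: box_rel_def)
  then have "boxes_of B = place B ` {(i, ?N + 1 - c) | i c. D.rel i c}"
    by (simp only: boxes_of_def)
  also have "\<dots> = {place B (i, ?N + 1 - c) | i c. D.rel i c}" by blast
  also have "\<dots> = {(a, diagonal_sum B - b) | a b. shape_rel B a b}"
  proof (intro equalityI subsetI)
    fix p assume "p \<in> {place B (i, ?N + 1 - c) | i c. D.rel i c}"
    then obtain i c where ic: "p = place B (i, ?N + 1 - c)" "D.rel i c" by blast
    then show "p \<in> {(a, diagonal_sum B - b) | a b. shape_rel B a b}"
      using place_eq[of i c] D.field[OF ic(2)] unfolding shape_rel_shift
      by (cases "orientation B") auto
  next
    fix p assume "p \<in> {(a, diagonal_sum B - b) | a b. shape_rel B a b}"
    then obtain a b where ab: "p = (a, diagonal_sum B - b)" "shape_rel B a b" by blast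
    then obtain i c where ic: "D.rel i c" "case orientation B of
        Upper \<Rightarrow> a = row_offset B + i \<and> b = row_offset B + c
      | Lower \<Rightarrow> a = row_offset B + c \<and> b = row_offset B + i" unfolding shape_rel_shift by blast
    then have "p = place B (i, ?N + 1 - c)"
      using place_eq[of i c] D.field[OF ic(1)] ab(1) by (cases "orientation B") auto
    then show "p \<in> {place B (i, ?N + 1 - c) | i c. D.rel i c}" using ic(1) by blast
  qed
  finally show ?thesis .
qed

lemma blocks_of_eq:
  "blocks_of B = {antidiagonal_boxes (diagonal_sum B) (cls a) (cls b) | a b. shape_rel B a b}"
proof -
  have "blocks_of B = {place B ` D.block i c | i c. D.rel i c}"
    unfolding blocks_of_def D.blocks_eq by blast
  also have "\<dots> = {antidiagonal_boxes (diagonal_sum B) (cls a) (cls b) | a b. shape_rel B a b}"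
  proof (cases "orientation B")
    case Upper
    then have r: "shape_rel B a b \<longleftrightarrow> (\<exists>i c. D.rel i c \<and> a = row_offset B + i \<and> b = row_offset B + c)" for a b
      unfolding shape_rel_shift by simp
    show ?thesis unfolding place_block r Upper triangle.case by blast
  next
    case Lower
    then have r: "shape_rel B a b \<longleftrightarrow> (\<exists>i c. D.rel i c \<and> a = row_offset B + c \<and> b = row_offset B + i)" for a b
      unfolding shape_rel_shift by simp
    show ?thesis unfolding place_block r Lower triangle.case by blast
  qed
  finally show ?thesis .
qed

lemma top_right_of_eq:
  "top_right_of B = antidiagonal_boxes (diagonal_sum B) (cls (first_row B)) (cls (first_row B))"
  unfolding top_right_of_def D.top_right_block_eq place_block
  by (cases "orientation B") (simp_all add: first_row_def)

lemma bottom_left_of_eq: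
  "bottom_left_of B = antidiagonal_boxes (diagonal_sum B) (cls (last_row B)) (cls (last_row B))"
  unfolding bottom_left_of_def D.bottom_left_block_eq place_block
  by (cases "orientation B") (simp_all add: last_row_def)

text \<open>The bound on \<open>b\<close> keeps the subtraction from truncating, so the column
  determines the index.\<close>

lemma mem_boxes_of:
  assumes "b < diagonal_sum B"
  shows "(a, diagonal_sum B - b) \<in> boxes_of B \<longleftrightarrow> shape_rel B a b"
proof
  assume "(a, diagonal_sum B - b) \<in> boxes_of B"
  then obtain b' where b': "shape_rel B a b'" "diagonal_sum B - b = diagonal_sum B - b'"
    unfolding boxes_of_eq by blast
  then have "b' = b" using field[OF b'(1)] last_row_less assms by auto
  then show "shape_rel B a b" using b'(1) by simp
qed (auto simp: boxes_of_eq)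

lemma block_constant_iff:
  "(\<forall>b\<in>blocks_of B. \<forall>p\<in>b. \<forall>q\<in>b. w p = w q) \<longleftrightarrow>
    (\<forall>a b a' b'. shape_rel B a b \<longrightarrow> a' \<in> cls a \<longrightarrow> b' \<in> cls b \<longrightarrow>
      w (a, diagonal_sum B - b) = w (a', diagonal_sum B - b'))" (is "?L \<longleftrightarrow> ?R")
proof
  assume L: ?L
  show ?R
  proof (intro allI impI)
    fix a b a' b' assume r: "shape_rel B a b" and c: "a' \<in> cls a" "b' \<in> cls b"
    have blk: "antidiagonal_boxes (diagonal_sum B) (cls a) (cls b) \<in> blocks_of B"
      unfolding blocks_of_eq using r by blast
    have "a \<in> cls a" "b \<in> cls b" using field[OF r] cls_self by simp_all
    moreover have "(x, diagonal_sum B - y) \<in> antidiagonal_boxes (diagonal_sum B) (cls a) (cls b)"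
      if "x \<in> cls a" "y \<in> cls b" for x y
      using that unfolding antidiagonal_boxes_def by blast
    ultimately show "w (a, diagonal_sum B - b) = w (a', diagonal_sum B - b')"
      using L[rule_format, OF blk] c by blast
  qed
next
  assume R: ?R
  show ?L
  proof (intro ballI)
    fix D p q assume D: "D \<in> blocks_of B" "p \<in> D" "q \<in> D"
    then obtain a b where ab: "D = antidiagonal_boxes (diagonal_sum B) (cls a) (cls b)" "shape_rel B a b"
      unfolding blocks_of_eq by blast
    have "w x = w (a, diagonal_sum B - b)" if "x \<in> D" for x
    proof -
      obtain a' b' where "x = (a', diagonal_sum B - b')" "a' \<in> cls a" "b' \<in> cls b"
        using \<open>x \<in> D\<close> unfolding ab(1) antidiagonal_boxes_def by blast
      then show ?thesis using R[rule_format, OF ab(2)] by simp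
    qed
    then show "w p = w q" using D(2,3) by simp
  qed
qed

text \<open>Moving to the right lowers the column index, hence \<open>b' \<le> b\<close> in the row
  condition.\<close>

lemma increasing_iff:
  "increasing_along (boxes_of B) w \<longleftrightarrow>
    (\<forall>a b b'. shape_rel B a b \<longrightarrow> shape_rel B a b' \<longrightarrow> b' \<le> b \<longrightarrow>
      w (a, diagonal_sum B - b) \<le> w (a, diagonal_sum B - b')) \<and>
    (\<forall>a a' b. shape_rel B a b \<longrightarrow> shape_rel B a' b \<longrightarrow> a \<le> a' \<longrightarrow>
      w (a, diagonal_sum B - b) \<le> w (a', diagonal_sum B - b))" (is "?L \<longleftrightarrow> ?R")
proof
  assume L: ?L
  have row: "w (a, j) \<le> w (a, j')" if "(a, j) \<in> boxes_of B" "(a, j') \<in> boxes_of B" "j \<le> j'" for a j j'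
    using that L unfolding increasing_along_def by blast
  have col: "w (a, j) \<le> w (a', j)" if "(a, j) \<in> boxes_of B" "(a', j) \<in> boxes_of B" "a \<le> a'" for a a' j
    using that L unfolding increasing_along_def by blast
  have box: "(a, diagonal_sum B - b) \<in> boxes_of B" if "shape_rel B a b" for a b
    unfolding boxes_of_eq using that by blast
  show ?R
    by (intro conjI allI impI) (rule row col; (rule box)?; (rule diff_le_mono2)?; assumption)+
next
  assume R: ?R
  show ?L
    unfolding increasing_along_def
  proof (intro conjI allI impI; elim conjE)
    fix i j j' assume *: "(i, j) \<in> boxes_of B" "(i, j') \<in> boxes_of B" "j \<le> j'"
    then obtain b b' where b: "shape_rel B i b" "j = diagonal_sum B - b"
      "shape_rel B i b'" "j' = diagonal_sum B - b'" unfolding boxes_of_eq by blast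
    then have "b' \<le> b" using field[OF b(1)] field[OF b(3)] last_row_less *(3) by auto
    then show "w (i, j) \<le> w (i, j')" using R b by blast
  next
    fix i i' j assume *: "(i, j) \<in> boxes_of B" "(i', j) \<in> boxes_of B" "i \<le> i'"
    then obtain b where b: "shape_rel B i b" "j = diagonal_sum B - b" unfolding boxes_of_eq by blast
    then have "shape_rel B i' b" using *(2) mem_boxes_of[of b i'] field[OF b(1)] last_row_less by auto
    then show "w (i, j) \<le> w (i', j)" using R b *(3) by blast
  qed
qed

lemma decreasing_iff:
  "decreasing_along (boxes_of B) w \<longleftrightarrow>
    (\<forall>a b b'. shape_rel B a b \<longrightarrow> shape_rel B a b' \<longrightarrow> b' \<le> b \<longrightarrow>
      w (a, diagonal_sum B - b') \<le> w (a, diagonal_sum B - b)) \<and>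
    (\<forall>a a' b. shape_rel B a b \<longrightarrow> shape_rel B a' b \<longrightarrow> a \<le> a' \<longrightarrow>
      w (a', diagonal_sum B - b) \<le> w (a, diagonal_sum B - b))" (is "?L \<longleftrightarrow> ?R")
proof
  assume L: ?L
  have row: "w (a, j') \<le> w (a, j)" if "(a, j) \<in> boxes_of B" "(a, j') \<in> boxes_of B" "j \<le> j'" for a j j'
    using that L unfolding decreasing_along_def by blast
  have col: "w (a', j) \<le> w (a, j)" if "(a, j) \<in> boxes_of B" "(a', j) \<in> boxes_of B" "a \<le> a'" for a a' j
    using that L unfolding decreasing_along_def by blast
  have box: "(a, diagonal_sum B - b) \<in> boxes_of B" if "shape_rel B a b" for a b
    unfolding boxes_of_eq using that by blast
  show ?R
    by (intro conjI allI impI) (rule row col; (rule box)?; (rule diff_le_mono2)?; assumption)+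
next
  assume R: ?R
  show ?L
    unfolding decreasing_along_def
  proof (intro conjI allI impI; elim conjE)
    fix i j j' assume *: "(i, j) \<in> boxes_of B" "(i, j') \<in> boxes_of B" "j \<le> j'"
    then obtain b b' where b: "shape_rel B i b" "j = diagonal_sum B - b"
      "shape_rel B i b'" "j' = diagonal_sum B - b'" unfolding boxes_of_eq by blast
    then have "b' \<le> b" using field[OF b(1)] field[OF b(3)] last_row_less *(3) by auto
    then show "w (i, j) \<ge> w (i, j')" using R b by blast
  next
    fix i i' j assume *: "(i, j) \<in> boxes_of B" "(i', j) \<in> boxes_of B" "i \<le> i'"
    then obtain b where b: "shape_rel B i b" "j = diagonal_sum B - b" unfolding boxes_of_eq by blast
    then have "shape_rel B i' b" using *(2) mem_boxes_of[of b i'] field[OF b(1)] last_row_less by auto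
    then show "w (i, j) \<ge> w (i', j)" using R b *(3) by blast
  qed
qed

text \<open>For \<open>a \<rightarrow> b \<rightarrow> c\<close> compare the box of \<open>a\<close>
  and \<open>c\<close> with the other two. Either the order of the indices lets monotonicity apply,
  or the type of the shape supplies the reverse arrow, two indices are equivalent and constancy on
  blocks gives equality.\<close>

theorem filling_conditions_iff:
  "(\<forall>b\<in>blocks_of B. \<forall>p\<in>b. \<forall>q\<in>b. w p = w q) \<and>
    (orientation B = Upper \<longrightarrow> increasing_along (boxes_of B) w) \<and>
    (orientation B = Lower \<longrightarrow> decreasing_along (boxes_of B) w) \<longleftrightarrow>
    transitive_filling (shape_rel B) (\<lambda>a b. w (a, diagonal_sum B - b))"
    (is "?L \<longleftrightarrow> transitive_filling _ ?v")
proof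
  assume L: ?L
  then have const: "\<And>a b a' b'. shape_rel B a b \<Longrightarrow> a' \<in> cls a \<Longrightarrow> b' \<in> cls b \<Longrightarrow> ?v a b = ?v a' b'"
    and inc: "orientation B = Upper \<Longrightarrow> increasing_along (boxes_of B) w"
    and dec: "orientation B = Lower \<Longrightarrow> decreasing_along (boxes_of B) w"
    unfolding block_constant_iff by simp_all
  have "?v a c \<le> ?v a b \<and> ?v a c \<le> ?v b c" if ab: "shape_rel B a b" and bc: "shape_rel B b c" for a b c
  proof -
    have ac: "shape_rel B a c" using trans[OF ab bc] .
    have f: "a \<in> {first_row B..last_row B}" "b \<in> {first_row B..last_row B}" "c \<in> {first_row B..last_row B}"
      using field[OF ab] field[OF bc] by simp_all
    have eq1: "?v a c = ?v a b" if "shape_rel B c b"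
      using const[OF ab cls_self[OF f(1)], of c] that bc by (simp add: cls_def)
    have eq2: "?v a c = ?v b c" if "shape_rel B b a"
      using const[OF bc _ cls_self[OF f(3)], of a] that ab by (simp add: cls_def)
    show ?thesis
    proof (cases "orientation B")
      case Upper
      have "?v a c \<le> ?v a b"
      proof (cases "b \<le> c")
        case True
        then show ?thesis
          using conjunct1[OF inc[OF Upper, unfolded increasing_iff], rule_format, OF ac ab] by simp
      next
        case False
        then show ?thesis using eq1 shape_rel_Upper[OF Upper f(3,2)] by simp
      qed
      moreover have "?v a c \<le> ?v b c"
      proof (cases "a \<le> b")
        case True
        then show ?thesis
          using conjunct2[OF inc[OF Upper, unfolded increasing_iff], rule_format, OF ac bc] by simp
      next
        case False
        then show ?thesis using eq2 shape_rel_Upper[OF Upper f(2,1)] by simp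
      qed
      ultimately show ?thesis by blast
    next
      case Lower
      have "?v a c \<le> ?v a b"
      proof (cases "c \<le> b")
        case True
        then show ?thesis
          using conjunct1[OF dec[OF Lower, unfolded decreasing_iff], rule_format, OF ab ac] by simp
      next
        case False
        then show ?thesis using eq1 shape_rel_Lower[OF Lower f(3,2)] by simp
      qed
      moreover have "?v a c \<le> ?v b c"
      proof (cases "b \<le> a")
        case True
        then show ?thesis
          using conjunct2[OF dec[OF Lower, unfolded decreasing_iff], rule_format, OF bc ac] by simp
      next
        case False
        then show ?thesis using eq2 shape_rel_Lower[OF Lower f(2,1)] by simp
      qed
      ultimately show ?thesis by blast
    qed
  qed
  then show "transitive_filling (shape_rel B) ?v"
    unfolding transitive_filling_def using trans by blast
next
  assume "transitive_filling (shape_rel B) ?v"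
  then have le: "?v a c \<le> ?v a b" "?v a c \<le> ?v b c" if "shape_rel B a b" "shape_rel B b c" for a b c
    using that unfolding transitive_filling_def by blast+
  have const: "?v a b = ?v a' b'" if r: "shape_rel B a b" and c: "a' \<in> cls a" "b' \<in> cls b" for a b a' b'
  proof -
    have aa: "shape_rel B a a'" "shape_rel B a' a" "shape_rel B b b'" "shape_rel B b' b"
      using c by (simp_all add: cls_def)
    have a'b: "shape_rel B a' b" using trans[OF aa(2) r] .
    \<comment> \<open>Equivalent indices can be composed in both directions, so the inequality holds
      both ways.\<close>
    have "?v a b = ?v a' b" using le(2)[OF aa(1) a'b] le(2)[OF aa(2) r] by simp
    also have "\<dots> = ?v a' b'" using le(1)[OF a'b aa(3)] le(1)[OF trans[OF a'b aa(3)] aa(4)] by simp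
    finally show ?thesis .
  qed
  have "increasing_along (boxes_of B) w" if Upper: "orientation B = Upper"
    unfolding increasing_iff
  proof (intro conjI allI impI)
    fix a b b' assume r: "shape_rel B a b" "shape_rel B a b'" "b' \<le> b"
    \<comment> \<open>The type gives \<open>b' \<rightarrow> b\<close>, so this is the inequality
      for \<open>a \<rightarrow> b' \<rightarrow> b\<close>.\<close>
    then show "?v a b \<le> ?v a b'"
      using field[OF r(1)] field[OF r(2)] by (intro le(1)[OF r(2)] shape_rel_Upper[OF Upper]) simp_all
  next
    fix a a' b assume r: "shape_rel B a b" "shape_rel B a' b" "a \<le> a'"
    then show "?v a b \<le> ?v a' b"
      using field[OF r(1)] field[OF r(2)] by (intro le(2)[OF _ r(2)] shape_rel_Upper[OF Upper]) simp_all
  qed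
  moreover have "decreasing_along (boxes_of B) w" if Lower: "orientation B = Lower"
    unfolding decreasing_iff
  proof (intro conjI allI impI)
    fix a b b' assume r: "shape_rel B a b" "shape_rel B a b'" "b' \<le> b"
    then show "?v a b' \<le> ?v a b"
      using field[OF r(1)] field[OF r(2)] by (intro le(1)[OF r(1)] shape_rel_Lower[OF Lower]) simp_all
  next
    fix a a' b assume r: "shape_rel B a b" "shape_rel B a' b" "a \<le> a'"
    then show "?v a' b \<le> ?v a b"
      using field[OF r(1)] field[OF r(2)] by (intro le(2)[OF _ r(1)] shape_rel_Lower[OF Lower]) simp_all
  qed
  ultimately show ?L unfolding block_constant_iff using const by blast
qed

end

section \<open>Gluing prime shapes\<close>

context unmixed_prime_shape
begin

lemma first_in: "first_row B \<in> {first_row B..last_row B}"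
  using rows_le by simp

lemma last_in: "last_row B \<in> {first_row B..last_row B}"
  using rows_le by simp

text \<open>Classes are intervals, so the whole index range is one class and all boxes are present.
  Read backwards, a nonsquare shape has different first and last classes.\<close>

lemma is_square_boxes_of:
  assumes "last_row B \<in> cls (first_row B)"
  shows "is_square (boxes_of B)"
proof -
  have "a \<in> cls (first_row B)" if "a \<in> {first_row B..last_row B}" for a
    using cls_interval[OF cls_self[OF first_in] assms] that by simp
  then have "shape_rel B a b" if "a \<in> {first_row B..last_row B}" "b \<in> {first_row B..last_row B}" for a b
    using trans[of a "first_row B" b] that by (simp add: cls_def)
  then have "shape_rel B a b \<longleftrightarrow> a \<in> {first_row B..last_row B} \<and> b \<in> {first_row B..last_row B}" for a b
    using field by blast
  then have "boxes_of B = {(a, diagonal_sum B - b) | a b.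
      a \<in> {first_row B..last_row B} \<and> b \<in> {first_row B..last_row B}}"
    unfolding boxes_of_eq by simp
  also have "\<dots> = {row_offset B + 1..row_offset B + rows B} \<times> {col_offset B + 1..col_offset B + rows B}"
  proof (intro equalityI subsetI)
    fix p assume "p \<in> {row_offset B + 1..row_offset B + rows B} \<times> {col_offset B + 1..col_offset B + rows B}"
    then obtain a j where p: "p = (a, j)" "a \<in> {first_row B..last_row B}"
      "j \<in> {col_offset B + 1..col_offset B + rows B}"
      unfolding first_row_def last_row_def by blast
    have "j = diagonal_sum B - (diagonal_sum B - j)" "diagonal_sum B - j \<in> {first_row B..last_row B}"
      using p(3) by (auto simp: diagonal_sum_def first_row_def last_row_def)
    then show "p \<in> {(a, diagonal_sum B - b) | a b.
      a \<in> {first_row B..last_row B} \<and> b \<in> {first_row B..last_row B}}" using p(1,2) by blast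
  qed (auto simp: diagonal_sum_def first_row_def last_row_def)
  finally show ?thesis unfolding is_square_def by blast
qed

end

text \<open>The rows of the set give \<open>K\<close>. Its rightmost column is
  \<open>s - Min K\<close> in one description and \<open>s' - Min K\<close> in the other, which
  gives \<open>s\<close>.\<close>

lemma antidiagonal_square_inject:
  assumes eq: "antidiagonal_boxes s K K = antidiagonal_boxes s' K' K'"
    and K: "finite K" "K \<noteq> {}" "\<And>k. k \<in> K \<Longrightarrow> k < s" "\<And>k. k \<in> K' \<Longrightarrow> k < s'"
  shows "s = s' \<and> K = K'"
proof -
  have fst: "fst ` antidiagonal_boxes s K K = K" for s and K :: "nat set"
    unfolding antidiagonal_boxes_def by force
  have KK: "K = K'" using fst[of s K] fst[of s' K'] eq by simp
  define m where "m = Min K"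
  have m: "m \<in> K" "\<And>k. k \<in> K \<Longrightarrow> m \<le> k" using K(1,2) by (simp_all add: m_def)
  have "(m, s - m) \<in> antidiagonal_boxes s' K' K'"
    unfolding eq[symmetric] unfolding antidiagonal_boxes_def using m(1) by blast
  then obtain c where "c \<in> K" "s - m = s' - c" unfolding antidiagonal_boxes_def KK by blast
  moreover have "(m, s' - m) \<in> antidiagonal_boxes s K K"
    unfolding eq unfolding antidiagonal_boxes_def using m(1) KK by blast
  then obtain c' where "c' \<in> K" "s' - m = s - c'" unfolding antidiagonal_boxes_def by blast
  ultimately have "s = s'" using m(2)[of c] m(2)[of c'] K(3)[OF m(1)] K(4)[of m] m(1) KK by auto
  then show ?thesis using KK by blast
qed

locale adjacent_shapes =
  A: unmixed_prime_shape A + B: unmixed_prime_shape B for A B :: prime_shape +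
  assumes orientation: "orientation A \<noteq> orientation B"
    and overlap: "bottom_left_of A = top_right_of B"
begin

text \<open>Shapes that share an extremal block have a common antidiagonal and can be described with
  the same column numbering.\<close>

lemma diagonal_cls: "diagonal_sum A = diagonal_sum B \<and> A.cls (last_row A) = B.cls (first_row B)"
proof (rule antidiagonal_square_inject)
  show "antidiagonal_boxes (diagonal_sum A) (A.cls (last_row A)) (A.cls (last_row A)) =
      antidiagonal_boxes (diagonal_sum B) (B.cls (first_row B)) (B.cls (first_row B))"
    using overlap unfolding A.bottom_left_of_eq B.top_right_of_eq .
  show "finite (A.cls (last_row A))" by (rule finite_subset[OF A.cls_sub]) simp
  show "A.cls (last_row A) \<noteq> {}" using A.cls_self[OF A.last_in] by blast
  show "k < diagonal_sum A" if "k \<in> A.cls (last_row A)" for k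
    using subsetD[OF A.cls_sub that] A.last_row_less by simp
  show "k < diagonal_sum B" if "k \<in> B.cls (first_row B)" for k
    using subsetD[OF B.cls_sub that] B.last_row_less by simp
qed

lemmas cls_eq = conjunct2[OF diagonal_cls]

lemma bounds:
  "first_row A \<le> first_row B" "first_row B \<le> last_row A" "last_row A \<le> last_row B"
proof -
  have "first_row B \<in> A.cls (last_row A)" unfolding cls_eq by (rule B.cls_self[OF B.first_in])
  then have "first_row B \<in> {first_row A..last_row A}" by (rule subsetD[OF A.cls_sub])
  then show "first_row A \<le> first_row B" "first_row B \<le> last_row A" by simp_all
  have "last_row A \<in> B.cls (first_row B)" unfolding cls_eq[symmetric] by (rule A.cls_self[OF A.last_in])
  then have "last_row A \<in> {first_row B..last_row B}" by (rule subsetD[OF B.cls_sub])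
  then show "last_row A \<le> last_row B" by simp
qed

lemma overlap_iff:
  "k \<in> A.cls (last_row A) \<longleftrightarrow> first_row B \<le> k \<and> k \<le> last_row A" (is "_ \<in> ?K \<longleftrightarrow> _")
proof
  assume k: "k \<in> ?K"
  have "k \<in> {first_row A..last_row A}" using k A.cls_sub by blast
  moreover have "k \<in> {first_row B..last_row B}" using k B.cls_sub unfolding cls_eq by blast
  ultimately show "first_row B \<le> k \<and> k \<le> last_row A" by simp
next
  assume "first_row B \<le> k \<and> k \<le> last_row A"
  moreover have "first_row B \<in> ?K" unfolding cls_eq by (rule B.cls_self[OF B.first_in])
  ultimately show "k \<in> ?K" using A.cls_interval[OF _ A.cls_self[OF A.last_in]] by blast
qed

lemma rel_overlap:
  assumes "a \<in> A.cls (last_row A)" "b \<in> A.cls (last_row A)"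
  shows "shape_rel A a b" "shape_rel B a b"
proof -
  show "shape_rel A a b" using assms A.trans[of a "last_row A" b] by (simp add: A.cls_def)
  show "shape_rel B a b"
    using assms B.trans[of a "first_row B" b] unfolding cls_eq by (simp add: B.cls_def)
qed

text \<open>The types alternate. If \<open>A\<close> is upper and \<open>B\<close> lower, then an
  index \<open>c\<close> of \<open>B\<close> with \<open>k \<rightarrow> c\<close> also satisfies
  \<open>c \<rightarrow> first_row B\<close>, so it is equivalent to \<open>k\<close> and lies in
  the overlap. The other cases are the same up to symmetry.\<close>

lemma common_shape:
  assumes "first_row B \<le> k" "k \<le> last_row A"
  shows "shape_rel A i k \<Longrightarrow> shape_rel B k c \<Longrightarrow> shape_rel A k c \<or> shape_rel B i k"
    and "shape_rel B i k \<Longrightarrow> shape_rel A k c \<Longrightarrow> shape_rel B k c \<or> shape_rel A i k"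
proof -
  have k: "k \<in> A.cls (last_row A)" using assms overlap_iff by blast
  have kA: "shape_rel A k (last_row A)" "shape_rel A (last_row A) k" using k by (simp_all add: A.cls_def)
  have kB: "shape_rel B k (first_row B)" "shape_rel B (first_row B) k"
    using k unfolding cls_eq by (simp_all add: B.cls_def)
  consider "orientation A = Upper" "orientation B = Lower" | "orientation A = Lower" "orientation B = Upper"
    using orientation by (cases "orientation A"; cases "orientation B") auto
  note cases = this
  show "shape_rel A k c \<or> shape_rel B i k" if ik: "shape_rel A i k" and kc: "shape_rel B k c"
    using cases
  proof cases
    case 1
    have "shape_rel B c (first_row B)"
      using B.field[OF kc] B.first_in by (intro B.shape_rel_Lower 1) auto
    then have "c \<in> A.cls (last_row A)" unfolding cls_eq using B.trans[OF kB(2) kc] by (simp add: B.cls_def)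
    then show ?thesis using rel_overlap(1)[OF k] by blast
  next
    case 2
    have "shape_rel A (last_row A) i"
      using A.field[OF ik] A.last_in by (intro A.shape_rel_Lower 2) auto
    then have "i \<in> A.cls (last_row A)" using A.trans[OF ik kA(1)] by (simp add: A.cls_def)
    then show ?thesis using rel_overlap(2)[OF _ k] by blast
  qed
  show "shape_rel B k c \<or> shape_rel A i k" if ik: "shape_rel B i k" and kc: "shape_rel A k c"
    using cases
  proof cases
    case 1
    have "shape_rel A c (last_row A)"
      using A.field[OF kc] A.last_in by (intro A.shape_rel_Upper 1) auto
    then have "c \<in> A.cls (last_row A)" using A.trans[OF kA(2) kc] by (simp add: A.cls_def)
    then show ?thesis using rel_overlap(2)[OF k] by blast
  next
    case 2
    have "shape_rel B (first_row B) i"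
      using B.field[OF ik] B.first_in by (intro B.shape_rel_Upper 2) auto
    then have "i \<in> A.cls (last_row A)" unfolding cls_eq using B.trans[OF ik kB(1)] by (simp add: B.cls_def)
    then show ?thesis using rel_overlap(1)[OF _ k] by blast
  qed
qed

end

section \<open>Chains of overlapping prime shapes\<close>

locale shape_chain =
  fixes Bs :: "prime_shape list"
  assumes nonempty: "Bs \<noteq> []"
    and shapes: "B \<in> set Bs \<Longrightarrow> unmixed_prime_shape B"
    and nonsquare: "1 < length Bs \<Longrightarrow> B \<in> set Bs \<Longrightarrow> \<not> is_square (boxes_of B)"
    and alternating: "Suc q < length Bs \<Longrightarrow> orientation (Bs ! q) \<noteq> orientation (Bs ! Suc q)"
    and overlapping: "Suc q < length Bs \<Longrightarrow> bottom_left_of (Bs ! q) = top_right_of (Bs ! Suc q)"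
begin

lemma adjacent: "Suc q < length Bs \<Longrightarrow> adjacent_shapes (Bs ! q) (Bs ! Suc q)"
  using shapes[of "Bs ! q"] shapes[of "Bs ! Suc q"] alternating[of q] overlapping[of q]
  by (simp add: adjacent_shapes_def adjacent_shapes_axioms_def)

lemma diagonal_sum_eq: "q < length Bs \<Longrightarrow> diagonal_sum (Bs ! q) = diagonal_sum (hd Bs)"
proof (induction q)
  case 0
  then show ?case using nonempty by (simp add: hd_conv_nth)
next
  case (Suc q)
  then show ?case using adjacent_shapes.diagonal_cls[OF adjacent[of q]] by simp
qed

lemma diagonal_sum_set: "B \<in> set Bs \<Longrightarrow> diagonal_sum B = diagonal_sum (hd Bs)"
  using diagonal_sum_eq by (metis in_set_conv_nth)

lemma first_row_mono: "q \<le> q' \<Longrightarrow> q' < length Bs \<Longrightarrow> first_row (Bs ! q) \<le> first_row (Bs ! q')"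
proof (induction rule: dec_induct)
  case (step p)
  then show ?case using adjacent_shapes.bounds(1)[OF adjacent[of p]] by simp
qed simp

text \<open>A common index would belong both to the first and to the last class of the shape in
  between, making that shape a square.\<close>

lemma distant_disjoint:
  assumes "Suc (Suc q) < length Bs"
  shows "last_row (Bs ! q) < first_row (Bs ! Suc (Suc q))"
proof (rule ccontr)
  let ?B = "Bs ! Suc q"
  assume *: "\<not> ?thesis"
  interpret L: adjacent_shapes "Bs ! q" ?B using adjacent[of q] assms by simp
  interpret U: adjacent_shapes ?B "Bs ! Suc (Suc q)" using adjacent[of "Suc q"] assms by simp
  let ?k = "first_row (Bs ! Suc (Suc q))"
  have "?k \<in> L.B.cls (first_row ?B)"
    using * U.bounds L.overlap_iff[of ?k] unfolding L.cls_eq by simp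
  moreover have "?k \<in> L.B.cls (last_row ?B)"
    using U.overlap_iff[of ?k] U.bounds by simp
  ultimately have "L.B.cls (first_row ?B) = L.B.cls (last_row ?B)" using L.B.cls_eq by metis
  then have "last_row ?B \<in> L.B.cls (first_row ?B)" using L.B.cls_self[OF L.B.last_in] by simp
  then show False using L.B.is_square_boxes_of nonsquare[of ?B] assms by simp
qed

text \<open>Two shapes containing the index \<open>k\<close> are equal or adjacent, which leaves the
  case of two neighbours.\<close>

lemma common_shape:
  assumes "A \<in> set Bs" "B \<in> set Bs" "shape_rel A i k" "shape_rel B k c"
  shows "\<exists>C\<in>set Bs. shape_rel C i k \<and> shape_rel C k c"
proof -
  obtain p q where pq: "p < length Bs" "A = Bs ! p" "q < length Bs" "B = Bs ! q"
    using assms(1,2) by (metis in_set_conv_nth)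
  interpret A: unmixed_prime_shape A using shapes[OF assms(1)] .
  interpret B: unmixed_prime_shape B using shapes[OF assms(2)] .
  have kA: "first_row A \<le> k" "k \<le> last_row A" and kB: "first_row B \<le> k" "k \<le> last_row B"
    using A.field[OF assms(3)] B.field[OF assms(4)] by simp_all
  have far: False if "Suc (Suc a) \<le> b" "b < length Bs" "k \<le> last_row (Bs ! a)" "first_row (Bs ! b) \<le> k" for a b
    using distant_disjoint[of a] first_row_mono[of "Suc (Suc a)" b] that by simp
  consider "p = q" | "q = Suc p" | "p = Suc q"
    using far[of p q] far[of q p] kA kB pq by (metis Suc_leI le_neq_implies_less linorder_less_linear)
  then show ?thesis
  proof cases
    case 1
    then show ?thesis using assms pq by blast
  next
    case 2
    interpret adjacent_shapes A B using adjacent[of p] 2 pq by simp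
    show ?thesis using common_shape(1)[OF kB(1) kA(2) assms(3,4)] assms by blast
  next
    case 3
    interpret adjacent_shapes B A using adjacent[of q] 3 pq by simp
    show ?thesis using common_shape(2)[OF kA(1) kB(2) assms(3,4)] assms by blast
  qed
qed

text \<open>The global condition only concerns composable pairs of boxes, and each such pair lies in
  one shape.\<close>

lemma transitive_filling_iff:
  "transitive_filling (\<lambda>a b. \<exists>B\<in>set Bs. shape_rel B a b) v \<longleftrightarrow>
    (\<forall>B\<in>set Bs. transitive_filling (shape_rel B) v)" (is "?L \<longleftrightarrow> ?R")
proof
  assume L: ?L
  show ?R
    unfolding transitive_filling_def
  proof (intro ballI allI impI)
    fix B i k c assume B: "B \<in> set Bs" and r: "shape_rel B i k" "shape_rel B k c"
    interpret unmixed_prime_shape B using shapes[OF B] .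
    show "shape_rel B i c \<and> v i c \<le> v i k \<and> v i c \<le> v k c"
      using trans[OF r] L[unfolded transitive_filling_def] r B by blast
  qed
next
  assume R: ?R
  show ?L
    unfolding transitive_filling_def
  proof (intro allI impI)
    fix i k c assume "\<exists>B\<in>set Bs. shape_rel B i k" "\<exists>B\<in>set Bs. shape_rel B k c"
    then obtain C where "C \<in> set Bs" "shape_rel C i k" "shape_rel C k c" using common_shape by blast
    then show "(\<exists>B\<in>set Bs. shape_rel B i c) \<and> v i c \<le> v i k \<and> v i c \<le> v k c"
      using R unfolding transitive_filling_def by blast
  qed
qed

text \<open>The offsets of the shapes are not known beforehand. A shape through
  \<open>(1, n)\<close> has sum at least \<open>n + 1\<close>; it contains its antidiagonal box in
  row 1, which must not lie beyond column \<open>n\<close>.\<close>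

lemma diagonal_sum_Union:
  assumes D: "(\<Union>B\<in>set Bs. boxes_of B) \<subseteq> {1..n} \<times> {1..n}" and corner: "(1, n) \<in> (\<Union>B\<in>set Bs. boxes_of B)"
  shows "diagonal_sum (hd Bs) = n + 1"
proof -
  obtain B where B: "B \<in> set Bs" "(1, n) \<in> boxes_of B" using corner by blast
  interpret unmixed_prime_shape B using shapes[OF B(1)] .
  obtain b where b: "shape_rel B 1 b" "n = diagonal_sum B - b" using B(2) unfolding boxes_of_eq by auto
  have f: "first_row B = 1" "1 \<le> b" "b \<le> last_row B" using field[OF b(1)] by (auto simp: first_row_def)
  have "(1, diagonal_sum B - 1) \<in> boxes_of B"
    unfolding boxes_of_eq using refl[OF first_in] unfolding f(1) by blast
  then have "diagonal_sum B - 1 \<in> {1..n}" using D B(1) by blast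
  then have "diagonal_sum B = n + 1" using b(2) f by auto
  then show ?thesis using diagonal_sum_set[OF B(1)] by simp
qed

lemma box_rel_Union:
  assumes D: "(\<Union>B\<in>set Bs. boxes_of B) \<subseteq> {1..n} \<times> {1..n}" and s: "diagonal_sum (hd Bs) = n + 1"
  shows "box_rel n (\<Union>B\<in>set Bs. boxes_of B) a b \<longleftrightarrow> (\<exists>B\<in>set Bs. shape_rel B a b)"
proof
  assume "box_rel n (\<Union>B\<in>set Bs. boxes_of B) a b"
  then obtain B where B: "B \<in> set Bs" "(a, n + 1 - b) \<in> boxes_of B" "b \<in> {1..n}"
    unfolding box_rel_def by blast
  interpret unmixed_prime_shape B using shapes[OF B(1)] .
  have "shape_rel B a b" using mem_boxes_of[of b a] B(2,3) diagonal_sum_set[OF B(1)] s by simp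
  then show "\<exists>B\<in>set Bs. shape_rel B a b" using B(1) by blast
next
  assume "\<exists>B\<in>set Bs. shape_rel B a b"
  then obtain B where B: "B \<in> set Bs" "shape_rel B a b" by blast
  interpret unmixed_prime_shape B using shapes[OF B(1)] .
  have box: "(x, n + 1 - y) \<in> boxes_of B" if "shape_rel B x y" for x y
    unfolding boxes_of_eq using that diagonal_sum_set[OF B(1)] s by auto
  \<comment> \<open>The antidiagonal box in row \<open>b\<close> shows that \<open>b\<close> is in
    range.\<close>
  have "(b, n + 1 - b) \<in> boxes_of B" using field[OF B(2)] by (intro box refl) blast
  then show "box_rel n (\<Union>B\<in>set Bs. boxes_of B) a b"
    unfolding box_rel_def using box[OF B(2)] D B(1) by blast
qed

end

section \<open>Existence of the decomposition\<close>

text \<open>As \<open>r\<close> contains \<open>\<le>\<close>, the successors of \<open>i\<close>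
  form a final segment of the index range. Its length determines it, and this length is the row
  length.\<close>

lemma unmixed_diagram_of_preorder:
  fixes r :: "nat \<Rightarrow> nat \<Rightarrow> bool"
  assumes "skew_preorder 1 N r" and N: "1 \<le> N"
    and up: "\<And>i c. i \<in> {1..N} \<Longrightarrow> c \<in> {1..N} \<Longrightarrow> i \<le> c \<Longrightarrow> r i c"
  defines "lam \<equiv> \<lambda>i. card {c. r i c}"
  shows "unmixed_diagram N lam" "box_rel N (ferrers_diagram N lam) = r"
proof -
  interpret skew_preorder 1 N r by fact
  have sub: "{c. r i c} \<subseteq> {1..N}" for i using field by blast
  have fin: "finite {c. r i c}" for i by (rule finite_subset[OF sub]) simp
  have key: "r i c \<longleftrightarrow> N + 1 - c \<le> lam i" if i: "i \<in> {1..N}" and c: "c \<in> {1..N}" for i c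
  proof -
    define m where "m = Min {c. r i c}"
    have "{c. r i c} \<noteq> {}" using refl[OF i] by blast
    then have m: "r i m" "\<And>c. r i c \<Longrightarrow> m \<le> c" using Min_in[OF fin] Min_le[OF fin] by (auto simp: m_def)
    have mN: "m \<in> {1..N}" using m(1) field by blast
    have "{c. r i c} = {m..N}"
    proof (intro equalityI subsetI)
      fix c assume "c \<in> {m..N}"
      then have "r m c" using mN by (intro up) auto
      then show "c \<in> {c. r i c}" using trans[OF m(1)] by simp
    next
      fix c assume "c \<in> {c. r i c}"
      then have "r i c" by simp
      then show "c \<in> {m..N}" using m(2) field[of i c] by simp
    qed
    then have "r i c \<longleftrightarrow> m \<le> c" "lam i = N + 1 - m" using c unfolding lam_def by auto
    then show ?thesis using c mN by auto
  qed
  have pos: "0 < lam i" if "i \<in> {1..N}" for i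
    unfolding lam_def using refl[OF that] by (subst card_gt_0_iff) (use fin in blast)
  have le: "lam i \<le> N" for i unfolding lam_def using card_mono[OF _ sub[of i]] by simp
  have anti: "lam i' \<le> lam i" if "i \<in> {1..N}" "i' \<in> {1..N}" "i \<le> i'" for i i'
    unfolding lam_def using trans[OF up[OF that]] by (intro card_mono fin) auto
  have one: "lam 1 = N"
    using key[of 1 1] up[of 1 1] le[of 1] N by auto
  show eq: "box_rel N (ferrers_diagram N lam) = r"
  proof (intro ext)
    fix i c
    show "box_rel N (ferrers_diagram N lam) i c = r i c"
    proof (cases "i \<in> {1..N} \<and> c \<in> {1..N}")
      case True
      then show ?thesis using key[of i c] by (auto simp: box_rel_def ferrers_diagram_def skew_diagram_def)
    next
      case False
      then show ?thesis using field by (auto simp: box_rel_def)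
    qed
  qed
  show "unmixed_diagram N lam"
  proof
    show "skew_shape N lam (\<lambda>_. 0)"
      unfolding skew_shape_def monotone_on_def using N pos anti by auto
    show "lam 1 = N" by (rule one)
    show "box_rel N (ferrers_diagram N lam) k k" if "k \<in> {1..N}" for k
      unfolding eq using refl[OF that] .
    show "box_rel N (ferrers_diagram N lam) i c"
      if "box_rel N (ferrers_diagram N lam) i k" "box_rel N (ferrers_diagram N lam) k c" for i k c
      using that unfolding eq by (rule trans)
  qed
qed

lemma skew_preorder_restrict:
  assumes "skew_preorder 1 n r" "1 \<le> l" "l \<le> u" "u \<le> n"
  shows "skew_preorder 1 (u + 1 - l)
    (\<lambda>i c. i \<in> {1..u + 1 - l} \<and> c \<in> {1..u + 1 - l} \<and> r (l - 1 + i) (l - 1 + c))"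
proof -
  interpret skew_preorder 1 n r by fact
  show ?thesis
  proof
    show "a \<in> {1..u + 1 - l} \<and> b \<in> {1..u + 1 - l} \<and> r (l - 1 + a) (l - 1 + b)"
      if "i \<in> {1..u + 1 - l} \<and> c \<in> {1..u + 1 - l} \<and> r (l - 1 + i) (l - 1 + c)"
        "i' \<in> {1..u + 1 - l} \<and> c' \<in> {1..u + 1 - l} \<and> r (l - 1 + i') (l - 1 + c')"
        "i \<le> a" "a \<le> i'" "c' \<le> b" "b \<le> c" for i c i' c' a b
      using convex[of "l - 1 + i" "l - 1 + c" "l - 1 + i'" "l - 1 + c'" "l - 1 + a" "l - 1 + b"] that by auto
    show "i \<in> {1..u + 1 - l} \<and> c \<in> {1..u + 1 - l} \<and> r (l - 1 + i) (l - 1 + c)"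
      if "i \<in> {1..u + 1 - l} \<and> k \<in> {1..u + 1 - l} \<and> r (l - 1 + i) (l - 1 + k)"
        "k \<in> {1..u + 1 - l} \<and> c \<in> {1..u + 1 - l} \<and> r (l - 1 + k) (l - 1 + c)" for i k c
      using trans[of "l - 1 + i" "l - 1 + k" "l - 1 + c"] that by simp
    show "i \<in> {1..u + 1 - l} \<and> i \<in> {1..u + 1 - l} \<and> r (l - 1 + i) (l - 1 + i)"
      if i: "i \<in> {1..u + 1 - l}" for i
    proof -
      have "l - 1 + i \<in> {1..n}" using i assms(2-4) by auto
      then show ?thesis using i refl by blast
    qed
  qed simp
qed

text \<open>Allows a single construction for both types: along a shape of type \<open>t\<close> this
  relation contains \<open>\<le>\<close>.\<close>

definition oriented :: "triangle \<Rightarrow> (nat \<Rightarrow> nat \<Rightarrow> bool) \<Rightarrow> nat \<Rightarrow> nat \<Rightarrow> bool" where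
  "oriented t r a b \<longleftrightarrow> (case t of Upper \<Rightarrow> r a b | Lower \<Rightarrow> r b a)"

text \<open>\<open>connected\<close> is the trace of connectedness of the graph: no cut between
  consecutive indices.\<close>

locale connected_preorder = skew_preorder 1 n r for n r +
  assumes n_pos: "1 \<le> n"
    and connected: "1 \<le> i \<Longrightarrow> i < n \<Longrightarrow> r i (i + 1) \<or> r (i + 1) i"
begin

lemma skew_preorder_oriented: "skew_preorder 1 n (oriented t r)"
  using skew_preorder_axioms skew_preorder_transpose[OF skew_preorder_axioms]
  by (cases t) (simp_all add: oriented_def[abs_def])

definition run :: "triangle \<Rightarrow> nat \<Rightarrow> nat \<Rightarrow> bool" where
  "run t l u \<longleftrightarrow> 1 \<le> l \<and> l \<le> u \<and> u \<le> n \<and> (\<forall>a b. l \<le> a \<longrightarrow> a \<le> b \<longrightarrow> b \<le> u \<longrightarrow> oriented t r a b)"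

text \<open>The column offset \<open>n - u\<close> places the antidiagonal of the shape on that of
  the diagram, where the coordinates add up to \<open>n + 1\<close>.\<close>

definition run_shape :: "triangle \<Rightarrow> nat \<Rightarrow> nat \<Rightarrow> prime_shape" where
  "run_shape t l u = Prime_Shape t (u + 1 - l)
     (\<lambda>i. card {c. i \<in> {1..u + 1 - l} \<and> c \<in> {1..u + 1 - l} \<and> oriented t r (l - 1 + i) (l - 1 + c)})
     (l - 1) (n - u)"

lemma run_shape:
  assumes "run t l u"
  shows "unmixed_prime_shape (run_shape t l u)"
    and "shape_rel (run_shape t l u) a b \<longleftrightarrow> a \<in> {l..u} \<and> b \<in> {l..u} \<and> r a b"
    and "diagonal_sum (run_shape t l u) = n + 1"
    and "first_row (run_shape t l u) = l" "last_row (run_shape t l u) = u"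
    and "orientation (run_shape t l u) = t"
proof -
  have lu: "1 \<le> l" "l \<le> u" "u \<le> n" and or: "\<And>a b. l \<le> a \<Longrightarrow> a \<le> b \<Longrightarrow> b \<le> u \<Longrightarrow> oriented t r a b"
    using assms by (auto simp: run_def)
  have N: "1 \<le> u + 1 - l" using lu by simp
  have up: "i \<in> {1..u + 1 - l} \<and> c \<in> {1..u + 1 - l} \<and> oriented t r (l - 1 + i) (l - 1 + c)"
    if "i \<in> {1..u + 1 - l}" "c \<in> {1..u + 1 - l}" "i \<le> c" for i c
    using that lu by (auto intro!: or)
  note F = unmixed_diagram_of_preorder[OF skew_preorder_restrict[OF skew_preorder_oriented lu, of t] N up]
  show "unmixed_prime_shape (run_shape t l u)"
    unfolding unmixed_prime_shape_def using F(1) by (simp add: run_shape_def)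
  show "diagonal_sum (run_shape t l u) = n + 1" "first_row (run_shape t l u) = l"
    "last_row (run_shape t l u) = u" "orientation (run_shape t l u) = t"
    using lu by (simp_all add: diagonal_sum_def first_row_def last_row_def run_shape_def)
  have box: "box_rel (rows (run_shape t l u)) (ferrers_diagram (rows (run_shape t l u)) (parts (run_shape t l u))) =
      (\<lambda>i c. i \<in> {1..u + 1 - l} \<and> c \<in> {1..u + 1 - l} \<and> oriented t r (l - 1 + i) (l - 1 + c))"
    using F(2) by (simp add: run_shape_def)
  have off: "row_offset (run_shape t l u) = l - 1" "orientation (run_shape t l u) = t"
    by (simp_all add: run_shape_def)
  have rng: "x \<in> {l..u} \<longleftrightarrow> l - 1 < x \<and> x - (l - 1) \<in> {1..u + 1 - l}" for x
    using lu by auto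
  have add: "l - 1 + (x - (l - 1)) = x" if "l - 1 < x" for x using that by simp
  show "shape_rel (run_shape t l u) a b \<longleftrightarrow> a \<in> {l..u} \<and> b \<in> {l..u} \<and> r a b"
    unfolding shape_rel_def box off rng
    by (cases t) (auto simp: oriented_def add)
qed

definition equivalent :: "nat \<Rightarrow> nat \<Rightarrow> bool" where
  "equivalent a b \<longleftrightarrow> r a b \<and> r b a"

text \<open>The last two conditions identify the overlap with the class of the end of the first run
  and with the class of the start of the second.\<close>

definition adjacent_runs :: "triangle \<times> nat \<times> nat \<Rightarrow> triangle \<times> nat \<times> nat \<Rightarrow> bool" where
  "adjacent_runs = (\<lambda>(t, l, u) (t', l', u'). t \<noteq> t' \<and> l \<le> l' \<and> l' \<le> u \<and> u \<le> u' \<and>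
     (\<forall>y. l \<le> y \<and> y \<le> u \<and> equivalent u y \<longleftrightarrow> l' \<le> y \<and> y \<le> u) \<and>
     (\<forall>y. l' \<le> y \<and> y \<le> u' \<and> equivalent l' y \<longleftrightarrow> l' \<le> y \<and> y \<le> u))"

lemma oriented_equivalent: "equivalent a b \<longleftrightarrow> oriented t r a b \<and> oriented t r b a"
  by (cases t) (auto simp: equivalent_def oriented_def)

lemma equivalent_trans: "equivalent a b \<Longrightarrow> equivalent b c \<Longrightarrow> equivalent a c"
  unfolding equivalent_def using trans[of a b c] trans[of c b a] by blast

lemma equivalent_sym: "equivalent a b \<Longrightarrow> equivalent b a"
  unfolding equivalent_def by blast

lemma equivalent_between:
  assumes "equivalent a b" "a \<le> k" "k \<le> b"
  shows "equivalent a k" "equivalent k b"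
  using assms between_up[of a b k] between_down[of b a k] unfolding equivalent_def by auto

text \<open>The first run is the longest one starting at \<open>l\<close>, and the induction goes on with the class of
  its last element. Maximality makes the next run turn the other way.\<close>

lemma exists_runs:
  assumes "1 \<le> l" "l \<le> n" "\<not> equivalent l n"
  shows "\<exists>xs t u. (\<forall>(t, l, u)\<in>set ((t, l, u) # xs). run t l u \<and> \<not> equivalent l u) \<and>
    successively adjacent_runs ((t, l, u) # xs) \<and>
    (\<forall>a b. r a b \<longrightarrow> l \<le> a \<longrightarrow> l \<le> b \<longrightarrow> (\<exists>(t, l, u)\<in>set ((t, l, u) # xs). a \<in> {l..u} \<and> b \<in> {l..u}))"
  using assms
proof (induction "n - l" arbitrary: l rule: less_induct)
  case less
  have ll: "equivalent l l" using refl[of l] less.prems by (simp add: equivalent_def)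
  define e where "e = Max {y. equivalent l y}"
  have fin: "finite {y. equivalent l y}"
    by (rule finite_subset[of _ "{1..n}"]) (use field in \<open>auto simp: equivalent_def\<close>)
  have e: "equivalent l e" "\<And>y. equivalent l y \<Longrightarrow> y \<le> e"
    using Max_in[OF fin] Max_ge[OF fin] ll by (auto simp: e_def)
  have "e \<in> {1..n}" using e(1) field unfolding equivalent_def by blast
  moreover have "e \<noteq> n" using e(1) less.prems by blast
  ultimately have en: "1 \<le> e" "e < n" by auto
  have "l \<le> e" using e(2)[OF ll] .
  \<comment> \<open>The first step out of the class of \<open>l\<close> decides the type of the
    run.\<close>
  obtain t where t: "oriented t r e (e + 1)"
    using connected[OF en] by (auto simp: oriented_def intro: that[of Upper] that[of Lower])
  interpret T: skew_preorder 1 n "oriented t r" by (rule skew_preorder_oriented)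
  define u where "u = Max {y. oriented t r l y}"
  have fin': "finite {y. oriented t r l y}"
    by (rule finite_subset[of _ "{1..n}"]) (use T.field in auto)
  have le1: "oriented t r l (e + 1)" using T.trans[OF _ t] e(1) oriented_equivalent by blast
  have u: "oriented t r l u" "\<And>y. oriented t r l y \<Longrightarrow> y \<le> u"
    using Max_in[OF fin'] Max_ge[OF fin'] le1 by (auto simp: u_def)
  have ue: "e < u" using u(2)[OF le1] by simp
  have nlu: "\<not> equivalent l u" using e(2)[of u] ue by auto
  have un: "u \<le> n" using T.field[OF u(1)] by simp
  have lu: "l \<le> u" using \<open>l \<le> e\<close> ue by simp
  \<comment> \<open>The box of \<open>l\<close> and \<open>u\<close> spans with the antidiagonal box
    of \<open>a\<close> a rectangle containing the box of \<open>a\<close> and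
    \<open>b\<close>.\<close>
  have or: "oriented t r a b" if "l \<le> a" "a \<le> b" "b \<le> u" for a b
  proof -
    have "oriented t r a a" using that less.prems un by (intro T.refl) auto
    then show ?thesis using T.convex[OF u(1), of a a a b] that by simp
  qed
  have run: "run t l u" using less.prems un lu or by (auto simp: run_def)
  show ?case
  proof (cases "u = n")
    case True
    have "a \<in> {l..u} \<and> b \<in> {l..u}" if "r a b" "l \<le> a" "l \<le> b" for a b
      using field[OF that(1)] that True by auto
    then show ?thesis using run nlu by (intro exI[of _ "[]"] exI[of _ t] exI[of _ u]) auto
  next
    case False
    then have "u < n" using un by simp
    have uu: "equivalent u u" using refl[of u] un lu less.prems by (simp add: equivalent_def)
    define l' where "l' = (LEAST y. l \<le> y \<and> equivalent u y)"
    have l': "l \<le> l' \<and> equivalent u l'" unfolding l'_def by (rule LeastI[of _ u]) (use uu lu in blast)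
    have l'_least: "l' \<le> y" if "l \<le> y" "equivalent u y" for y
      unfolding l'_def using that by (intro Least_le) blast
    have l'u: "l' \<le> u" using l'_least[OF lu uu] .
    have "l' \<noteq> l" using nlu l' equivalent_sym by blast
    then have "l < l'" using l' by simp
    have beyond: False if "oriented t r u y" "u < y" for y
      using u(2)[OF T.trans[OF u(1) that(1)]] that(2) by simp
    have "\<not> equivalent l' n"
    proof
      assume "equivalent l' n"
      then have "equivalent u n" using equivalent_trans l' by blast
      then show False using beyond[of n] \<open>u < n\<close> oriented_equivalent by blast
    qed
    moreover have "1 \<le> l'" "l' \<le> n" "n - l' < n - l" using \<open>l < l'\<close> less.prems l'u un by auto
    ultimately obtain xs t' u' where xs:
      "\<forall>(t, l, u)\<in>set ((t', l', u') # xs). run t l u \<and> \<not> equivalent l u"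
      "successively adjacent_runs ((t', l', u') # xs)"
      "\<forall>a b. r a b \<longrightarrow> l' \<le> a \<longrightarrow> l' \<le> b \<longrightarrow> (\<exists>(t, l, u)\<in>set ((t', l', u') # xs). a \<in> {l..u} \<and> b \<in> {l..u})"
      using less.hyps[of l'] by blast
    have run': "run t' l' u'" "\<not> equivalent l' u'" using xs(1) by auto
    have l'u_eq: "equivalent l' u" using l' equivalent_sym by blast
    \<comment> \<open>The next run leaves the class of \<open>l'\<close>, which contains
      \<open>u\<close>.\<close>
    have uu': "u < u'"
    proof (rule ccontr)
      assume "\<not> u < u'"
      then have "equivalent l' u'"
        using equivalent_between(1)[OF l'u_eq, of u'] run'(1) by (simp add: run_def)
      then show False using run'(2) by blast
    qed
    have "t \<noteq> t'"
    proof
      assume "t = t'"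
      then have "oriented t r u u'" using run'(1) l'u uu' by (simp add: run_def)
      then show False using beyond uu' by blast
    qed
    moreover have "l \<le> y \<and> y \<le> u \<and> equivalent u y \<longleftrightarrow> l' \<le> y \<and> y \<le> u" for y
      using l'_least[of y] equivalent_between(2)[OF l'u_eq, of y] equivalent_sym[of y u] l' by auto
    moreover have "l' \<le> y \<and> y \<le> u' \<and> equivalent l' y \<longleftrightarrow> l' \<le> y \<and> y \<le> u" for y
    proof
      assume y: "l' \<le> y \<and> y \<le> u' \<and> equivalent l' y"
      then have "oriented t r u y" using equivalent_trans l' oriented_equivalent by blast
      then show "l' \<le> y \<and> y \<le> u" using beyond[of y] y by (auto simp: not_less[symmetric])
    qed (use equivalent_between(1)[OF l'u_eq, of y] uu' in auto)
    ultimately have adj: "adjacent_runs (t, l, u) (t', l', u')"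
      unfolding adjacent_runs_def using l' l'u uu' by simp
    have cover: "\<exists>(t, l, u)\<in>set ((t, l, u) # (t', l', u') # xs). a \<in> {l..u} \<and> b \<in> {l..u}"
      if ab: "oriented t r a b" "l \<le> a" "l \<le> b" for a b
    proof -
      have rab: "r a b \<or> r b a" using ab(1) by (cases t) (simp_all add: oriented_def)
      \<comment> \<open>A pair in neither range straddles the overlap. With \<open>a\<close> on the
        left, \<open>l \<rightarrow> a \<rightarrow> b\<close> contradicts maximality of
        \<open>u\<close>; with \<open>b\<close> on the left, \<open>b\<close> would be equivalent to
        \<open>u\<close>, against the choice of \<open>l'\<close>.\<close>
      consider "l' \<le> a" "l' \<le> b" | "a \<le> u" "b \<le> u" | "a < l'" "u < b" | "u < a" "b < l'" by linarith
      then show ?thesis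
      proof cases
        case 1
        then have "\<exists>(t, l, u)\<in>set ((t', l', u') # xs). a \<in> {l..u} \<and> b \<in> {l..u}"
          using xs(3) rab by blast
        then show ?thesis by auto
      next
        case 2
        then show ?thesis using ab by auto
      next
        case 3
        have "oriented t r l a" using or[of l a] 3 ab l'u by simp
        then show ?thesis using u(2)[OF T.trans[OF _ ab(1)]] 3 by simp
      next
        case 4
        have "oriented t r u b" using T.between_down(2)[OF ab(1), of u] 4 l'u by simp
        moreover have "oriented t r b u" using or[of b u] ab 4 l'u by simp
        ultimately have "equivalent u b" using oriented_equivalent by blast
        then show ?thesis using l'_least[of b] ab 4 by simp
      qed
    qed
    have "\<exists>(t, l, u)\<in>set ((t, l, u) # (t', l', u') # xs). a \<in> {l..u} \<and> b \<in> {l..u}"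
      if ab: "r a b" "l \<le> a" "l \<le> b" for a b
    proof (cases t)
      case Upper
      then show ?thesis using cover[of a b] ab by (simp add: oriented_def)
    next
      case Lower
      then show ?thesis using cover[of b a] ab unfolding oriented_def by (auto split: prod.splits)
    qed
    moreover have "\<forall>(t, l, u)\<in>set ((t, l, u) # (t', l', u') # xs). run t l u \<and> \<not> equivalent l u"
      using xs(1) run nlu by simp
    moreover have "successively adjacent_runs ((t, l, u) # (t', l', u') # xs)"
      using xs(2) adj by simp
    ultimately show ?thesis
      by (intro exI[of _ "(t', l', u') # xs"] exI[of _ t] exI[of _ u]) blast
  qed
qed

section \<open>From runs to prime shapes\<close>

lemma boxes_of_run_shape:
  assumes "run t l u"
  shows "boxes_of (run_shape t l u) = {(a, n + 1 - b) | a b. a \<in> {l..u} \<and> b \<in> {l..u} \<and> r a b}"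
  unfolding unmixed_prime_shape.boxes_of_eq[OF run_shape(1)[OF assms]] run_shape(2,3)[OF assms] ..

lemma corners_of_run_shape:
  assumes "run t l u"
  shows "top_right_of (run_shape t l u) =
      antidiagonal_boxes (n + 1) {y. l \<le> y \<and> y \<le> u \<and> equivalent l y} {y. l \<le> y \<and> y \<le> u \<and> equivalent l y}"
    and "bottom_left_of (run_shape t l u) =
      antidiagonal_boxes (n + 1) {y. l \<le> y \<and> y \<le> u \<and> equivalent u y} {y. l \<le> y \<and> y \<le> u \<and> equivalent u y}"
proof -
  interpret B: unmixed_prime_shape "run_shape t l u" by (rule run_shape(1)[OF assms])
  have "l \<le> u" using assms by (simp add: run_def)
  then have "B.cls l = {y. l \<le> y \<and> y \<le> u \<and> equivalent l y}" "B.cls u = {y. l \<le> y \<and> y \<le> u \<and> equivalent u y}"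
    unfolding B.cls_def run_shape(2)[OF assms] equivalent_def by auto
  then show "top_right_of (run_shape t l u) =
      antidiagonal_boxes (n + 1) {y. l \<le> y \<and> y \<le> u \<and> equivalent l y} {y. l \<le> y \<and> y \<le> u \<and> equivalent l y}"
    and "bottom_left_of (run_shape t l u) =
      antidiagonal_boxes (n + 1) {y. l \<le> y \<and> y \<le> u \<and> equivalent u y} {y. l \<le> y \<and> y \<le> u \<and> equivalent u y}"
    unfolding B.top_right_of_eq B.bottom_left_of_eq run_shape(3-5)[OF assms] by simp_all
qed

text \<open>A square through the antidiagonal boxes of \<open>l\<close> and \<open>u\<close>
  contains the other two corners as well, which makes \<open>l\<close> and \<open>u\<close>
  equivalent.\<close>

lemma not_is_square_run_shape:
  assumes "run t l u" "\<not> equivalent l u"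
  shows "\<not> is_square (boxes_of (run_shape t l u))"
proof
  assume "is_square (boxes_of (run_shape t l u))"
  then obtain x y s where sq: "boxes_of (run_shape t l u) = {x + 1..x + s} \<times> {y + 1..y + s}"
    unfolding is_square_def by blast
  interpret B: unmixed_prime_shape "run_shape t l u" by (rule run_shape(1)[OF assms(1)])
  have lu: "1 \<le> l" "l \<le> u" "u \<le> n" using assms(1) by (auto simp: run_def)
  have mem: "(a, n + 1 - b) \<in> boxes_of (run_shape t l u) \<longleftrightarrow> a \<in> {l..u} \<and> b \<in> {l..u} \<and> r a b" if "b \<le> n" for a b
    using B.mem_boxes_of[of b a] that unfolding run_shape(2,3)[OF assms(1)] by simp
  have "(l, n + 1 - l) \<in> boxes_of (run_shape t l u)" "(u, n + 1 - u) \<in> boxes_of (run_shape t l u)"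
    using mem[of l l] mem[of u u] refl[of l] refl[of u] lu by auto
  then have "(l, n + 1 - u) \<in> boxes_of (run_shape t l u)" "(u, n + 1 - l) \<in> boxes_of (run_shape t l u)"
    unfolding sq by blast+
  then show False using mem[of l u] mem[of u l] lu assms(2) by (auto simp: equivalent_def)
qed

lemma adjacent_run_shapes:
  assumes "run t l u" "run t' l' u'" "adjacent_runs (t, l, u) (t', l', u')"
  shows "orientation (run_shape t l u) \<noteq> orientation (run_shape t' l' u')"
    "boxes_of (run_shape t l u) \<inter> boxes_of (run_shape t' l' u') = bottom_left_of (run_shape t l u)"
    "boxes_of (run_shape t l u) \<inter> boxes_of (run_shape t' l' u') = top_right_of (run_shape t' l' u')"
proof -
  have adj: "t \<noteq> t'" "l \<le> l'" "l' \<le> u" "u \<le> u'"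
    "\<And>y. l \<le> y \<and> y \<le> u \<and> equivalent u y \<longleftrightarrow> l' \<le> y \<and> y \<le> u"
    "\<And>y. l' \<le> y \<and> y \<le> u' \<and> equivalent l' y \<longleftrightarrow> l' \<le> y \<and> y \<le> u"
    using assms(3) unfolding adjacent_runs_def prod.case by blast+
  have un: "u \<le> n" "u' \<le> n" using assms(1,2) by (auto simp: run_def)
  have eq: "r a b" if "a \<in> {l'..u}" "b \<in> {l'..u}" for a b
    using adj(5)[of a] adj(5)[of b] that trans[of a u b] by (simp add: equivalent_def)
  have inter: "boxes_of (run_shape t l u) \<inter> boxes_of (run_shape t' l' u') = antidiagonal_boxes (n + 1) {l'..u} {l'..u}"
  proof (intro equalityI subsetI)
    fix p assume p: "p \<in> boxes_of (run_shape t l u) \<inter> boxes_of (run_shape t' l' u')"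
    then obtain a b where ab: "p = (a, n + 1 - b)" "a \<in> {l..u}" "b \<in> {l..u}"
      unfolding boxes_of_run_shape[OF assms(1)] by blast
    from p obtain a' b' where ab': "p = (a', n + 1 - b')" "a' \<in> {l'..u'}" "b' \<in> {l'..u'}"
      unfolding boxes_of_run_shape[OF assms(2)] by blast
    have "a' = a" "b' = b" using ab ab' un by auto
    then have "a \<in> {l'..u}" "b \<in> {l'..u}" using ab ab' by simp_all
    then show "p \<in> antidiagonal_boxes (n + 1) {l'..u} {l'..u}"
      using ab(1) unfolding antidiagonal_boxes_def by blast
  next
    fix p assume "p \<in> antidiagonal_boxes (n + 1) {l'..u} {l'..u}"
    then obtain a b where ab: "p = (a, n + 1 - b)" "a \<in> {l'..u}" "b \<in> {l'..u}"
      unfolding antidiagonal_boxes_def by blast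
    have "a \<in> {l..u}" "b \<in> {l..u}" "a \<in> {l'..u'}" "b \<in> {l'..u'}" using ab adj(2,4) by auto
    then show "p \<in> boxes_of (run_shape t l u) \<inter> boxes_of (run_shape t' l' u')"
      unfolding boxes_of_run_shape[OF assms(1)] boxes_of_run_shape[OF assms(2)]
      using ab(1) eq[OF ab(2,3)] by blast
  qed
  have int: "{y. l' \<le> y \<and> y \<le> u} = {l'..u}" by auto
  show "orientation (run_shape t l u) \<noteq> orientation (run_shape t' l' u')"
    using adj(1) by (simp add: run_shape_def)
  show "boxes_of (run_shape t l u) \<inter> boxes_of (run_shape t' l' u') = bottom_left_of (run_shape t l u)"
    unfolding inter corners_of_run_shape(2)[OF assms(1)] adj(5) int ..
  show "boxes_of (run_shape t l u) \<inter> boxes_of (run_shape t' l' u') = top_right_of (run_shape t' l' u')"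
    unfolding inter corners_of_run_shape(1)[OF assms(2)] adj(6) int ..
qed

lemma exists_run_list:
  "\<exists>ys. ys \<noteq> [] \<and> (\<forall>(t, l, u)\<in>set ys. run t l u) \<and>
    (1 < length ys \<longrightarrow> (\<forall>(t, l, u)\<in>set ys. \<not> equivalent l u)) \<and> successively adjacent_runs ys \<and>
    (\<forall>a b. r a b \<longrightarrow> (\<exists>(t, l, u)\<in>set ys. a \<in> {l..u} \<and> b \<in> {l..u}))"
proof (cases "equivalent 1 n")
  case True
  have "r a b" if "1 \<le> a" "a \<le> b" "b \<le> n" for a b
    using equivalent_between(1)[OF True, of a] equivalent_between(1)[OF True, of b] that trans[of a 1 b]
    by (simp add: equivalent_def)
  \<comment> \<open>A square is of both types; the upper one is chosen.\<close>
  then have "run Upper 1 n" using n_pos by (simp add: run_def oriented_def)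
  moreover have "\<exists>(t, l, u)\<in>set [(Upper, 1, n)]. a \<in> {l..u} \<and> b \<in> {l..u}" if "r a b" for a b
    using field[OF that] by simp
  ultimately show ?thesis
    by (intro exI[of _ "[(Upper, 1, n)]"] conjI allI impI) simp_all
next
  case False
  obtain xs t u where xs:
    "\<forall>(t, l, u)\<in>set ((t, 1, u) # xs). run t l u \<and> \<not> equivalent l u"
    "successively adjacent_runs ((t, 1, u) # xs)"
    "\<forall>a b. r a b \<longrightarrow> 1 \<le> a \<longrightarrow> 1 \<le> b \<longrightarrow> (\<exists>(t, l, u)\<in>set ((t, 1, u) # xs). a \<in> {l..u} \<and> b \<in> {l..u})"
    using exists_runs[OF order.refl n_pos False] by (elim exE conjE) (rule that)
  show ?thesis
  proof (intro exI[of _ "(t, 1, u) # xs"] conjI allI impI)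
    show "\<forall>(t, l, u)\<in>set ((t, 1, u) # xs). run t l u" "\<forall>(t, l, u)\<in>set ((t, 1, u) # xs). \<not> equivalent l u"
      using xs(1) by auto
    show "\<exists>(t, l, u)\<in>set ((t, 1, u) # xs). a \<in> {l..u} \<and> b \<in> {l..u}" if "r a b" for a b
    proof -
      have "1 \<le> a" "1 \<le> b" using field[OF that] by simp_all
      then show ?thesis using xs(3)[rule_format, OF that] by blast
    qed
  qed (simp, fact xs(2))
qed

lemma exists_prime_decomposition:
  "\<exists>Bs. prime_decomposition TYPE('k::field) {(a, n + 1 - b) | a b. r a b} Bs"
proof -
  obtain ys where ys: "ys \<noteq> []" and run: "\<And>t l u. (t, l, u) \<in> set ys \<Longrightarrow> run t l u"
    and ns: "\<And>t l u. 1 < length ys \<Longrightarrow> (t, l, u) \<in> set ys \<Longrightarrow> \<not> equivalent l u"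
    and adj: "successively adjacent_runs ys"
    and cover: "\<And>a b. r a b \<Longrightarrow> \<exists>(t, l, u)\<in>set ys. a \<in> {l..u} \<and> b \<in> {l..u}"
    using exists_run_list by blast
  define f where "f = (\<lambda>(t, l, u). run_shape t l u)"
  have "prime_decomposition TYPE('k) {(a, n + 1 - b) | a b. r a b} (map f ys)"
    unfolding prime_decomposition_def
  proof (intro conjI impI ballI allI)
    show "map f ys \<noteq> []" using ys by simp
    fix B assume "B \<in> set (map f ys)"
    then obtain y where y: "y \<in> set ys" "B = f y" unfolding set_map by blast
    obtain t l u where "y = (t, l, u)" by (rule prod_cases3)
    then have B: "(t, l, u) \<in> set ys" "B = run_shape t l u" using y by (simp_all add: f_def)
    show "unmixed_partition TYPE('k) (rows B) (parts B)"
      unfolding unmixed_partition_iff B(2) by (rule unmixed_prime_shape.diagram[OF run_shape(1)[OF run[OF B(1)]]])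
    show "\<not> is_square (boxes_of B)" if "1 < length (map f ys)"
      unfolding B(2) using that by (intro not_is_square_run_shape run[OF B(1)] ns[OF _ B(1)]) simp
  next
    show "{(a, n + 1 - b) | a b. r a b} = (\<Union>B\<in>set (map f ys). boxes_of B)"
    proof (intro equalityI subsetI)
      fix p assume "p \<in> {(a, n + 1 - b) | a b. r a b}"
      then obtain a b where ab: "p = (a, n + 1 - b)" "r a b" by blast
      then obtain t l u where tlu: "(t, l, u) \<in> set ys" "a \<in> {l..u}" "b \<in> {l..u}" using cover by blast
      have "p \<in> boxes_of (run_shape t l u)" unfolding boxes_of_run_shape[OF run[OF tlu(1)]] using ab tlu by blast
      then show "p \<in> (\<Union>B\<in>set (map f ys). boxes_of B)" 
        using imageI[OF tlu(1), of f] by (intro UN_I[of "run_shape t l u"]) (simp_all add: f_def)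
    next
      fix p assume "p \<in> (\<Union>B\<in>set (map f ys). boxes_of B)"
      then obtain y where y: "y \<in> set ys" "p \<in> boxes_of (f y)" unfolding set_map by blast
      obtain t l u where "y = (t, l, u)" by (rule prod_cases3)
      then have tlu: "(t, l, u) \<in> set ys" "p \<in> boxes_of (run_shape t l u)"
        using y by (simp_all add: f_def)
      then show "p \<in> {(a, n + 1 - b) | a b. r a b}" unfolding boxes_of_run_shape[OF run[OF tlu(1)]] by blast
    qed
  next
    fix q assume q: "Suc q < length (map f ys)"
    obtain t l u where 1: "ys ! q = (t, l, u)" by (cases "ys ! q") auto
    obtain t' l' u' where 2: "ys ! Suc q = (t', l', u')" by (cases "ys ! Suc q") auto
    have "(t, l, u) \<in> set ys" "(t', l', u') \<in> set ys"
      using nth_mem[of q ys] nth_mem[of "Suc q" ys] q 1 2 by simp_all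
    then have "run t l u" "run t' l' u'" by (simp_all add: run)
    moreover have "adjacent_runs (t, l, u) (t', l', u')"
      using adj[unfolded successively_conv_nth, rule_format, of q] q 1 2 by simp
    ultimately have A: "orientation (run_shape t l u) \<noteq> orientation (run_shape t' l' u')"
      "boxes_of (run_shape t l u) \<inter> boxes_of (run_shape t' l' u') = bottom_left_of (run_shape t l u)"
      "boxes_of (run_shape t l u) \<inter> boxes_of (run_shape t' l' u') = top_right_of (run_shape t' l' u')"
      by (rule adjacent_run_shapes)+
    have f: "map f ys ! q = run_shape t l u" "map f ys ! Suc q = run_shape t' l' u'"
      using q 1 2 by (simp_all add: f_def)
    show "orientation (map f ys ! q) \<noteq> orientation (map f ys ! Suc q)"
      "boxes_of (map f ys ! q) \<inter> boxes_of (map f ys ! Suc q) = bottom_left_of (map f ys ! q)"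
      "boxes_of (map f ys ! q) \<inter> boxes_of (map f ys ! Suc q) = top_right_of (map f ys ! Suc q)"
      unfolding f by (rule A)+
  qed
  then show ?thesis by blast
qed

end

lemma shape_chain_prime_decomposition:
  assumes "prime_decomposition TYPE('k::field) D Bs"
  shows "shape_chain Bs" "D = (\<Union>B\<in>set Bs. boxes_of B)"
proof -
  show "D = (\<Union>B\<in>set Bs. boxes_of B)" using assms by (simp add: prime_decomposition_def)
  show "shape_chain Bs"
  proof (rule shape_chain.intro)
    show "unmixed_prime_shape B" if "B \<in> set Bs" for B :: prime_shape
      using assms that unfolding unmixed_prime_shape_def unmixed_partition_iff[where 'k='k, symmetric]
      by (simp add: prime_decomposition_def)
    show "bottom_left_of (Bs ! q) = top_right_of (Bs ! Suc q)" if "Suc q < length Bs" for q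
    proof -
      have "boxes_of (Bs ! q) \<inter> boxes_of (Bs ! Suc q) = bottom_left_of (Bs ! q)"
        "boxes_of (Bs ! q) \<inter> boxes_of (Bs ! Suc q) = top_right_of (Bs ! Suc q)"
        using assms that unfolding prime_decomposition_def by blast+
      then show ?thesis by (rule trans[OF sym])
    qed
  qed (use assms in \<open>simp_all add: prime_decomposition_def\<close>)
qed

section \<open>Connected skew shapes\<close>

lemma column_nonempty:
  assumes "skew_shape n lam mu" "skew_graph_connected n lam mu" "j \<in> {1..lam 1}"
  shows "\<exists>i. (i, j) \<in> skew_diagram n lam mu"
proof -
  have "X 1 \<in> skew_vars n lam" "Y j \<in> skew_vars n lam"
    using assms(1,3) by (auto simp: skew_vars_def skew_shape_def)
  then have "(X 1, Y j) \<in> (skew_edges n lam mu)\<^sup>*" using assms(2) by (simp add: skew_graph_connected_def)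
  then obtain v where "(v, Y j) \<in> skew_edges n lam mu" by (rule rtranclE) auto
  then show ?thesis by (auto simp: skew_edges_def)
qed

lemma connected_preorder_box_rel:
  assumes sh: "skew_shape n lam mu" and conn: "skew_graph_connected n lam mu" and ln: "lam 1 = n"
    and refl: "\<forall>k\<in>{1..n}. box_rel n (skew_diagram n lam mu) k k"
    and tr: "transitive_filling (box_rel n (skew_diagram n lam mu)) v"
  shows "connected_preorder n (box_rel n (skew_diagram n lam mu))"
proof
  let ?D = "skew_diagram n lam mu" and ?r = "box_rel n (skew_diagram n lam mu)"
  show field: "i \<in> {1..n} \<and> c \<in> {1..n}" if "?r i c" for i c using that by (simp add: box_rel_def)
  show "?r i i" if "i \<in> {1..n}" for i using refl that by blast
  show "?r i c" if "?r i k" "?r k c" for i k c using tr that unfolding transitive_filling_def by blast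
  show "1 \<le> n" using sh by (simp add: skew_shape_def)
  have anti: "lam i' \<le> lam i" "mu i' \<le> mu i" if "i \<in> {1..n}" "i' \<in> {1..n}" "i \<le> i'" for i i'
    using sh that by (auto simp: skew_shape_def monotone_on_def)
  show convex: "?r a b" if "?r i c" "?r i' c'" "i \<le> a" "a \<le> i'" "c' \<le> b" "b \<le> c" for i c i' c' a b
    using that anti(2)[of i a] anti(1)[of a i'] by (auto simp: box_rel_def skew_diagram_def)
  show "?r i (i + 1) \<or> ?r (i + 1) i" if i: "1 \<le> i" "i < n" for i
  proof (rule ccontr)
    assume neg: "\<not> ?thesis"
    \<comment> \<open>A box joining the two sides of the cut spans with the antidiagonal box of
      \<open>i\<close> a rectangle that contains a box relating \<open>i\<close> and
      \<open>i + 1\<close>.\<close>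
    have side: "a \<le> i \<longleftrightarrow> b \<le> i" if ab: "?r a b" for a b
    proof (rule ccontr)
      assume "\<not> ?thesis"
      then consider "a \<le> i" "i < b" | "b \<le> i" "i < a" by linarith
      then show False
      proof cases
        case 1
        have "?r i (i + 1)"
          using convex[OF ab, of i i i "i + 1"] refl i 1 field[OF ab] by simp
        then show False using neg by blast
      next
        case 2
        have "?r (i + 1) i"
          using convex[OF _ ab, of i i "i + 1" i] refl i 2 field[OF ab] by simp
        then show False using neg by blast
      qed
    qed
    \<comment> \<open>The vertices on one side of the cut. No edge leaves this set, although it
      separates \<open>X 1\<close> from \<open>X (i + 1)\<close>.\<close>
    define Z where "Z = X ` {1..i} \<union> Y ` {j. n + 1 - j \<le> i}"
    have step: "y \<in> Z" if xy: "(x, y) \<in> skew_edges n lam mu" "x \<in> Z" for x y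
    proof -
      obtain a j where aj: "(a, j) \<in> ?D" "(x = X a \<and> y = Y j) \<or> (x = Y j \<and> y = X a)"
        using xy(1) by (auto simp: skew_edges_def)
      have "n + 1 - (n + 1 - j) = j" "n + 1 - j \<in> {1..n}" "a \<in> {1..n}"
        using skew_diagram_bounds[OF sh aj(1)] unfolding ln by auto
      then have "?r a (n + 1 - j)" using aj(1) by (simp add: box_rel_def)
      then have "a \<le> i \<longleftrightarrow> n + 1 - j \<le> i" by (rule side)
      then show ?thesis using aj(2) xy(2) \<open>a \<in> {1..n}\<close> by (auto simp: Z_def)
    qed
    have "(X 1, X (i + 1)) \<in> (skew_edges n lam mu)\<^sup>*"
      using conn i unfolding skew_graph_connected_def skew_vars_def by auto
    then have "X (i + 1) \<in> Z"
    proof (induction rule: rtrancl_induct)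
      case base
      show ?case using i by (auto simp: Z_def)
    qed (rule step)
    then show False by (auto simp: Z_def)
  qed
qed

text \<open>Holds for every decomposition of the shape: the corner \<open>(1, n)\<close> fixes the
  common antidiagonal, so that \<open>box_rel\<close> is the union of the relations of the shapes
  and the condition splits.\<close>

lemma decomposition_filling_iff:
  assumes sh: "skew_shape n lam mu" and ln: "lam 1 = n"
    and refl: "\<forall>k\<in>{1..n}. box_rel n (skew_diagram n lam mu) k k"
    and dec: "prime_decomposition TYPE('k::field) (skew_diagram n lam mu) Bs"
  shows "transitive_filling (box_rel n (skew_diagram n lam mu)) (\<lambda>i c. w (i, n + 1 - c)) \<longleftrightarrow>
    (\<forall>B\<in>set Bs. \<forall>b\<in>blocks_of B. \<forall>p\<in>b. \<forall>q\<in>b. w p = w q) \<and>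
    (\<forall>B\<in>set Bs. orientation B = Upper \<longrightarrow> increasing_along (boxes_of B) w) \<and>
    (\<forall>B\<in>set Bs. orientation B = Lower \<longrightarrow> decreasing_along (boxes_of B) w)"
proof -
  let ?D = "skew_diagram n lam mu" and ?v = "\<lambda>i c. w (i, n + 1 - c)"
  interpret shape_chain Bs by (rule shape_chain_prime_decomposition(1)[OF dec])
  note D = shape_chain_prime_decomposition(2)[OF dec]
  have sub: "(\<Union>B\<in>set Bs. boxes_of B) \<subseteq> {1..n} \<times> {1..n}"
    unfolding D[symmetric] using skew_diagram_bounds[OF sh] unfolding ln by auto
  have "(1, n) \<in> ?D" using refl[rule_format, of 1] sh by (simp add: box_rel_def skew_shape_def)
  then have s: "diagonal_sum (hd Bs) = n + 1" using diagonal_sum_Union[OF sub] unfolding D by blast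
  have rel: "box_rel n ?D = (\<lambda>a b. \<exists>B\<in>set Bs. shape_rel B a b)"
    unfolding D by (intro ext box_rel_Union[OF sub s])
  have shape: "transitive_filling (shape_rel B) ?v \<longleftrightarrow> (\<forall>b\<in>blocks_of B. \<forall>p\<in>b. \<forall>q\<in>b. w p = w q) \<and>
      (orientation B = Upper \<longrightarrow> increasing_along (boxes_of B) w) \<and>
      (orientation B = Lower \<longrightarrow> decreasing_along (boxes_of B) w)" if B: "B \<in> set Bs" for B
    unfolding unmixed_prime_shape.filling_conditions_iff[OF shapes[OF B]] diagonal_sum_set[OF B] s ..
  show ?thesis
    unfolding rel transitive_filling_iff ball_conj_distrib[symmetric] by (rule ball_cong[OF HOL.refl shape])
qed

theorem theorem1p9:
  fixes n :: nat and lam mu :: "nat \<Rightarrow> nat" and w :: "nat \<times> nat \<Rightarrow> nat"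
  assumes "skew_shape n lam mu"
    and "\<forall>b\<in>skew_diagram n lam mu. w b > 0"
    and "skew_graph_connected n lam mu"
  shows "unmixed (poly_ring (skew_vars n lam)) (skew_tableau_ideal n lam mu w :: 'k::field mpoly set) \<longleftrightarrow>
    unmixed (poly_ring (skew_vars n lam)) (skew_ferrers_ideal n lam mu :: 'k mpoly set) \<and>
    (\<exists>Bs. prime_decomposition TYPE('k) (skew_diagram n lam mu) Bs \<and>
      (\<forall>B\<in>set Bs. \<forall>b\<in>blocks_of B. \<forall>p\<in>b. \<forall>q\<in>b. w p = w q) \<and>
      (\<forall>B\<in>set Bs. orientation B = Upper \<longrightarrow> increasing_along (boxes_of B) w) \<and>
      (\<forall>B\<in>set Bs. orientation B = Lower \<longrightarrow> decreasing_along (boxes_of B) w))"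
proof -
  let ?D = "skew_diagram n lam mu"
  let ?r = "box_rel n ?D"
  have iff: "unmixed (poly_ring (skew_vars n lam)) (skew_tableau_ideal n lam mu u :: 'k mpoly set) \<longleftrightarrow>
      lam 1 = n \<and> (\<forall>k\<in>{1..n}. ?r k k) \<and> transitive_filling ?r (\<lambda>i c. u (i, n + 1 - c))"
    if "\<forall>b\<in>?D. u b > 0" for u
    using unmixed_skew_tableau_iff[OF assms(1) column_nonempty[OF assms(1,3)] that] .
  have ferrers: "unmixed (poly_ring (skew_vars n lam)) (skew_ferrers_ideal n lam mu :: 'k mpoly set) \<longleftrightarrow>
      lam 1 = n \<and> (\<forall>k\<in>{1..n}. ?r k k) \<and> transitive_filling ?r (\<lambda>_ _. 1)"
    unfolding skew_ferrers_ideal_def using iff[of "\<lambda>_. 1"] by simp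
  \<comment> \<open>Existence serves the forward implication; in the converse the decomposition is
    given.\<close>
  have ex: "\<exists>Bs. prime_decomposition TYPE('k) ?D Bs"
    if ln: "lam 1 = n" and refl: "\<forall>k\<in>{1..n}. ?r k k" and tr: "transitive_filling ?r (\<lambda>_ _. 1)"
  proof -
    interpret connected_preorder n ?r by (rule connected_preorder_box_rel[OF assms(1,3) that])
    have "?D = {(a, n + 1 - b) | a b. ?r a b}"
    proof (intro equalityI subsetI)
      fix p assume "p \<in> ?D"
      then obtain i j where p: "p = (i, j)" "(i, j) \<in> ?D" by (cases p) auto
      have "i \<in> {1..n}" "n + 1 - j \<in> {1..n}" "n + 1 - (n + 1 - j) = j"
        using skew_diagram_bounds[OF assms(1) p(2)] unfolding ln by auto
      then have "?r i (n + 1 - j)" "p = (i, n + 1 - (n + 1 - j))" using p by (simp_all add: box_rel_def)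
      then show "p \<in> {(a, n + 1 - b) | a b. ?r a b}" by blast
    qed (auto simp: box_rel_def)
    then show ?thesis using exists_prime_decomposition[where 'k='k] by simp
  qed
  have weaken: "transitive_filling ?r (\<lambda>_ _. 1)" if "transitive_filling ?r v" for v
    using that unfolding transitive_filling_def by simp
  note filling = decomposition_filling_iff[OF assms(1), where w = w and 'k = 'k]
  show ?thesis
    unfolding iff[OF assms(2)] ferrers
  proof (rule iffI; elim conjE exE)
    assume R: "lam 1 = n" "\<forall>k\<in>{1..n}. ?r k k" and tr: "transitive_filling ?r (\<lambda>i c. w (i, n + 1 - c))"
    obtain Bs where Bs: "prime_decomposition TYPE('k) ?D Bs" using ex[OF R weaken[OF tr]] by (rule exE)
    have "(\<forall>B\<in>set Bs. \<forall>b\<in>blocks_of B. \<forall>p\<in>b. \<forall>q\<in>b. w p = w q) \<and>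
        (\<forall>B\<in>set Bs. orientation B = Upper \<longrightarrow> increasing_along (boxes_of B) w) \<and>
        (\<forall>B\<in>set Bs. orientation B = Lower \<longrightarrow> decreasing_along (boxes_of B) w)"
      using tr unfolding filling[OF R Bs] .
    then show "(lam 1 = n \<and> (\<forall>k\<in>{1..n}. ?r k k) \<and> transitive_filling ?r (\<lambda>_ _. 1)) \<and>
      (\<exists>Bs. prime_decomposition TYPE('k) ?D Bs \<and>
        (\<forall>B\<in>set Bs. \<forall>b\<in>blocks_of B. \<forall>p\<in>b. \<forall>q\<in>b. w p = w q) \<and>
        (\<forall>B\<in>set Bs. orientation B = Upper \<longrightarrow> increasing_along (boxes_of B) w) \<and>
        (\<forall>B\<in>set Bs. orientation B = Lower \<longrightarrow> decreasing_along (boxes_of B) w))"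
      using R weaken[OF tr] Bs by blast
  next
    fix Bs assume R: "lam 1 = n" "\<forall>k\<in>{1..n}. ?r k k" and dec: "prime_decomposition TYPE('k) ?D Bs"
      and F: "\<forall>B\<in>set Bs. \<forall>b\<in>blocks_of B. \<forall>p\<in>b. \<forall>q\<in>b. w p = w q"
        "\<forall>B\<in>set Bs. orientation B = Upper \<longrightarrow> increasing_along (boxes_of B) w"
        "\<forall>B\<in>set Bs. orientation B = Lower \<longrightarrow> decreasing_along (boxes_of B) w"
    have "transitive_filling ?r (\<lambda>i c. w (i, n + 1 - c))"
      unfolding filling[OF R dec] by (intro conjI F)
    then show "lam 1 = n \<and> (\<forall>k\<in>{1..n}. ?r k k) \<and> transitive_filling ?r (\<lambda>i c. w (i, n + 1 - c))"
      using R by (intro conjI)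
  qed
qed

end
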